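(* Let $G$ be a compact group with identity $e$ and normalized Haar measure $m_G$, let $X$ be a complex Banach space, let $\Phi$ be a Young function, and let $\nu$ be a nonzero $X$-valued vector measure on $G$ which is absolutely continuous with respect to $m_G$ and norm integral translation invariant. Then $L^\Phi(\nu)$ has a left approximate identity; that is, there exists a net $(g_\lambda)_{\lambda\in\Lambda}$ in $L^\Phi(\nu)$ such that (i) $g_\lambda\in\mathcal{C}(G)$ for all $\lambda\in\Lambda$; (ii) $g_\lambda\ge 0$ for all $\lambda\in\Lambda$; (iii) $\operatorname{supp}(g_\beta)\subset\operatorname{supp}(g_\alpha)$ whenever $\alpha\preccurlyeq\beta$ in $\Lambda$; (iv) $\operatorname{supp}(g_\lambda)\to\{e\}$ as $\lambda\to\infty$; (v) $\int_G g_\lambda\,dm_G=1$ for all $\lambda\in\Lambda$; (vi) $\lim_\lambda\|g_\lambda*f-f\|_{\nu,\Phi}=0$ for every $f\in L^\Phi(\nu)$.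
   Context: $\mathcal{B}(G)$ is the Borel $\sigma$-algebra of $G$; $\mathcal{C}(G)$ is the space of continuous complex functions on $G$. Condition (iv) means that for every neighbourhood $U$ of $e$ there is $\lambda_0\in\Lambda$ with $\operatorname{supp}(g_\lambda)\subset U$ for all $\lambda\succcurlyeq\lambda_0$. A vector measure $\nu$ is a $\sigma$-additive map $\mathcal{B}(G)\to X$. $X'$ is the topological dual of $X$, $B_{X'}$ its closed unit ball; for $x'\in X'$, $\langle\nu,x'\rangle(A)=\langle\nu(A),x'\rangle$ is a complex measure with total variation $|\langle\nu,x'\rangle|$. $\nu$ is absolutely continuous w.r.t. $m_G$ if $\nu(A)\to0$ as $m_G(A)\to 0$. A set $A$ is $\nu$-null if $\nu(B)=0$ for all Borel $B\subset A$; functions equal off a $\nu$-null set are identified. $\tau_s f(t)=f(s^{-1}t)$. For a simple function $\phi=\sum_i\alpha_i\chi_{A_i}$, $I_\nu(\phi)=\int_G\phi\,d\nu=\sum_i\alpha_i\nu(A_i)$. $\nu$ is norm integral translation invariant if $\|I_\nu(\tau_s\phi)\|=\|I_\nu(\phi)\|$ for every simple function $\phi$ on $G$ and every $s\in G$. A Young function is a strictly increasing, convex, continuous $\Phi:[0,\infty)\to[0,\infty)$ with $\Phi(t)=0$ iff $t=0$ and $\lim_{t\to\infty}\Phi(t)=\infty$. For a finite positive measure $\mu$, $\|f\|_{L^\Phi(\mu)}=\inf\{k>0:\int_G\Phi(|f|/k)\,d\mu\le 1\}$. $L^\Phi_w(\nu)$ is the space of complex measurable $f$ with $\|f\|_{\nu,\Phi}=\sup_{x'\in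 B_{X'}}\|f\|_{L^\Phi(|\langle\nu,x'\rangle|)}<\infty$, and $L^\Phi(\nu)$ is the closure of the simple functions in it under $\|\cdot\|_{\nu,\Phi}$. For such $\nu$, $\nu$-null sets and $m_G$-null sets coincide and $L^\Phi_w(\nu)\subset L^1(G)$, so the usual convolution $f*g(t)=\int_G f(s)g(s^{-1}t)\,dm_G(s)$ is defined. *)

theory Defs
  imports "HOL-Analysis.Analysis"
begin

text \<open>
  Compact groups are compact types of class \<open>topological_group_add\<close> that are Hausdorff.  This class
  does not assume commutativity, but it is written additively: \<open>s + t\<close>, \<open>- s\<close>, \<open>0\<close> stand for
  \<open>s t\<close>, the inverse of \<open>s\<close>, and the identity \<open>e\<close>.
\<close>

class complex_banach = banach +
  fixes scaleC :: "complex \<Rightarrow> 'a \<Rightarrow> 'a" (infixr "*\<^sub>C" 75)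
  assumes scaleC_add_right: "a *\<^sub>C (x + y) = a *\<^sub>C x + a *\<^sub>C y"
    and scaleC_add_left: "(a + b) *\<^sub>C x = a *\<^sub>C x + b *\<^sub>C x"
    and scaleC_scaleC: "a *\<^sub>C (b *\<^sub>C x) = (a * b) *\<^sub>C x"
    and scaleC_of_real: "complex_of_real r *\<^sub>C x = r *\<^sub>R x"
    and norm_scaleC: "norm (a *\<^sub>C x) = cmod a * norm x"

instantiation complex :: complex_banach
begin

definition scaleC_complex :: "complex \<Rightarrow> complex \<Rightarrow> complex"
  where "scaleC_complex a x = a * x"

instance
  by standard (simp_all add: scaleC_complex_def algebra_simps norm_mult scaleR_conv_of_real)

end

definition dual_unit_ball :: "('x::complex_banach \<Rightarrow> complex) set" where
  "dual_unit_ball =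
     {x'. bounded_linear x' \<and> (\<forall>c x. x' (c *\<^sub>C x) = c * x' x) \<and> onorm x' \<le> 1}"

text \<open>A Haar measure is required to be regular: on a non-metrizable compact group, translation
  invariance alone does not determine a Borel probability measure.\<close>

definition normalized_haar_measure :: "'g::topological_group_add measure \<Rightarrow> bool" where
  "normalized_haar_measure m \<longleftrightarrow>
     sets m = sets borel \<and>
     emeasure m UNIV = 1 \<and>
     (\<forall>s. \<forall>A \<in> sets borel. emeasure m ((+) s ` A) = emeasure m A) \<and>
     (\<forall>A \<in> sets borel. emeasure m A = (INF U \<in> {U. open U \<and> A \<subseteq> U}. emeasure m U)) \<and>
     (\<forall>U. open U \<longrightarrow> emeasure m U = (SUP K \<in> {K. compact K \<and> K \<subseteq> U}. emeasure m K))"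

text \<open>Vector measures are functions on all sets of which only the values on Borel sets matter.\<close>

definition vector_measure ::
    "('g::topological_space set \<Rightarrow> 'x::real_normed_vector) \<Rightarrow> bool" where
  "vector_measure \<nu> \<longleftrightarrow>
     (\<forall>A :: nat \<Rightarrow> 'g set. range A \<subseteq> sets borel \<and> disjoint_family A \<longrightarrow>
        (\<lambda>n. \<nu> (A n)) sums \<nu> (\<Union>n. A n))"

definition nonzero_vector_measure ::
    "('g::topological_space set \<Rightarrow> 'x::real_normed_vector) \<Rightarrow> bool" where
  "nonzero_vector_measure \<nu> \<longleftrightarrow> (\<exists>A \<in> sets borel. \<nu> A \<noteq> 0)"

definition abs_continuous_wrt ::
    "('g::topological_space set \<Rightarrow> 'x::real_normed_vector) \<Rightarrow> 'g measure \<Rightarrow> bool" where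
  "abs_continuous_wrt \<nu> m \<longleftrightarrow>
     (\<forall>\<epsilon>>0. \<exists>\<delta>>0. \<forall>A \<in> sets borel. measure m A < \<delta> \<longrightarrow> norm (\<nu> A) < \<epsilon>)"

definition translate :: "'g::group_add \<Rightarrow> ('g \<Rightarrow> 'b) \<Rightarrow> 'g \<Rightarrow> 'b" where
  "translate s f = (\<lambda>t. f (- s + t))"

text \<open>The integral of a simple function, computed from its canonical representation.\<close>

definition simple_vector_integral ::
    "('g set \<Rightarrow> 'x::complex_banach) \<Rightarrow> ('g \<Rightarrow> complex) \<Rightarrow> 'x" where
  "simple_vector_integral \<nu> \<phi> = (\<Sum>\<alpha> \<in> range \<phi>. \<alpha> *\<^sub>C \<nu> (\<phi> -` {\<alpha>}))"

definition norm_integral_translation_invariant ::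
    "('g::topological_group_add set \<Rightarrow> 'x::complex_banach) \<Rightarrow> bool" where
  "norm_integral_translation_invariant \<nu> \<longleftrightarrow>
     (\<forall>\<phi> s. simple_function borel \<phi> \<longrightarrow>
        norm (simple_vector_integral \<nu> (translate s \<phi>)) = norm (simple_vector_integral \<nu> \<phi>))"

text \<open>The total variation, as a Borel measure, of a complex measure \<open>\<mu>\<close> (a complex-valued
  \<^const>\<open>vector_measure\<close>); the partitions \<open>P\<close> are finite families of pairwise disjoint Borel sets.\<close>

definition total_variation :: "('g::topological_space set \<Rightarrow> complex) \<Rightarrow> 'g measure" where
  "total_variation \<mu> = measure_of UNIV (sets borel)
     (\<lambda>A. SUP P \<in> {P. finite P \<and> disjoint P \<and> P \<subseteq> sets borel \<and> \<Union>P = A}.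
        \<Sum>B\<in>P. ennreal (cmod (\<mu> B)))"

text \<open>Only the values on \<open>[0, \<infinity>)\<close> of a Young function matter.\<close>

definition Young_function :: "(real \<Rightarrow> real) \<Rightarrow> bool" where
  "Young_function \<Phi> \<longleftrightarrow>
     (\<forall>t\<ge>0. 0 \<le> \<Phi> t) \<and>
     strict_mono_on {0..} \<Phi> \<and> convex_on {0..} \<Phi> \<and> continuous_on {0..} \<Phi> \<and>
     (\<forall>t\<ge>0. \<Phi> t = 0 \<longleftrightarrow> t = 0) \<and>
     filterlim \<Phi> at_top at_top"

text \<open>Norms take values in \<^typ>\<open>ennreal\<close>; the infimum of the empty set is \<open>\<infinity>\<close>.\<close>

definition Luxemburg_norm :: "(real \<Rightarrow> real) \<Rightarrow> 'g measure \<Rightarrow> ('g \<Rightarrow> complex) \<Rightarrow> ennreal" where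
  "Luxemburg_norm \<Phi> \<mu> f =
     Inf {ennreal k | k. k > 0 \<and> (\<integral>\<^sup>+ t. ennreal (\<Phi> (cmod (f t) / k)) \<partial>\<mu>) \<le> 1}"

definition Orlicz_norm ::
    "(real \<Rightarrow> real) \<Rightarrow> ('g::topological_space set \<Rightarrow> 'x::complex_banach) \<Rightarrow> ('g \<Rightarrow> complex) \<Rightarrow> ennreal"
  where
  "Orlicz_norm \<Phi> \<nu> f =
     (SUP x' \<in> dual_unit_ball. Luxemburg_norm \<Phi> (total_variation (\<lambda>A. x' (\<nu> A))) f)"

text \<open>The elements of the Orlicz spaces are represented by Borel functions; no quotient by
  almost everywhere equality is taken.\<close>

definition weak_Orlicz_space ::
    "(real \<Rightarrow> real) \<Rightarrow> ('g::topological_space set \<Rightarrow> 'x::complex_banach) \<Rightarrow> ('g \<Rightarrow> complex) set" where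
  "weak_Orlicz_space \<Phi> \<nu> = {f \<in> borel_measurable borel. Orlicz_norm \<Phi> \<nu> f < \<infinity>}"

definition Orlicz_space ::
    "(real \<Rightarrow> real) \<Rightarrow> ('g::topological_space set \<Rightarrow> 'x::complex_banach) \<Rightarrow> ('g \<Rightarrow> complex) set" where
  "Orlicz_space \<Phi> \<nu> =
     {f \<in> weak_Orlicz_space \<Phi> \<nu>.
        \<forall>\<epsilon>>0. \<exists>\<phi>. simple_function borel \<phi> \<and> Orlicz_norm \<Phi> \<nu> (\<lambda>t. f t - \<phi> t) < \<epsilon>}"

definition convolution ::
    "'g::group_add measure \<Rightarrow> ('g \<Rightarrow> complex) \<Rightarrow> ('g \<Rightarrow> complex) \<Rightarrow> 'g \<Rightarrow> complex" where
  "convolution m f g = (\<lambda>t. LINT s|m. f s * g (- s + t))"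

definition supp :: "('g::topological_space \<Rightarrow> complex) \<Rightarrow> 'g set" where
  "supp f = closure {t. f t \<noteq> 0}"

definition directed_set :: "'i set \<Rightarrow> ('i \<Rightarrow> 'i \<Rightarrow> bool) \<Rightarrow> bool" where
  "directed_set \<Lambda> le \<longleftrightarrow>
     \<Lambda> \<noteq> {} \<and>
     (\<forall>a\<in>\<Lambda>. le a a) \<and>
     (\<forall>a\<in>\<Lambda>. \<forall>b\<in>\<Lambda>. \<forall>c\<in>\<Lambda>. le a b \<longrightarrow> le b c \<longrightarrow> le a c) \<and>
     (\<forall>a\<in>\<Lambda>. \<forall>b\<in>\<Lambda>. \<exists>c\<in>\<Lambda>. le a c \<and> le b c)"

end

theory Submission
  imports Defs
begin

text \<open>
  Write \<open>\<parallel>f\<parallel>\<close> for the Orlicz norm of \<open>f\<close> with respect to \<open>\<nu>\<close>, and \<open>\<tau>\<^sub>s f(t) = f(-s + t)\<close>.  The convolution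
  \<open>g * f\<close> is an average of the translates \<open>\<tau>\<^sub>s f\<close> with weights \<open>g(s) dm(s)\<close>.  So two facts make
  kernels \<open>g \<ge> 0\<close> of integral 1 with shrinking supports an approximate identity: such averages do
  not increase the norm, and \<open>\<tau>\<^sub>s f \<rightarrow> f\<close> as \<open>s \<rightarrow> 0\<close>.  For continuous \<open>f\<close> the second fact is uniform
  continuity; by the first fact it extends to the closure of the continuous functions, which is
  \<open>L\<^sup>\<Phi>(\<nu>)\<close> because \<open>m\<close> is regular and \<open>\<nu>\<close> is absolutely continuous.

  The norm is invariant under translation.  For \<open>x'\<close> in the dual unit ball the map
  \<open>I\<^sub>\<nu>(\<phi>) \<mapsto> x'(I\<^sub>\<nu>(\<tau>\<^sub>s \<phi>))\<close> is well defined and contractive on the integrals of simple functions,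
  because \<open>\<parallel>I\<^sub>\<nu>(\<tau>\<^sub>s \<phi>)\<parallel> = \<parallel>I\<^sub>\<nu>(\<phi>)\<parallel>\<close>.  By the Hahn-Banach theorem it extends to some \<open>y'\<close> in the dual
  unit ball (\<open>dual_functional_translate\<close>).  The total variation of \<open>\<langle>\<nu>, y'\<rangle>\<close> is then that of
  \<open>\<langle>\<nu>, x'\<rangle>\<close> carried along by a translation, so that every Luxemburg norm entering \<open>\<parallel>\<tau>\<^sub>s f\<parallel>\<close> is one
  that enters \<open>\<parallel>f\<parallel>\<close> (\<open>Orlicz_norm_translate_le\<close>).

  The group need not be metrizable, so \<open>(s, t) \<mapsto> f(-s + t)\<close> need not be measurable for the product
  of the Borel \<open>\<sigma>\<close>-algebras, and Fubini's theorem is avoided.  For continuous \<open>f\<close>, the convolution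
  \<open>g * f\<close> is a uniform limit of finite convex combinations of translates of \<open>f\<close>; this gives
  \<open>\<parallel>g * f\<parallel> \<le> \<parallel>f\<parallel>\<close> (\<open>conv_continuous\<close>).  Its special case \<open>g = 1\<close> has a second use:
  \<open>1 * |f|\<close> is the constant \<open>\<integral> |f(-s)| dm(s)\<close>, and therefore
  \<open>\<integral> |f(-s)| dm(s) \<cdot> \<parallel>1\<parallel> \<le> \<parallel>f\<parallel>\<close>.  This estimate passes to simple functions and then to all \<open>f\<close>
  (\<open>L1_bound\<close>).  It shows that if continuous \<open>h\<close> tend to \<open>f\<close> in the Orlicz norm, then \<open>g * h\<close> tends
  to \<open>g * f\<close> uniformly, whence \<open>\<parallel>g * f\<parallel> \<le> \<parallel>f\<parallel>\<close> for all \<open>f\<close> in \<open>L\<^sup>\<Phi>(\<nu>)\<close> (\<open>conv_of_C_closure\<close>).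

  The net is indexed by the open neighbourhoods \<open>U\<close> of \<open>0\<close>: \<open>g\<^sub>U\<close> is a normalized Urysohn function
  with support in \<open>U\<close> and \<open>g\<^sub>U(0) \<noteq> 0\<close>, and \<open>U\<close> precedes \<open>V\<close> if \<open>supp g\<^sub>V \<subseteq> supp g\<^sub>U\<close>.
\<close>

section \<open>The Hahn-Banach theorem\<close>

definition sublinear :: "('a::real_vector \<Rightarrow> real) \<Rightarrow> bool" where
  "sublinear p \<longleftrightarrow>
     (\<forall>x y. p (x + y) \<le> p x + p y) \<and> (\<forall>c x. 0 \<le> c \<longrightarrow> p (c *\<^sub>R x) = c * p x)"

lemma sublinear_lower_bound:
  assumes "sublinear p"
  shows "- p (- x) \<le> p x"
proof -
  have "p (x + - x) \<le> p x + p (- x)" "p (0 *\<^sub>R x) = 0 * p x"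
    using assms unfolding sublinear_def by blast+
  then show ?thesis by simp
qed

lemma sublinear_norm: "sublinear (norm :: 'a::real_normed_vector \<Rightarrow> real)"
  by (simp add: sublinear_def norm_triangle_ineq)

text \<open>
  Lowers \<open>p\<close> as far as the prescribed values \<open>r\<close> at \<open>v\<close>, with \<open>(v, r)\<close> in the convex cone \<open>R\<close>,
  allow: the reduced functional is \<open>q x = inf {p (x + v) - r | (v, r) \<in> R}\<close>.  The infimum is finite
  because \<open>r \<le> p v\<close> on \<open>R\<close>.  A linear functional below \<open>q\<close> is at least \<open>r\<close> at \<open>v\<close>, since
  \<open>q (- v) \<le> - r\<close>.  This one construction serves both to prescribe values in the Hahn-Banach theorem
  and to show that a minimal sublinear functional is linear.
\<close>

lemma sublinear_reduction:
  fixes p :: "'a::real_vector \<Rightarrow> real" and R :: "('a \<times> real) set"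
  assumes p: "sublinear p"
    and zero: "(0, 0) \<in> R"
    and add: "\<And>v r w s. (v, r) \<in> R \<Longrightarrow> (w, s) \<in> R \<Longrightarrow> (v + w, r + s) \<in> R"
    and scale: "\<And>c v r. 0 \<le> c \<Longrightarrow> (v, r) \<in> R \<Longrightarrow> (c *\<^sub>R v, c * r) \<in> R"
    and dom: "\<And>v r. (v, r) \<in> R \<Longrightarrow> r \<le> p v"
  obtains q where "sublinear q" "\<And>x. q x \<le> p x" "\<And>v r. (v, r) \<in> R \<Longrightarrow> q (- v) \<le> - r"
proof
  define D where "D = (\<lambda>x. (\<lambda>(v, r). p (x + v) - r) ` R)"
  define q where "q = (\<lambda>x. Inf (D x))"
  have p_add: "p (x + y) \<le> p x + p y" for x y using p by (simp add: sublinear_def)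
  have p_scale: "p (c *\<^sub>R x) = c * p x" if "0 \<le> c" for c x using p that by (simp add: sublinear_def)
  have ne: "D x \<noteq> {}" for x using zero by (auto simp: D_def)
  have bdd: "bdd_below (D x)" for x
  proof (rule bdd_belowI)
    fix a assume "a \<in> D x"
    then obtain v r where vr: "(v, r) \<in> R" "a = p (x + v) - r" by (auto simp: D_def)
    have "p ((x + v) + - x) \<le> p (x + v) + p (- x)" by (rule p_add)
    then show "- p (- x) \<le> a" using dom[OF vr(1)] vr(2) by simp
  qed
  have q_le: "q x \<le> p (x + v) - r" if "(v, r) \<in> R" for x v r
    unfolding q_def by (rule cInf_lower[OF _ bdd]) (use that in \<open>force simp: D_def\<close>)
  have q_ge: "b \<le> q x" if "\<And>v r. (v, r) \<in> R \<Longrightarrow> b \<le> p (x + v) - r" for b x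
    unfolding q_def by (rule cInf_greatest[OF ne]) (use that in \<open>auto simp: D_def\<close>)
  show "q x \<le> p x" for x using q_le[OF zero, of x] by simp
  show "q (- v) \<le> - r" if "(v, r) \<in> R" for v r
    using q_le[OF that, of "- v"] p_scale[of 0 0] by simp
  have q_add: "q (x + y) \<le> q x + q y" for x y
  proof -
    have *: "q (x + y) \<le> (p (x + v) - r) + (p (y + w) - s)"
      if "(v, r) \<in> R" "(w, s) \<in> R" for v r w s
    proof -
      have "q (x + y) \<le> p ((x + y) + (v + w)) - (r + s)" by (rule q_le[OF add[OF that]])
      also have "p ((x + y) + (v + w)) \<le> p (x + v) + p (y + w)"
        using p_add[of "x + v" "y + w"] by (simp add: algebra_simps)
      finally show ?thesis by simp
    qed
    have "q (x + y) - (p (y + w) - s) \<le> q x" if "(w, s) \<in> R" for w s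
      by (rule q_ge) (use * that in fastforce)
    then have "q (x + y) - q x \<le> q y"
      by (intro q_ge) (force simp: algebra_simps)
    then show ?thesis by simp
  qed
  have q_scale: "c * q x \<le> q (c *\<^sub>R x)" if c: "0 < c" for c x
  proof (rule q_ge)
    fix v r assume vr: "(v, r) \<in> R"
    have "q x \<le> p (x + (1 / c) *\<^sub>R v) - (1 / c) * r"
      by (rule q_le[OF scale[OF _ vr]]) (use c in simp)
    then have "c * q x \<le> c * p (x + (1 / c) *\<^sub>R v) - r"
      using c by (simp add: field_simps)
    also have "c * p (x + (1 / c) *\<^sub>R v) = p (c *\<^sub>R x + v)"
      using p_scale[of c "x + (1 / c) *\<^sub>R v"] c by (simp add: scaleR_add_right)
    finally show "c * q x \<le> p (c *\<^sub>R x + v) - r" .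
  qed
  have "q (c *\<^sub>R x) = c * q x" if c: "0 \<le> c" for c x
  proof (cases "c = 0")
    case True
    have "0 \<le> q 0" by (rule q_ge) (use dom in auto)
    moreover have "q 0 \<le> 0" using q_le[OF zero, of 0] p_scale[of 0 0] by simp
    ultimately show ?thesis using True by simp
  next
    case False
    with c have c: "0 < c" by simp
    have "(1 / c) * q (c *\<^sub>R x) \<le> q x" using q_scale[of "1 / c" "c *\<^sub>R x"] c by simp
    then have "q (c *\<^sub>R x) \<le> c * q x" using c by (simp add: field_simps)
    then show ?thesis using q_scale[OF c, of x] by simp
  qed
  then show "sublinear q" using q_add by (simp add: sublinear_def)
qed

text \<open>
  By Zorn's lemma there is a minimal sublinear functional \<open>q \<le> p\<close>.  Reducing it along the ray
  through any \<open>y\<close> cannot change it, hence \<open>q (- y) \<le> - q y\<close>; so \<open>q\<close> is odd, and a sublinear odd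
  functional is linear.
\<close>

lemma sublinear_dominates_linear:
  fixes p :: "'a::real_vector \<Rightarrow> real"
  assumes p: "sublinear p"
  obtains q where "linear q" "\<And>x. q x \<le> p x"
proof -
  define A where "A = {q. sublinear q \<and> q \<le> p}"
  have "\<exists>q\<in>A. \<forall>a\<in>A. a \<le> q \<longrightarrow> a = q"
  proof (rule predicate_Zorn)
    show "partial_order_on A (relation_of (\<lambda>x y. y \<le> x) A)"
      by (rule partial_order_on_relation_ofI) auto
  next
    fix C assume "C \<in> Chains (relation_of (\<lambda>x y. y \<le> x) A)"
    then have chain: "\<And>a b. a \<in> C \<Longrightarrow> b \<in> C \<Longrightarrow> a \<le> b \<or> b \<le> a" and CA: "C \<subseteq> A"
      by (auto simp: Chains_def relation_of_def)
    show "\<exists>u\<in>A. \<forall>a\<in>C. u \<le> a"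
    proof (cases "C = {}")
      case True
      then show ?thesis using p by (auto simp: A_def)
    next
      case False
      define u where "u = (\<lambda>x. INF q\<in>C. q x)"
      have sub: "sublinear q" if "q \<in> C" for q using that CA by (auto simp: A_def)
      have C_le: "q x \<le> p x" if "q \<in> C" for q x using that CA by (auto simp: A_def le_fun_def)
      have bdd: "bdd_below ((\<lambda>q. q x) ` C)" for x
      proof (rule bdd_belowI2)
        fix q assume "q \<in> C"
        then show "- p (- x) \<le> q x"
          using sublinear_lower_bound[OF sub, of q x] C_le[of q "- x"] by linarith
      qed
      have u_le: "u x \<le> q x" if "q \<in> C" for q x
        unfolding u_def by (rule cINF_lower[OF bdd that])
      have u_ge: "b \<le> u x" if "\<And>q. q \<in> C \<Longrightarrow> b \<le> q x" for b x
        unfolding u_def by (rule cINF_greatest[OF False that])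
      have "u (x + y) \<le> u x + u y" for x y
      proof -
        have *: "u (x + y) \<le> a x + b y" if ab: "a \<in> C" "b \<in> C" for a b
        proof -
          obtain c where c: "c \<in> C" "c \<le> a" "c \<le> b" using chain[OF ab] ab by blast
          have "u (x + y) \<le> c (x + y)" by (rule u_le[OF c(1)])
          also have "\<dots> \<le> c x + c y" using sub[OF c(1)] by (simp add: sublinear_def)
          also have "\<dots> \<le> a x + b y" using c by (simp add: add_mono le_funD)
          finally show ?thesis .
        qed
        have "u (x + y) - b y \<le> u x" if "b \<in> C" for b
          by (rule u_ge) (use * that in fastforce)
        then have "u (x + y) - u x \<le> u y"
          by (intro u_ge) (force simp: algebra_simps)
        then show ?thesis by simp
      qed
      moreover have "u (c *\<^sub>R x) = c * u x" if c: "0 \<le> c" for c x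
      proof -
        have eq: "q (c *\<^sub>R y) = c * q y" if "q \<in> C" for q y
          using sub[OF that] c by (simp add: sublinear_def)
        have "u (c *\<^sub>R x) = (INF q\<in>C. c * q x)" using eq by (simp add: u_def)
        also have "\<dots> = c * u x"
          unfolding u_def
          using continuous_at_Inf_mono[of "\<lambda>t. c * t" "(\<lambda>q. q x) ` C"] c False bdd[of x]
          by (simp add: image_image mono_def mult_left_mono continuous_intros)
        finally show ?thesis .
      qed
      ultimately have "sublinear u" by (simp add: sublinear_def)
      moreover have "u \<le> p" using False u_le C_le by (fastforce simp: le_fun_def intro: order_trans)
      ultimately show ?thesis using u_le by (auto simp: A_def le_fun_def)
    qed
  qed
  then obtain q where q: "sublinear q" "q \<le> p" and min: "\<And>a. sublinear a \<Longrightarrow> a \<le> q \<Longrightarrow> a = q"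
    unfolding A_def by (auto intro: order_trans)
  have q_scale: "q (c *\<^sub>R x) = c * q x" if "0 \<le> c" for c x using q that by (simp add: sublinear_def)
  have neg: "q (- y) = - q y" for y
  proof -
    define R where "R = (\<lambda>t. (t *\<^sub>R y, t * q y)) ` {0..}"
    obtain q' where q': "sublinear q'" "\<And>x. q' x \<le> q x" "\<And>v r. (v, r) \<in> R \<Longrightarrow> q' (- v) \<le> - r"
    proof (rule sublinear_reduction[OF q(1), of R])
      show "(0, 0) \<in> R" by (auto simp: R_def image_iff intro!: bexI[of _ 0])
      show "(v + w, r + s) \<in> R" if "(v, r) \<in> R" "(w, s) \<in> R" for v r w s
      proof -
        from that obtain a b where "0 \<le> a" "0 \<le> b" "v = a *\<^sub>R y" "r = a * q y" "w = b *\<^sub>R y" "s = b * q y"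
          by (auto simp: R_def)
        then show ?thesis
          by (auto simp: R_def image_iff algebra_simps intro!: bexI[of _ "a + b"])
      qed
      show "(c *\<^sub>R v, c * r) \<in> R" if "0 \<le> c" "(v, r) \<in> R" for c v r
      proof -
        from that obtain a where "0 \<le> a" "v = a *\<^sub>R y" "r = a * q y" by (auto simp: R_def)
        then show ?thesis using that
          by (auto simp: R_def image_iff intro!: bexI[of _ "c * a"])
      qed
      show "r \<le> q v" if "(v, r) \<in> R" for v r using that q_scale by (auto simp: R_def)
    qed blast
    have "(y, q y) \<in> R" by (auto simp: R_def image_iff intro!: bexI[of _ 1])
    moreover have "q' = q" using q'(1,2) by (intro min) (auto simp: le_fun_def)
    ultimately have "q (- y) \<le> - q y" using q'(3) by blast
    then show ?thesis using sublinear_lower_bound[OF q(1), of y] by linarith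
  qed
  have q_add: "q (x + y) = q x + q y" for x y
  proof -
    have "q (x + y) \<le> q x + q y" "q ((x + y) + - y) \<le> q (x + y) + q (- y)"
      using q(1) unfolding sublinear_def by blast+
    then show ?thesis using neg[of y] by simp
  qed
  have "q (c *\<^sub>R x) = c * q x" for c x
  proof (cases "0 \<le> c")
    case False
    then have "q ((- c) *\<^sub>R (- x)) = (- c) * q (- x)" by (intro q_scale) simp
    then show ?thesis by (simp add: neg)
  qed (rule q_scale)
  then have "linear q" using q_add by (intro linearI) simp_all
  then show thesis using q(2) by (intro that) (auto simp: le_fun_def)
qed

lemma scaleC_zero_left [simp]: "0 *\<^sub>C x = 0"
  using scaleC_of_real[of 0 x] by simp

lemma scaleC_one [simp]: "1 *\<^sub>C x = x"
  using scaleC_of_real[of 1 x] by simp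

lemma scaleC_zero_right [simp]: "a *\<^sub>C 0 = 0"
  using norm_scaleC[of a 0] by simp

lemma scaleC_sum_right: "a *\<^sub>C sum f A = (\<Sum>x\<in>A. a *\<^sub>C f x)"
  by (induction A rule: infinite_finite_induct) (simp_all add: scaleC_add_right)

lemma dual_unit_ballD:
  assumes "x' \<in> dual_unit_ball"
  shows "bounded_linear x'" "x' (c *\<^sub>C x) = c * x' x" "cmod (x' x) \<le> norm x"
proof -
  show bl: "bounded_linear x'" and "x' (c *\<^sub>C x) = c * x' x"
    using assms by (auto simp: dual_unit_ball_def)
  have "cmod (x' x) \<le> onorm x' * norm x" by (rule onorm[OF bl])
  also have "\<dots> \<le> 1 * norm x"
    using assms by (intro mult_right_mono) (auto simp: dual_unit_ball_def)
  finally show "cmod (x' x) \<le> norm x" by simp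
qed

text \<open>
  The complex Hahn-Banach theorem.  The functional to be extended is given by its graph \<open>R\<close>, a
  complex subspace; that it is single-valued follows from \<open>dom\<close>.  The real part is extended by
  reducing the norm along \<open>R\<close>, and \<open>l\<close> is completed to the complex functional
  \<open>x \<mapsto> l x - \<i> l (\<i> x)\<close>.
\<close>

lemma dual_unit_ball_extension:
  fixes R :: "('x::complex_banach \<times> complex) set"
  assumes ne: "R \<noteq> {}"
    and add: "\<And>v a w b. (v, a) \<in> R \<Longrightarrow> (w, b) \<in> R \<Longrightarrow> (v + w, a + b) \<in> R"
    and scale: "\<And>c v a. (v, a) \<in> R \<Longrightarrow> (c *\<^sub>C v, c * a) \<in> R"
    and dom: "\<And>v a. (v, a) \<in> R \<Longrightarrow> cmod a \<le> norm v"
  obtains y' where "y' \<in> dual_unit_ball" "\<And>v a. (v, a) \<in> R \<Longrightarrow> y' v = a"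
proof -
  define S where "S = (\<lambda>(v, a). (v, Re a)) ` R"
  have S_I: "(v, Re a) \<in> S" if "(v, a) \<in> R" for v a using that by (force simp: S_def)
  obtain q where q: "sublinear q" "\<And>x. q x \<le> norm x" "\<And>v r. (v, r) \<in> S \<Longrightarrow> q (- v) \<le> - r"
  proof (rule sublinear_reduction[OF sublinear_norm, of S])
    obtain v a where "(v, a) \<in> R" using ne by auto
    from S_I[OF scale[OF this, of 0]] show "(0, 0) \<in> S" by simp
    show "(v + w, r + s) \<in> S" if "(v, r) \<in> S" "(w, s) \<in> S" for v r w s
      using that add S_I by (fastforce simp: S_def)
    show "(c *\<^sub>R v, c * r) \<in> S" if cv: "0 \<le> c" "(v, r) \<in> S" for c v r
    proof -
      obtain a where a: "(v, a) \<in> R" "r = Re a" using cv by (auto simp: S_def)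
      show ?thesis using S_I[OF scale[OF a(1), of "complex_of_real c"]] a(2)
        by (simp add: scaleC_of_real)
    qed
    show "r \<le> norm v" if "(v, r) \<in> S" for v r
      using that dom complex_Re_le_cmod by (fastforce simp: S_def intro: order_trans)
  qed blast
  obtain l where l: "linear l" "\<And>x. l x \<le> q x" using sublinear_dominates_linear[OF q(1)] by blast
  interpret l: linear l by (rule l(1))
  have l_norm: "l x \<le> norm x" for x using l(2)[of x] q(2)[of x] by simp
  have l_R: "l v = Re a" if va: "(v, a) \<in> R" for v a
  proof -
    have "l (- v) \<le> - Re a" using l(2)[of "- v"] q(3)[OF S_I[OF va]] by simp
    moreover have "l v \<le> Re a"
      using l(2)[of v] q(3)[OF S_I[OF scale[OF va, of "- 1"]]] scaleC_of_real[of "- 1" v] by simp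
    ultimately show ?thesis by (simp add: l.neg)
  qed
  define y' where "y' = (\<lambda>x. Complex (l x) (- l (\<i> *\<^sub>C x)))"
  have y'_add: "y' (x + y) = y' x + y' y" for x y
    by (simp add: y'_def complex_eq_iff scaleC_add_right l.add)
  have y'_real: "y' (r *\<^sub>R x) = complex_of_real r * y' x" for r x
  proof -
    have "\<i> *\<^sub>C (r *\<^sub>R x) = r *\<^sub>R (\<i> *\<^sub>C x)"
      by (simp add: scaleC_scaleC mult.commute flip: scaleC_of_real)
    then show ?thesis by (simp add: y'_def complex_eq_iff l.scale)
  qed
  have y'_i: "y' (\<i> *\<^sub>C x) = \<i> * y' x" for x
  proof -
    have "\<i> *\<^sub>C (\<i> *\<^sub>C x) = - x"
      using scaleC_of_real[of "- 1" x] by (simp add: scaleC_scaleC)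
    then show ?thesis by (simp add: y'_def complex_eq_iff l.neg)
  qed
  have y'_scale: "y' (c *\<^sub>C x) = c * y' x" for c x
  proof -
    have "c *\<^sub>C x = Re c *\<^sub>R x + Im c *\<^sub>R (\<i> *\<^sub>C x)"
      by (simp add: scaleC_scaleC flip: scaleC_of_real scaleC_add_left)
         (metis complex_eq mult.commute)
    then have "y' (c *\<^sub>C x) = (complex_of_real (Re c) + \<i> * complex_of_real (Im c)) * y' x"
      by (simp add: y'_add y'_real y'_i algebra_simps)
    then show ?thesis by (simp flip: complex_eq)
  qed
  have y'_norm: "cmod (y' x) \<le> norm x" for x
  proof -
    \<comment> \<open>Rotating \<open>x\<close> by this phase makes the value of \<open>y'\<close> real, so that it is a value of \<open>l\<close>.\<close>
    define c where "c = cnj (sgn (y' x))"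
    have "cnj (sgn z) * z = complex_of_real (cmod z)" for z
      by (cases "z = 0")
         (simp_all add: sgn_eq mult.commute[of "cnj z"] power2_eq_square flip: complex_norm_square)
    then have "y' (c *\<^sub>C x) = complex_of_real (cmod (y' x))"
      by (simp add: y'_scale c_def)
    then have "cmod (y' x) = l (c *\<^sub>C x)" by (simp add: y'_def complex_eq_iff)
    also have "\<dots> \<le> norm (c *\<^sub>C x)" by (rule l_norm)
    also have "\<dots> \<le> norm x"
      by (simp add: norm_scaleC c_def norm_sgn)
    finally show ?thesis .
  qed
  have "bounded_linear y'"
    by (rule bounded_linear_intro[where K = 1])
       (simp_all add: y'_add y'_real y'_norm scaleR_conv_of_real)
  moreover have "onorm y' \<le> 1" by (rule onorm_bound) (simp_all add: y'_norm)
  ultimately have "y' \<in> dual_unit_ball" by (simp add: dual_unit_ball_def y'_scale)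
  moreover have "y' v = a" if "(v, a) \<in> R" for v a
    using l_R[OF that] l_R[OF scale[OF that, of \<i>]] by (simp add: y'_def complex_eq_iff)
  ultimately show thesis by (rule that)
qed

lemma dual_unit_ball_norming:
  fixes x :: "'x::complex_banach"
  obtains x' where "x' \<in> dual_unit_ball" "x' x = complex_of_real (norm x)"
proof -
  define R where "R = range (\<lambda>c. (c *\<^sub>C x, c * complex_of_real (norm x)))"
  obtain y' where y': "y' \<in> dual_unit_ball" "\<And>v a. (v, a) \<in> R \<Longrightarrow> y' v = a"
  proof (rule dual_unit_ball_extension[of R])
    show "R \<noteq> {}" by (simp add: R_def)
    show "(v + w, a + b) \<in> R" if vw: "(v, a) \<in> R" "(w, b) \<in> R" for v a w b
    proof -
      obtain c d where "v = c *\<^sub>C x" "a = c * complex_of_real (norm x)"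
          "w = d *\<^sub>C x" "b = d * complex_of_real (norm x)"
        using vw by (auto simp: R_def)
      then have "(v + w, a + b) = ((c + d) *\<^sub>C x, (c + d) * complex_of_real (norm x))"
        by (simp add: scaleC_add_left algebra_simps)
      then show ?thesis unfolding R_def by blast
    qed
    show "(c *\<^sub>C v, c * a) \<in> R" if "(v, a) \<in> R" for c v a
      using that by (auto simp: R_def scaleC_scaleC mult.assoc[symmetric])
    show "cmod a \<le> norm v" if "(v, a) \<in> R" for v a
      using that by (auto simp: R_def norm_scaleC norm_mult)
  qed blast
  have "(1 *\<^sub>C x, 1 * complex_of_real (norm x)) \<in> R" unfolding R_def by (rule rangeI)
  then show thesis using that y' by simp
qed

section \<open>Vector measures and the total variation\<close>

lemma vector_measureD:
  fixes A :: "nat \<Rightarrow> 'g::topological_space set"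
  assumes "vector_measure \<nu>" "\<And>n. A n \<in> sets borel" "disjoint_family A"
  shows "(\<lambda>n. \<nu> (A n)) sums \<nu> (\<Union>n. A n)"
  using assms unfolding vector_measure_def by blast

lemma vector_measure_empty:
  assumes "vector_measure \<nu>"
  shows "\<nu> {} = 0"
proof -
  have "(\<lambda>n::nat. \<nu> {}) sums \<nu> (\<Union>n::nat. {})"
    by (rule vector_measureD[OF assms]) (auto simp: disjoint_family_on_def)
  then have "(\<lambda>n::nat. \<nu> {}) \<longlonglongrightarrow> 0" by (intro summable_LIMSEQ_zero sums_summable)
  then show ?thesis by (simp add: LIMSEQ_const_iff)
qed

lemma vector_measure_Un:
  assumes \<nu>: "vector_measure \<nu>"
    and AB: "A \<in> sets borel" "B \<in> sets borel" "A \<inter> B = {}"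
  shows "\<nu> (A \<union> B) = \<nu> A + \<nu> B"
proof -
  have "(\<lambda>n. \<nu> (binaryset A B n)) sums \<nu> (\<Union>n. binaryset A B n)"
    using AB by (intro vector_measureD[OF \<nu>]) (auto simp: disjoint_family_on_def binaryset_def)
  then have "(\<lambda>n. \<nu> (binaryset A B n)) sums \<nu> (A \<union> B)"
    by (simp add: UN_binaryset_eq)
  moreover have "(\<lambda>n. \<nu> (binaryset A B n)) sums (\<nu> A + \<nu> B)"
    by (rule binaryset_sums[of \<nu>]) (rule vector_measure_empty[OF \<nu>])
  ultimately show ?thesis by (rule sums_unique2)
qed

lemma vector_measure_finite_UN:
  assumes \<nu>: "vector_measure \<nu>"
    and "finite I" "\<And>i. i \<in> I \<Longrightarrow> F i \<in> sets borel" "disjoint_family_on F I"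
  shows "\<nu> (\<Union>i\<in>I. F i) = (\<Sum>i\<in>I. \<nu> (F i))"
  using assms(2-)
proof (induction I rule: finite_induct)
  case empty
  then show ?case by (simp add: vector_measure_empty[OF \<nu>])
next
  case (insert i I)
  have "F i \<inter> (\<Union>j\<in>I. F j) = {}"
    using insert.hyps insert.prems by (auto simp: disjoint_family_on_def)
  moreover have "(\<Union>j\<in>I. F j) \<in> sets borel"
    using insert.hyps insert.prems by (intro sets.finite_UN) auto
  ultimately have "\<nu> (F i \<union> (\<Union>j\<in>I. F j)) = \<nu> (F i) + \<nu> (\<Union>j\<in>I. F j)"
    using insert.prems by (intro vector_measure_Un[OF \<nu>]) auto
  moreover have "\<nu> (\<Union>j\<in>I. F j) = (\<Sum>j\<in>I. \<nu> (F j))"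
    using insert.prems by (intro insert.IH) (auto simp: disjoint_family_on_def)
  ultimately show ?case using insert.hyps by simp
qed

text \<open>
  The differences of consecutive sets are disjoint, so the values telescope along a convergent
  series.
\<close>

lemma vector_measure_decseq_convergent:
  assumes \<nu>: "vector_measure \<nu>"
    and A: "\<And>n. A n \<in> sets borel" "decseq A"
  shows "convergent (\<lambda>n. \<nu> (A n))"
proof -
  define D where "D = (\<lambda>n. A n - A (Suc n))"
  have "D n \<inter> D k = {}" if "n < k" for n k
    using decseqD[OF A(2), of "Suc n" k] that by (auto simp: D_def)
  then have "disjoint_family D"
    unfolding disjoint_family_on_def by (metis linorder_less_linear inf_commute)
  then have "summable (\<lambda>n. \<nu> (D n))"
    using A(1) by (intro sums_summable[OF vector_measureD[OF \<nu>]]) (auto simp: D_def)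
  then have conv: "convergent (\<lambda>n. \<Sum>i<n. \<nu> (D i))" by (simp add: summable_iff_convergent)
  have "\<nu> (A n) = \<nu> (A 0) - (\<Sum>i<n. \<nu> (D i))" for n
  proof (induction n)
    case (Suc n)
    have "A n = A (Suc n) \<union> D n" using decseqD[OF A(2), of n "Suc n"] by (auto simp: D_def)
    moreover have "\<nu> (A (Suc n) \<union> D n) = \<nu> (A (Suc n)) + \<nu> (D n)"
      using A(1) by (intro vector_measure_Un[OF \<nu>]) (auto simp: D_def)
    ultimately show ?case using Suc by (simp add: algebra_simps)
  qed simp
  then have "(\<lambda>n. \<nu> (A n)) = (\<lambda>n. \<nu> (A 0) - (\<Sum>i<n. \<nu> (D i)))" by (rule ext)
  then show ?thesis by (metis convergent_diff[OF convergent_const conv])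
qed

text \<open>
  Call a set unbounded if \<open>\<nu>\<close> is unbounded on its Borel subsets.  An unbounded set splits into two
  parts on both of which \<open>\<nu>\<close> is large, and one of the parts is again unbounded.  Iterating gives
  decreasing sets \<open>A\<^sub>n\<close> with \<open>\<parallel>\<nu> A\<^sub>n\<parallel> \<rightarrow> \<infinity>\<close>, although \<open>\<nu> A\<^sub>n\<close> converges.
\<close>

lemma vector_measure_bounded:
  assumes \<nu>: "vector_measure \<nu>"
  obtains S where "\<And>A. A \<in> sets borel \<Longrightarrow> norm (\<nu> A) \<le> S"
proof -
  define unb where
    "unb = (\<lambda>A. A \<in> sets borel \<and> \<not> (\<exists>S. \<forall>B\<in>sets borel. B \<subseteq> A \<longrightarrow> norm (\<nu> B) \<le> S))"
  have step: "\<exists>A'. unb A' \<and> A' \<subseteq> A \<and> real n \<le> norm (\<nu> A')" if A: "unb A" for A n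
  proof -
    obtain B where B: "B \<in> sets borel" "B \<subseteq> A" "norm (\<nu> A) + real n < norm (\<nu> B)"
      using A unfolding unb_def by (meson not_le)
    have AB: "A - B \<in> sets borel" using A B by (auto simp: unb_def)
    have "\<nu> A = \<nu> B + \<nu> (A - B)"
      using vector_measure_Un[OF \<nu> B(1) AB] B(2) by (simp add: Un_absorb1)
    then have "norm (\<nu> B) \<le> norm (\<nu> A) + norm (\<nu> (A - B))"
      by (metis add_diff_cancel_right' norm_triangle_ineq4)
    then have large: "real n \<le> norm (\<nu> (A - B))" "real n \<le> norm (\<nu> B)"
      using B(3) norm_ge_zero[of "\<nu> A"] by linarith+
    have "unb B \<or> unb (A - B)"
    proof (rule ccontr)
      assume "\<not> (unb B \<or> unb (A - B))"
      then have "\<exists>S. \<forall>C\<in>sets borel. C \<subseteq> B \<longrightarrow> norm (\<nu> C) \<le> S"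
          "\<exists>S. \<forall>C\<in>sets borel. C \<subseteq> A - B \<longrightarrow> norm (\<nu> C) \<le> S"
        using B(1) AB by (simp_all add: unb_def)
      then obtain S T where S: "\<forall>C\<in>sets borel. C \<subseteq> B \<longrightarrow> norm (\<nu> C) \<le> S"
        and T: "\<forall>C\<in>sets borel. C \<subseteq> A - B \<longrightarrow> norm (\<nu> C) \<le> T"
        by (elim exE)
      have "norm (\<nu> C) \<le> S + T" if C: "C \<in> sets borel" "C \<subseteq> A" for C
      proof -
        have "\<nu> C = \<nu> (C \<inter> B) + \<nu> (C - B)"
          using vector_measure_Un[OF \<nu>, of "C \<inter> B" "C - B"] C B(1)
          by (simp add: Int_Diff_Un Int_Diff_disjoint)
        then show ?thesis
          using S[rule_format, of "C \<inter> B"] T[rule_format, of "C - B"] C B(1)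
          by (auto intro!: order_trans[OF norm_triangle_ineq] add_mono)
      qed
      then have "\<exists>S. \<forall>C\<in>sets borel. C \<subseteq> A \<longrightarrow> norm (\<nu> C) \<le> S" by blast
      moreover have "\<not> (\<exists>S. \<forall>C\<in>sets borel. C \<subseteq> A \<longrightarrow> norm (\<nu> C) \<le> S)"
        using A unfolding unb_def by (rule conjunct2)
      ultimately show False by contradiction
    qed
    then show ?thesis using large B(2) by blast
  qed
  show thesis
  proof (cases "unb UNIV")
    case False
    then have "\<exists>S. \<forall>B\<in>sets borel. norm (\<nu> B) \<le> S" by (simp add: unb_def)
    then obtain S where "\<forall>B\<in>sets borel. norm (\<nu> B) \<le> S" by (elim exE)
    then show ?thesis by (intro that[of S]) simp
  next
    case True
    \<comment> \<open>The sets shrink while the norms of their values grow beyond all bounds.\<close>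
    have "\<exists>A. \<forall>n. unb (A n) \<and> (A (Suc n) \<subseteq> A n \<and> real n \<le> norm (\<nu> (A (Suc n))))"
    proof (rule dependent_nat_choice)
      show "\<exists>A. unb A" using True by (rule exI)
      show "\<exists>A'. unb A' \<and> (A' \<subseteq> A \<and> real n \<le> norm (\<nu> A'))" if "unb A" for A n
        using that by (rule step)
    qed
    then obtain A where A: "\<And>n. unb (A n)" "\<And>n. A (Suc n) \<subseteq> A n"
        "\<And>n. real n \<le> norm (\<nu> (A (Suc n)))" by blast
    have "convergent (\<lambda>n. \<nu> (A n))"
      using A(1,2) by (intro vector_measure_decseq_convergent[OF \<nu>] decseq_SucI) (auto simp: unb_def)
    then have "Bseq (\<lambda>n. \<nu> (A n))" by (rule convergent_imp_Bseq)
    then obtain K where K: "\<And>n. norm (\<nu> (A n)) \<le> K" by (auto simp: Bseq_def)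
    obtain n where "K < real n" using reals_Archimedean2 by blast
    then show ?thesis using K[of "Suc n"] A(3)[of n] by simp
  qed
qed

text \<open>
  The set function from which \<^const>\<open>total_variation\<close> builds its measure.
\<close>

definition variation :: "('g::topological_space set \<Rightarrow> complex) \<Rightarrow> 'g set \<Rightarrow> ennreal" where
  "variation \<mu> A =
     (SUP P \<in> {P. finite P \<and> disjoint P \<and> P \<subseteq> sets borel \<and> \<Union>P = A}.
        \<Sum>B\<in>P. ennreal (cmod (\<mu> B)))"

text \<open>
  Partitions may be given as indexed families: members that coincide are empty, so they contribute
  nothing on either side.
\<close>

lemma variation_upper:
  assumes \<mu>: "vector_measure \<mu>"
    and F: "finite I" "\<And>i. i \<in> I \<Longrightarrow> F i \<in> sets borel" "disjoint_family_on F I"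
      "(\<Union>i\<in>I. F i) = A"
  shows "(\<Sum>i\<in>I. ennreal (cmod (\<mu> (F i)))) \<le> variation \<mu> A"
proof -
  have "sum (\<lambda>B. ennreal (cmod (\<mu> B))) (F ` I) = sum ((\<lambda>B. ennreal (cmod (\<mu> B))) \<circ> F) I"
  proof (rule sum.reindex_nontrivial[OF F(1)])
    fix i j assume "i \<in> I" "j \<in> I" "i \<noteq> j" "F i = F j"
    then have "F i = {}" using F(3) by (auto simp: disjoint_family_on_def)
    then show "ennreal (cmod (\<mu> (F i))) = 0" by (simp add: vector_measure_empty[OF \<mu>])
  qed
  then have "(\<Sum>i\<in>I. ennreal (cmod (\<mu> (F i)))) = (\<Sum>B\<in>F ` I. ennreal (cmod (\<mu> B)))"
    by (simp add: o_def)
  also have "\<dots> \<le> variation \<mu> A"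
    unfolding variation_def
    using F by (intro SUP_upper) (auto intro: disjoint_family_on_disjoint_image)
  finally show ?thesis .
qed

lemma variation_least:
  assumes "\<And>P. finite P \<Longrightarrow> disjoint P \<Longrightarrow> P \<subseteq> sets borel \<Longrightarrow> \<Union>P = A \<Longrightarrow>
             (\<Sum>B\<in>P. ennreal (cmod (\<mu> B))) \<le> c"
  shows "variation \<mu> A \<le> c"
  unfolding variation_def using assms by (intro SUP_least) auto

lemma variation_superadditive:
  assumes \<mu>: "vector_measure \<mu>"
    and AB: "A \<in> sets borel" "B \<in> sets borel" "A \<inter> B = {}"
  shows "variation \<mu> A + variation \<mu> B \<le> variation \<mu> (A \<union> B)"
proof -
  define part where
    "part = (\<lambda>A::'a set. {P. finite P \<and> disjoint P \<and> P \<subseteq> sets borel \<and> \<Union>P = A})"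
  define s where "s = (\<lambda>P. \<Sum>B\<in>P. ennreal (cmod (\<mu> B)))"
  have var: "variation \<mu> C = (SUP P\<in>part C. s P)" for C
    by (simp add: variation_def part_def s_def)
  have ne: "part C \<noteq> {}" if "C \<in> sets borel" for C
  proof -
    have "{C} \<in> part C" using that by (simp add: part_def)
    then show ?thesis by blast
  qed
  have *: "s P + s Q \<le> variation \<mu> (A \<union> B)" if P: "P \<in> part A" and Q: "Q \<in> part B" for P Q
  proof -
    have PQ: "C \<inter> D = {}" "D \<inter> C = {}" if "C \<in> P" "D \<in> Q" for C D
      using P Q that AB(3) unfolding part_def by blast+
    have dis: "C \<inter> D = {}" if "C \<noteq> D" "C \<in> P \<and> D \<in> P \<or> C \<in> Q \<and> D \<in> Q" for C D
      using P Q that by (auto simp: part_def dest: disjointD)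
    have "case_sum id id i \<inter> case_sum id id j = {}"
      if "i \<in> P <+> Q" "j \<in> P <+> Q" "i \<noteq> j" for i j
      using that by (elim PlusE) (simp_all add: PQ dis)
    then have dF: "disjoint_family_on (case_sum id id) (P <+> Q)"
      by (simp add: disjoint_family_on_def)
    have "s P + s Q = (\<Sum>i\<in>P <+> Q. ennreal (cmod (\<mu> (case_sum id id i))))"
      using P Q by (simp add: s_def part_def sum.Plus o_def del: sum_ennreal)
    also have "\<dots> \<le> variation \<mu> (A \<union> B)"
    proof (rule variation_upper[OF \<mu> _ _ dF])
      show "finite (P <+> Q)" using P Q by (simp add: part_def)
      show "case_sum id id i \<in> sets borel" if "i \<in> P <+> Q" for i
        using that P Q by (elim PlusE) (auto simp: part_def)
      show "(\<Union>i\<in>P <+> Q. case_sum id id i) = A \<union> B"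
        using P Q by (simp add: part_def Plus_def image_Un image_image)
    qed
    finally show ?thesis .
  qed
  have "s P + variation \<mu> B \<le> variation \<mu> (A \<union> B)" if P: "P \<in> part A" for P
  proof -
    have "s P + variation \<mu> B = (SUP Q\<in>part B. s P + s Q)"
      unfolding var by (rule ennreal_SUP_add_right[OF ne[OF AB(2)]])
    also have "\<dots> \<le> variation \<mu> (A \<union> B)" by (rule SUP_least) (rule *[OF P])
    finally show ?thesis .
  qed
  then have "(SUP P\<in>part A. s P + variation \<mu> B) \<le> variation \<mu> (A \<union> B)" by (rule SUP_least)
  also have "(SUP P\<in>part A. s P + variation \<mu> B) = variation \<mu> A + variation \<mu> B"
    unfolding var[of A] by (rule ennreal_SUP_add_left[OF ne[OF AB(1)]])
  finally show ?thesis .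
qed

lemma variation_finite_superadditive:
  fixes A :: "nat \<Rightarrow> 'g::topological_space set"
  assumes \<mu>: "vector_measure \<mu>"
    and A: "range A \<subseteq> sets borel" "disjoint_family A"
  shows "(\<Sum>i<n. variation \<mu> (A i)) \<le> variation \<mu> (\<Union>i<n. A i)"
proof (induction n)
  case (Suc n)
  have "(\<Sum>i<Suc n. variation \<mu> (A i)) \<le> variation \<mu> (\<Union>i<n. A i) + variation \<mu> (A n)"
    using Suc by (simp add: add_mono)
  also have "\<dots> \<le> variation \<mu> ((\<Union>i<n. A i) \<union> A n)"
  proof (rule variation_superadditive[OF \<mu>])
    have "A i \<inter> A n = {}" if "i < n" for i using A(2) that by (simp add: disjoint_family_on_def)
    then show "(\<Union>i<n. A i) \<inter> A n = {}" by blast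
  qed (use A(1) in auto)
  also have "(\<Union>i<n. A i) \<union> A n = (\<Union>i<Suc n. A i)" by (auto simp: less_Suc_eq)
  finally show ?case .
qed simp

lemma ennreal_norm_sums_le:
  fixes x :: "nat \<Rightarrow> 'a::real_normed_vector"
  assumes "x sums s"
  shows "ennreal (norm s) \<le> (\<Sum>n. ennreal (norm (x n)))"
proof (rule LIMSEQ_le_const2)
  show "(\<lambda>n. ennreal (norm (\<Sum>i<n. x i))) \<longlonglongrightarrow> ennreal (norm s)"
    using assms by (intro tendsto_ennrealI tendsto_norm) (simp add: sums_def)
  have "ennreal (norm (\<Sum>i<n. x i)) \<le> (\<Sum>n. ennreal (norm (x n)))" for n
  proof -
    have "ennreal (norm (\<Sum>i<n. x i)) \<le> ennreal (\<Sum>i<n. norm (x i))"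
      by (intro ennreal_leI norm_sum)
    also have "\<dots> = (\<Sum>i<n. ennreal (norm (x i)))" by (simp add: sum_ennreal)
    also have "\<dots> \<le> (\<Sum>n. ennreal (norm (x n)))" by (intro sum_le_suminf) auto
    finally show ?thesis .
  qed
  then show "\<exists>N. \<forall>n\<ge>N. ennreal (norm (\<Sum>i<n. x i)) \<le> (\<Sum>n. ennreal (norm (x n)))" by blast
qed

text \<open>
  Superadditivity comes from joining partitions, subadditivity from cutting the members of one
  partition of the union along the sets \<open>A i\<close>.
\<close>

lemma variation_countably_additive:
  fixes \<mu> :: "'g::topological_space set \<Rightarrow> complex"
  assumes \<mu>: "vector_measure \<mu>"
  shows "countably_additive (sets borel) (variation \<mu>)"
proof (rule countably_additiveI)
  fix A :: "nat \<Rightarrow> 'g set"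
  assume A: "range A \<subseteq> sets borel" "disjoint_family A" and UA: "(\<Union>i. A i) \<in> sets borel"
  have meas: "A n \<in> sets borel" for n using A by auto
  show "(\<Sum>i. variation \<mu> (A i)) = variation \<mu> (\<Union>i. A i)"
  proof (rule antisym)
    show "(\<Sum>i. variation \<mu> (A i)) \<le> variation \<mu> (\<Union>i. A i)"
    proof (rule suminf_le_const[OF summableI])
      fix n
      have U: "(\<Union>i<n. A i) \<in> sets borel" using meas by auto
      have "(\<Sum>i<n. variation \<mu> (A i)) \<le> variation \<mu> (\<Union>i<n. A i)"
        by (rule variation_finite_superadditive[OF \<mu> A])
      also have "\<dots> \<le> variation \<mu> (\<Union>i<n. A i) + variation \<mu> ((\<Union>i. A i) - (\<Union>i<n. A i))" by simp
      also have "\<dots> \<le> variation \<mu> ((\<Union>i<n. A i) \<union> ((\<Union>i. A i) - (\<Union>i<n. A i)))"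
        using U UA by (intro variation_superadditive[OF \<mu>]) auto
      also have "(\<Union>i<n. A i) \<union> ((\<Union>i. A i) - (\<Union>i<n. A i)) = (\<Union>i. A i)" by auto
      finally show "(\<Sum>i<n. variation \<mu> (A i)) \<le> variation \<mu> (\<Union>i. A i)" .
    qed
    show "variation \<mu> (\<Union>i. A i) \<le> (\<Sum>i. variation \<mu> (A i))"
    proof (rule variation_least)
      fix P assume P: "finite P" "disjoint P" "P \<subseteq> sets borel" "\<Union>P = (\<Union>i. A i)"
      have "ennreal (cmod (\<mu> B)) \<le> (\<Sum>n. ennreal (cmod (\<mu> (B \<inter> A n))))" if B: "B \<in> P" for B
      proof (rule ennreal_norm_sums_le)
        have "(\<lambda>n. \<mu> (B \<inter> A n)) sums \<mu> (\<Union>n. B \<inter> A n)"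
          using A B P(3) by (intro vector_measureD[OF \<mu>]) (auto simp: disjoint_family_on_def)
        moreover have "(\<Union>n. B \<inter> A n) = B" using P(4) B by blast
        ultimately show "(\<lambda>n. \<mu> (B \<inter> A n)) sums \<mu> B" by simp
      qed
      then have "(\<Sum>B\<in>P. ennreal (cmod (\<mu> B))) \<le> (\<Sum>B\<in>P. \<Sum>n. ennreal (cmod (\<mu> (B \<inter> A n))))"
        by (rule sum_mono)
      also have "\<dots> = (\<Sum>n. \<Sum>B\<in>P. ennreal (cmod (\<mu> (B \<inter> A n))))"
        by (rule suminf_sum[symmetric]) (rule summableI)
      also have "\<dots> \<le> (\<Sum>n. variation \<mu> (A n))"
      proof (intro suminf_le summableI variation_upper[OF \<mu>] P(1))
        fix n
        show "B \<inter> A n \<in> sets borel" if "B \<in> P" for B using that P(3) meas by auto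
        show "disjoint_family_on (\<lambda>B. B \<inter> A n) P"
          using P(2) unfolding disjoint_def disjoint_family_on_def by blast
        show "(\<Union>B\<in>P. B \<inter> A n) = A n" using P(4) by blast
      qed
      finally show "(\<Sum>B\<in>P. ennreal (cmod (\<mu> B))) \<le> (\<Sum>i. variation \<mu> (A i))" .
    qed
  qed
qed

lemma sets_total_variation [measurable_cong, simp]: "sets (total_variation \<mu>) = sets borel"
  using sets.sigma_sets_eq[of borel] sets.space_closed[of borel]
  by (simp add: total_variation_def sets_measure_of)

lemma space_total_variation [simp]: "space (total_variation \<mu>) = UNIV"
  using sets_eq_imp_space_eq[OF sets_total_variation] by simp

text \<open>
  Countable additivity of the variation is what makes \<^const>\<open>total_variation\<close> take the intended values;
  the measure generated by a set function that is not a measure would be zero.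
\<close>

lemma emeasure_total_variation:
  assumes \<mu>: "vector_measure \<mu>" and A: "A \<in> sets borel"
  shows "emeasure (total_variation \<mu>) A = variation \<mu> A"
proof (rule emeasure_measure_of[where \<Omega> = UNIV and A = "sets borel" and \<mu> = "variation \<mu>"])
  show "total_variation \<mu> = measure_of UNIV (sets borel) (variation \<mu>)"
    unfolding total_variation_def variation_def ..
  have "variation \<mu> {} = 0"
  proof -
    have "(\<Sum>B\<in>P. ennreal (cmod (\<mu> B))) = 0" if "\<Union>P = {}" for P
    proof (rule sum.neutral, rule ballI)
      fix B assume "B \<in> P"
      then have "B = {}" using that by auto
      then show "ennreal (cmod (\<mu> B)) = 0" by (simp add: vector_measure_empty[OF \<mu>])
    qed
    then show ?thesis by (intro antisym variation_least) simp_all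
  qed
  then show "positive (sets (total_variation \<mu>)) (variation \<mu>)" by (simp add: positive_def)
  show "countably_additive (sets (total_variation \<mu>)) (variation \<mu>)"
    using variation_countably_additive[OF \<mu>] by simp
qed (use A in auto)

lemma norm_le_variation:
  assumes "A \<in> sets borel"
  shows "ennreal (cmod (\<mu> A)) \<le> variation \<mu> A"
  unfolding variation_def using assms by (intro SUP_upper2[of "{A}"]) auto

text \<open>
  The members of a partition on which the real part of \<open>\<mu>\<close> is nonnegative have a union on which \<open>\<mu>\<close>
  is at most \<open>S\<close>, and likewise for the negative real parts and for the imaginary parts.  This
  bounds the variation of \<open>\<langle>\<nu>, x'\<rangle>\<close> by the norms of the values of \<open>\<nu>\<close>, uniformly in \<open>x'\<close>.
\<close>

lemma variation_le_4_sup: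
  fixes \<mu> :: "'g::topological_space set \<Rightarrow> complex"
  assumes \<mu>: "vector_measure \<mu>"
    and S: "\<And>B. B \<in> sets borel \<Longrightarrow> B \<subseteq> A \<Longrightarrow> cmod (\<mu> B) \<le> S"
  shows "variation \<mu> A \<le> ennreal (4 * S)"
proof (rule variation_least)
  fix P assume P: "finite P" "disjoint P" "P \<subseteq> sets borel" "\<Union>P = A"
  have sum_le: "cmod (\<Sum>B\<in>Q. \<mu> B) \<le> S" if "Q \<subseteq> P" for Q
  proof -
    have Q: "finite Q" using that P(1) finite_subset by blast
    have "\<mu> (\<Union>B\<in>Q. B) = (\<Sum>B\<in>Q. \<mu> B)"
      using that P Q by (intro vector_measure_finite_UN[OF \<mu>])
        (auto simp: disjoint_def disjoint_family_on_def)
    moreover have "(\<Union>B\<in>Q. B) \<in> sets borel" using that P Q by (intro sets.finite_UN) auto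
    ultimately show ?thesis using S[of "\<Union>B\<in>Q. B"] that P(4) by auto
  qed
  have part: "(\<Sum>B\<in>P. \<bar>h (\<mu> B)\<bar>) \<le> 2 * S"
    if h: "linear h" "\<And>z. \<bar>h z\<bar> \<le> cmod z" for h :: "complex \<Rightarrow> real"
  proof -
    define Q where "Q = {B\<in>P. 0 \<le> h (\<mu> B)}"
    have h_sum: "\<bar>\<Sum>B\<in>R. h (\<mu> B)\<bar> \<le> S" if "R \<subseteq> P" for R
      using h(2)[of "\<Sum>B\<in>R. \<mu> B"] sum_le[OF that] by (simp add: linear_sum[OF h(1)])
    have "(\<Sum>B\<in>P. \<bar>h (\<mu> B)\<bar>) = (\<Sum>B\<in>Q. \<bar>h (\<mu> B)\<bar>) + (\<Sum>B\<in>P - Q. \<bar>h (\<mu> B)\<bar>)"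
      using sum.subset_diff[of Q P "\<lambda>B. \<bar>h (\<mu> B)\<bar>"] P(1) by (simp add: Q_def)
    also have "(\<Sum>B\<in>Q. \<bar>h (\<mu> B)\<bar>) = (\<Sum>B\<in>Q. h (\<mu> B))"
      by (intro sum.cong) (auto simp: Q_def)
    also have "(\<Sum>B\<in>P - Q. \<bar>h (\<mu> B)\<bar>) = - (\<Sum>B\<in>P - Q. h (\<mu> B))"
      unfolding sum_negf[symmetric] by (intro sum.cong) (auto simp: Q_def)
    finally show ?thesis using h_sum[of Q] h_sum[of "P - Q"] by (auto simp: Q_def)
  qed
  have "(\<Sum>B\<in>P. cmod (\<mu> B)) \<le> (\<Sum>B\<in>P. \<bar>Re (\<mu> B)\<bar> + \<bar>Im (\<mu> B)\<bar>)"
    by (intro sum_mono cmod_le)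
  also have "\<dots> \<le> 2 * S + 2 * S"
    unfolding sum.distrib
    by (intro add_mono part abs_Re_le_cmod abs_Im_le_cmod linearI) auto
  finally have "(\<Sum>B\<in>P. cmod (\<mu> B)) \<le> 4 * S" by simp
  then show "(\<Sum>B\<in>P. ennreal (cmod (\<mu> B))) \<le> ennreal (4 * S)"
    by (simp add: sum_ennreal ennreal_leI)
qed

lemma vector_measure_dual:
  assumes "vector_measure \<nu>" "x' \<in> dual_unit_ball"
  shows "vector_measure (\<lambda>A. x' (\<nu> A))"
  using assms bounded_linear.sums[OF dual_unit_ballD(1)] unfolding vector_measure_def by blast

section \<open>Translation invariance of the Orlicz norm\<close>

lemma measurable_left_add [measurable]:
  "(\<lambda>t. s + t) \<in> borel_measurable (borel :: 'g::topological_group_add measure)"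
  by (intro borel_measurable_continuous_onI continuous_intros)

lemma translate_image_eq_vimage: "(+) s ` A = (\<lambda>t. - s + t) -` A" for s :: "'g::group_add"
proof (intro set_eqI iffI)
  fix t assume "t \<in> (\<lambda>t. - s + t) -` A"
  then have "t = s + (- s + t)" "- s + t \<in> A" by (simp_all add: add.assoc[symmetric])
  then show "t \<in> (+) s ` A" by blast
qed (auto simp: add.assoc[symmetric])

lemma borel_translate_image [measurable]:
  fixes s :: "'g::topological_group_add"
  assumes "A \<in> sets borel"
  shows "(+) s ` A \<in> sets borel"
  using measurable_sets[OF measurable_left_add assms, of "- s"]
  by (simp add: translate_image_eq_vimage)

lemma measurable_translate:
  fixes s :: "'g::topological_group_add"
  assumes "f \<in> borel_measurable borel"
  shows "translate s f \<in> borel_measurable borel"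
  unfolding translate_def using assms by measurable

lemma simple_function_translate:
  fixes \<phi> :: "'g::topological_group_add \<Rightarrow> complex"
  assumes \<phi>: "simple_function borel \<phi>"
  shows "simple_function borel (translate s \<phi>)"
proof (rule simple_function_borel_measurable)
  show "translate s \<phi> \<in> borel_measurable borel"
    by (intro measurable_translate borel_measurable_simple_function \<phi>)
  show "finite (translate s \<phi> ` space borel)"
    by (rule finite_subset[OF _ simple_functionD(1)[OF \<phi>]]) (auto simp: translate_def)
qed

text \<open>
  The integral may be computed from any finite measurable partition (the fibres of \<open>Q\<close>) on whose
  members the function is constant.  Additivity follows by taking a common refinement.
\<close>

lemma simple_vector_integral_refine:
  fixes \<nu> :: "'g::topological_space set \<Rightarrow> 'x::complex_banach"
  assumes \<nu>: "vector_measure \<nu>"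
    and J: "finite J" "\<And>t. Q t \<in> J" "\<And>q. q \<in> J \<Longrightarrow> Q -` {q} \<in> sets borel"
  shows "simple_vector_integral \<nu> (\<lambda>t. f (Q t)) = (\<Sum>q\<in>J. f q *\<^sub>C \<nu> (Q -` {q}))"
proof -
  let ?\<phi> = "\<lambda>t. f (Q t)"
  have "(\<Sum>q\<in>J. f q *\<^sub>C \<nu> (Q -` {q})) = (\<Sum>\<alpha>\<in>f ` J. \<Sum>q\<in>{q\<in>J. f q = \<alpha>}. f q *\<^sub>C \<nu> (Q -` {q}))"
    by (rule sum.image_gen[OF J(1)])
  also have "\<dots> = (\<Sum>\<alpha>\<in>f ` J. \<alpha> *\<^sub>C \<nu> (?\<phi> -` {\<alpha>}))"
  proof (rule sum.cong[OF refl])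
    fix \<alpha>
    have "?\<phi> -` {\<alpha>} = (\<Union>q\<in>{q\<in>J. f q = \<alpha>}. Q -` {q})" using J(2) by auto
    also have "\<nu> \<dots> = (\<Sum>q\<in>{q\<in>J. f q = \<alpha>}. \<nu> (Q -` {q}))"
      using J by (intro vector_measure_finite_UN[OF \<nu>]) (auto simp: disjoint_family_on_def)
    finally have "\<alpha> *\<^sub>C \<nu> (?\<phi> -` {\<alpha>}) = (\<Sum>q\<in>{q\<in>J. f q = \<alpha>}. \<alpha> *\<^sub>C \<nu> (Q -` {q}))"
      by (simp add: scaleC_sum_right)
    also have "\<dots> = (\<Sum>q\<in>{q\<in>J. f q = \<alpha>}. f q *\<^sub>C \<nu> (Q -` {q}))"
      by (intro sum.cong) auto
    finally show "(\<Sum>q\<in>{q\<in>J. f q = \<alpha>}. f q *\<^sub>C \<nu> (Q -` {q})) = \<alpha> *\<^sub>C \<nu> (?\<phi> -` {\<alpha>})" ..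
  qed
  also have "\<dots> = (\<Sum>\<alpha>\<in>range ?\<phi>. \<alpha> *\<^sub>C \<nu> (?\<phi> -` {\<alpha>}))"
  proof (rule sum.mono_neutral_right)
    show "\<forall>\<alpha>\<in>f ` J - range ?\<phi>. \<alpha> *\<^sub>C \<nu> (?\<phi> -` {\<alpha>}) = 0"
    proof
      fix \<alpha> assume "\<alpha> \<in> f ` J - range ?\<phi>"
      then have "\<alpha> \<notin> range ?\<phi>" by blast
      then have "?\<phi> -` {\<alpha>} = {}" by blast
      then show "\<alpha> *\<^sub>C \<nu> (?\<phi> -` {\<alpha>}) = 0" by (simp add: vector_measure_empty[OF \<nu>])
    qed
  qed (use J in auto)
  finally show ?thesis by (simp add: simple_vector_integral_def)
qed

lemma simple_function_borelD:
  assumes "simple_function borel \<phi>"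
  shows "finite (range \<phi>)" "\<phi> -` A \<in> sets borel"
  using simple_functionD[OF assms] by simp_all

lemma simple_vector_integral_indicator:
  assumes \<nu>: "vector_measure \<nu>" and A: "A \<in> sets borel"
  shows "simple_vector_integral \<nu> (\<lambda>t. of_bool (t \<in> A)) = \<nu> A"
proof -
  have "(\<lambda>t. t \<in> A) -` {True} = A" "(\<lambda>t. t \<in> A) -` {False} = - A" by auto
  moreover from this have "(\<lambda>t. t \<in> A) -` {q} \<in> sets borel" for q
    using A by (cases q) (simp_all add: borel_comp)
  ultimately show ?thesis
    using simple_vector_integral_refine[OF \<nu>, of UNIV "\<lambda>t. t \<in> A" of_bool]
    by (simp add: UNIV_bool)
qed

lemma simple_vector_integral_add:
  assumes \<nu>: "vector_measure \<nu>"
    and \<phi>: "simple_function borel \<phi>" and \<psi>: "simple_function borel \<psi>"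
  shows "simple_vector_integral \<nu> (\<lambda>t. \<phi> t + \<psi> t) =
           simple_vector_integral \<nu> \<phi> + simple_vector_integral \<nu> \<psi>"
proof -
  define Q where "Q = (\<lambda>t. (\<phi> t, \<psi> t))"
  define J where "J = range \<phi> \<times> range \<psi>"
  have J: "finite J" "\<And>t. Q t \<in> J" "\<And>q. q \<in> J \<Longrightarrow> Q -` {q} \<in> sets borel"
  proof -
    show "finite J" using \<phi> \<psi> by (simp add: J_def simple_function_borelD)
    show "Q t \<in> J" for t by (simp add: Q_def J_def)
    have "Q -` {(a, b)} = \<phi> -` {a} \<inter> \<psi> -` {b}" for a b by (auto simp: Q_def)
    then show "Q -` {q} \<in> sets borel" for q
      using \<phi> \<psi> by (cases q) (simp add: simple_function_borelD sets.Int)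
  qed
  note refine = simple_vector_integral_refine[OF \<nu>, of J Q, OF J]
  show ?thesis
    using refine[of "\<lambda>(a, b). a + b"] refine[of fst] refine[of snd]
    by (simp add: Q_def case_prod_unfold scaleC_add_left sum.distrib)
qed

lemma simple_vector_integral_scale:
  assumes \<nu>: "vector_measure \<nu>" and \<phi>: "simple_function borel \<phi>"
  shows "simple_vector_integral \<nu> (\<lambda>t. c * \<phi> t) = c *\<^sub>C simple_vector_integral \<nu> \<phi>"
  using simple_vector_integral_refine[OF \<nu>, of "range \<phi>" \<phi>] simple_function_borelD[OF \<phi>]
  by (simp add: simple_vector_integral_def scaleC_sum_right scaleC_scaleC)

text \<open>
  The graph \<open>R\<close> of \<open>I\<^sub>\<nu>(\<phi>) \<mapsto> x' (I\<^sub>\<nu>(\<tau>\<^sub>s \<phi>))\<close> satisfies the domination condition of the Hahn-Banach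
  theorem exactly because \<open>\<nu>\<close> is norm integral translation invariant.
\<close>

lemma dual_functional_translate:
  fixes \<nu> :: "'g::topological_group_add set \<Rightarrow> 'x::complex_banach"
  assumes \<nu>: "vector_measure \<nu>" and inv: "norm_integral_translation_invariant \<nu>"
    and x': "x' \<in> dual_unit_ball"
  obtains y' where "y' \<in> dual_unit_ball"
    "\<And>A. A \<in> sets borel \<Longrightarrow> y' (\<nu> A) = x' (\<nu> ((+) s ` A))"
proof -
  let ?I = "simple_vector_integral \<nu>"
  define R where "R = (\<lambda>\<phi>. (?I \<phi>, x' (?I (translate s \<phi>)))) ` {\<phi>. simple_function borel \<phi>}"
  have RI: "(?I \<phi>, x' (?I (translate s \<phi>))) \<in> R" if "simple_function borel \<phi>" for \<phi>
    using that by (auto simp: R_def)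
  have RE: "\<exists>\<phi>. simple_function borel \<phi> \<and> v = ?I \<phi> \<and> a = x' (?I (translate s \<phi>))"
    if "(v, a) \<in> R" for v a using that by (auto simp: R_def)
  interpret x': bounded_linear x' by (rule dual_unit_ballD(1)[OF x'])
  obtain y' where y': "y' \<in> dual_unit_ball" "\<And>v a. (v, a) \<in> R \<Longrightarrow> y' v = a"
  proof (rule dual_unit_ball_extension[of R])
    show "R \<noteq> {}" using RI[OF simple_function_const] by blast
    show "(v + w, a + b) \<in> R" if va: "(v, a) \<in> R" and wb: "(w, b) \<in> R" for v a w b
    proof -
      obtain \<phi> where \<phi>: "simple_function borel \<phi>" "v = ?I \<phi>" "a = x' (?I (translate s \<phi>))"
        using RE[OF va] by blast
      obtain \<psi> where \<psi>: "simple_function borel \<psi>" "w = ?I \<psi>" "b = x' (?I (translate s \<psi>))"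
        using RE[OF wb] by blast
      have "translate s (\<lambda>t. \<phi> t + \<psi> t) = (\<lambda>t. translate s \<phi> t + translate s \<psi> t)"
        by (simp add: translate_def)
      then show ?thesis
        using RI[OF simple_function_add[OF \<phi>(1) \<psi>(1)]] \<phi> \<psi>
        by (simp add: simple_vector_integral_add[OF \<nu>] simple_function_translate x'.add)
    qed
    show "(c *\<^sub>C v, c * a) \<in> R" if va: "(v, a) \<in> R" for c v a
    proof -
      obtain \<phi> where \<phi>: "simple_function borel \<phi>" "v = ?I \<phi>" "a = x' (?I (translate s \<phi>))"
        using RE[OF va] by blast
      have "translate s (\<lambda>t. c * \<phi> t) = (\<lambda>t. c * translate s \<phi> t)"
        by (simp add: translate_def)
      then show ?thesis
        using RI[OF simple_function_mult[OF simple_function_const \<phi>(1)], of c] \<phi>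
        by (simp add: simple_vector_integral_scale[OF \<nu>] simple_function_translate
            dual_unit_ballD(2)[OF x'])
    qed
    show "cmod a \<le> norm v" if "(v, a) \<in> R" for v a
      using RE[OF that] inv dual_unit_ballD(3)[OF x']
      unfolding norm_integral_translation_invariant_def by metis
  qed blast
  have "y' (\<nu> A) = x' (\<nu> ((+) s ` A))" if A: "A \<in> sets borel" for A
  proof -
    have sf: "simple_function borel (\<lambda>t. of_bool (t \<in> A) :: complex)"
      using simple_function_indicator[of A borel] A
      by (simp add: indicator_def[abs_def] of_bool_def)
    moreover have "translate s (\<lambda>t. of_bool (t \<in> A) :: complex) = (\<lambda>t. of_bool (t \<in> (+) s ` A))"
      by (simp add: translate_def translate_image_eq_vimage)
    ultimately show ?thesis
      using y'(2)[OF RI[OF sf]] A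
      by (simp add: simple_vector_integral_indicator[OF \<nu>] borel_translate_image)
  qed
  with y'(1) show thesis by (rule that)
qed

lemma variation_translate_le:
  fixes s :: "'g::topological_group_add"
  assumes \<mu>: "vector_measure \<mu>"
    and eq: "\<And>B. B \<in> sets borel \<Longrightarrow> \<mu>' B = \<mu> ((+) s ` B)"
  shows "variation \<mu>' A \<le> variation \<mu> ((+) s ` A)"
proof (rule variation_least)
  fix P assume P: "finite P" "disjoint P" "P \<subseteq> sets borel" "\<Union>P = A"
  have "(\<Sum>B\<in>P. ennreal (cmod (\<mu>' B))) = (\<Sum>B\<in>P. ennreal (cmod (\<mu> ((+) s ` B))))"
    using P(3) eq by (intro sum.cong) auto
  also have "\<dots> \<le> variation \<mu> ((+) s ` A)"
  proof (rule variation_upper[OF \<mu> P(1)])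
    show "(+) s ` B \<in> sets borel" if "B \<in> P" for B using that P(3) by (intro borel_translate_image) auto
    show "disjoint_family_on ((`) ((+) s)) P"
      using P(2) unfolding disjoint_def disjoint_family_on_def
      by (simp flip: image_Int)
    show "(\<Union>B\<in>P. (+) s ` B) = (+) s ` A" using P(4) by auto
  qed
  finally show "(\<Sum>B\<in>P. ennreal (cmod (\<mu>' B))) \<le> variation \<mu> ((+) s ` A)" .
qed

text \<open>
  Translation permutes the partitions.  The inequality for \<open>s\<close> and the one for \<open>- s\<close>, with the roles
  of the two measures exchanged, combine to equality.
\<close>

lemma total_variation_translate:
  fixes s :: "'g::topological_group_add"
  assumes \<mu>: "vector_measure \<mu>" and \<mu>': "vector_measure \<mu>'"
    and eq: "\<And>B. B \<in> sets borel \<Longrightarrow> \<mu>' B = \<mu> ((+) s ` B)"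
  shows "total_variation \<mu>' = distr (total_variation \<mu>) borel (\<lambda>t. - s + t)"
proof (rule measure_eqI)
  fix A assume "A \<in> sets (total_variation \<mu>')"
  then have A: "A \<in> sets borel" by simp
  have cancel: "(+) s ` (+) (- s) ` B = B" "(+) (- s) ` (+) s ` B = B" for B
    by (simp_all add: image_image add.assoc[symmetric])
  have "variation \<mu> ((+) s ` A) \<le> variation \<mu>' ((+) (- s) ` (+) s ` A)"
    by (rule variation_translate_le[OF \<mu>']) (simp add: eq borel_translate_image cancel)
  then have "variation \<mu> ((+) s ` A) \<le> variation \<mu>' A" by (simp only: cancel)
  with variation_translate_le[OF \<mu> eq, of A] have "variation \<mu>' A = variation \<mu> ((+) s ` A)" by simp
  moreover have "(\<lambda>t. - s + t) \<in> total_variation \<mu> \<rightarrow>\<^sub>M borel"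
    by measurable
  ultimately show "emeasure (total_variation \<mu>') A =
      emeasure (distr (total_variation \<mu>) borel (\<lambda>t. - s + t)) A"
    using A by (simp add: emeasure_distr emeasure_total_variation \<mu> \<mu>' borel_translate_image
        flip: translate_image_eq_vimage)
qed simp

lemma Young_function_measurable:
  assumes \<Phi>: "Young_function \<Phi>" and f: "f \<in> borel_measurable M" and k: "0 < k"
  shows "(\<lambda>t. ennreal (\<Phi> (cmod (f t) / k))) \<in> borel_measurable M"
proof -
  have "continuous_on {0..} \<Phi>" using \<Phi> by (simp add: Young_function_def)
  moreover have "continuous_on UNIV (\<lambda>x::real. max 0 x)" by (intro continuous_intros)
  ultimately have "continuous_on UNIV (\<lambda>x. \<Phi> (max 0 x))"
    by (rule continuous_on_compose2) auto
  then have [measurable]: "(\<lambda>x. \<Phi> (max 0 x)) \<in> borel_measurable borel"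
    by (rule borel_measurable_continuous_onI)
  note [measurable] = f
  have "(\<lambda>t. ennreal (\<Phi> (max 0 (cmod (f t) / k)))) \<in> borel_measurable M" by measurable
  then show ?thesis using k by (simp add: max_def)
qed

text \<open>
  The Luxemburg norm of \<open>\<tau>\<^sub>s f\<close> for \<open>x'\<close> equals that of \<open>f\<close> for the translated functional \<open>y'\<close>.
\<close>

lemma Orlicz_norm_translate_le:
  fixes \<nu> :: "'g::topological_group_add set \<Rightarrow> 'x::complex_banach"
  assumes \<Phi>: "Young_function \<Phi>" and \<nu>: "vector_measure \<nu>"
    and inv: "norm_integral_translation_invariant \<nu>"
    and f: "f \<in> borel_measurable borel"
  shows "Orlicz_norm \<Phi> \<nu> (translate s f) \<le> Orlicz_norm \<Phi> \<nu> f"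
  unfolding Orlicz_norm_def
proof (rule SUP_least)
  fix x' :: "'x \<Rightarrow> complex" assume x': "x' \<in> dual_unit_ball"
  obtain y' where y': "y' \<in> dual_unit_ball"
      "\<And>A. A \<in> sets borel \<Longrightarrow> y' (\<nu> A) = x' (\<nu> ((+) s ` A))"
    using dual_functional_translate[OF \<nu> inv x'] by metis
  have tv: "total_variation (\<lambda>A. y' (\<nu> A)) =
      distr (total_variation (\<lambda>A. x' (\<nu> A))) borel (\<lambda>t. - s + t)"
    by (rule total_variation_translate[OF vector_measure_dual[OF \<nu> x']
          vector_measure_dual[OF \<nu> y'(1)] y'(2)])
  have "(\<integral>\<^sup>+t. ennreal (\<Phi> (cmod (f t) / k)) \<partial>total_variation (\<lambda>A. y' (\<nu> A))) =
      (\<integral>\<^sup>+t. ennreal (\<Phi> (cmod (translate s f t) / k)) \<partial>total_variation (\<lambda>A. x' (\<nu> A)))"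
    if "0 < k" for k
  proof -
    have "(\<lambda>t. - s + t) \<in> total_variation (\<lambda>A. x' (\<nu> A)) \<rightarrow>\<^sub>M borel" by measurable
    then show ?thesis
      unfolding tv translate_def
      by (rule nn_integral_distr) (rule Young_function_measurable[OF \<Phi> _ that], simp add: f)
  qed
  then have "Luxemburg_norm \<Phi> (total_variation (\<lambda>A. x' (\<nu> A))) (translate s f) =
      Luxemburg_norm \<Phi> (total_variation (\<lambda>A. y' (\<nu> A))) f"
    unfolding Luxemburg_norm_def by (simp cong: conj_cong)
  then show "Luxemburg_norm \<Phi> (total_variation (\<lambda>A. x' (\<nu> A))) (translate s f)
      \<le> (SUP x'\<in>dual_unit_ball. Luxemburg_norm \<Phi> (total_variation (\<lambda>A. x' (\<nu> A))) f)"
    using SUP_upper[OF y'(1)] by simp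
qed

section \<open>The Orlicz norm as a seminorm\<close>

lemma ennreal_le_by_real_bounds:
  fixes x y :: ennreal
  assumes "\<And>c. 0 < c \<Longrightarrow> y < ennreal c \<Longrightarrow> x \<le> ennreal c"
  shows "x \<le> y"
proof (rule dense_ge)
  fix z assume z: "y < z"
  show "x \<le> z"
  proof (cases z)
    case (real r)
    moreover from this z have "0 < r" by (cases "r = 0") auto
    ultimately show ?thesis using assms[of r] z by simp
  qed simp
qed

locale Orlicz_setting =
  fixes \<Phi> :: "real \<Rightarrow> real" and \<nu> :: "'g::topological_space set \<Rightarrow> 'x::complex_banach"
  assumes \<Phi>: "Young_function \<Phi>" and \<nu>: "vector_measure \<nu>"
begin

abbreviation nrm :: "('g \<Rightarrow> complex) \<Rightarrow> ennreal" where
  "nrm \<equiv> Orlicz_norm \<Phi> \<nu>"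

abbreviation tv :: "('x \<Rightarrow> complex) \<Rightarrow> 'g measure" where
  "tv x' \<equiv> total_variation (\<lambda>A. x' (\<nu> A))"

text \<open>
  The condition that describes the ball of radius \<open>c\<close> of the Orlicz norm.  It involves all \<open>x'\<close> at
  once, so seminorm properties can be proved for the modular without interchanging the supremum
  over \<open>x'\<close> with the infimum in the Luxemburg norm.
\<close>

definition modular_le_1 :: "real \<Rightarrow> ('g \<Rightarrow> complex) \<Rightarrow> bool" where
  "modular_le_1 c f \<longleftrightarrow>
     (\<forall>x'\<in>dual_unit_ball. (\<integral>\<^sup>+t. ennreal (\<Phi> (cmod (f t) / c)) \<partial>tv x') \<le> 1)"

lemma Phi_0: "\<Phi> 0 = 0" and Phi_nonneg: "0 \<le> t \<Longrightarrow> 0 \<le> \<Phi> t"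
  and Phi_pos: "0 < t \<Longrightarrow> 0 < \<Phi> t"
proof -
  have *: "0 \<le> \<Phi> t \<and> (\<Phi> t = 0 \<longleftrightarrow> t = 0)" if "0 \<le> t" for t
    using \<Phi> that by (simp add: Young_function_def)
  show "\<Phi> 0 = 0" "0 \<le> t \<Longrightarrow> 0 \<le> \<Phi> t" using * by simp_all
  show "0 < t \<Longrightarrow> 0 < \<Phi> t" using *[of t] by linarith
qed

lemma Phi_mono: "0 \<le> s \<Longrightarrow> s \<le> t \<Longrightarrow> \<Phi> s \<le> \<Phi> t"
proof -
  assume st: "0 \<le> s" "s \<le> t"
  have "strict_mono_on {0..} \<Phi>" using \<Phi> by (simp add: Young_function_def)
  then have "mono_on {0..} \<Phi>" by (rule strict_mono_on_imp_mono_on)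
  then show ?thesis by (rule mono_onD) (use st in auto)
qed

lemma nrm_modular:
  assumes c: "0 < c"
  shows "modular_le_1 c f \<Longrightarrow> nrm f \<le> ennreal c"
    and "nrm f < ennreal c \<Longrightarrow> modular_le_1 c f"
proof -
  show "nrm f \<le> ennreal c" if "modular_le_1 c f"
    unfolding Orlicz_norm_def Luxemburg_norm_def
    using c that by (intro SUP_least Inf_lower) (auto simp: modular_le_1_def)
  assume f: "nrm f < ennreal c"
  show "modular_le_1 c f"
    unfolding modular_le_1_def
  proof
    fix x' :: "'x \<Rightarrow> complex" assume x': "x' \<in> dual_unit_ball"
    have "Luxemburg_norm \<Phi> (tv x') f < ennreal c"
      using f SUP_upper[OF x', of "\<lambda>x'. Luxemburg_norm \<Phi> (tv x') f"]
      by (auto simp: Orlicz_norm_def)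
    then obtain k where k: "0 < k" "ennreal k < ennreal c"
        "(\<integral>\<^sup>+t. ennreal (\<Phi> (cmod (f t) / k)) \<partial>tv x') \<le> 1"
      by (auto simp: Luxemburg_norm_def Inf_less_iff)
    have "k < c" using k(1,2) by (simp add: ennreal_less_iff)
    then have "(\<integral>\<^sup>+t. ennreal (\<Phi> (cmod (f t) / c)) \<partial>tv x') \<le>
        (\<integral>\<^sup>+t. ennreal (\<Phi> (cmod (f t) / k)) \<partial>tv x')"
      using k(1) c by (intro nn_integral_mono ennreal_leI Phi_mono divide_left_mono) auto
    then show "(\<integral>\<^sup>+t. ennreal (\<Phi> (cmod (f t) / c)) \<partial>tv x') \<le> 1" using k(3) by simp
  qed
qed

lemma nrm_mono:
  assumes "\<And>t. cmod (f t) \<le> cmod (g t)"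
  shows "nrm f \<le> nrm g"
proof (rule ennreal_le_by_real_bounds)
  fix c :: real assume c: "0 < c" "nrm g < ennreal c"
  have "(\<integral>\<^sup>+t. ennreal (\<Phi> (cmod (f t) / c)) \<partial>tv x') \<le>
      (\<integral>\<^sup>+t. ennreal (\<Phi> (cmod (g t) / c)) \<partial>tv x')" for x'
    using assms c(1) by (intro nn_integral_mono ennreal_leI Phi_mono divide_right_mono) simp_all
  moreover have "modular_le_1 c g" by (rule nrm_modular(2)[OF c])
  ultimately have "modular_le_1 c f"
    unfolding modular_le_1_def by (auto intro: order_trans)
  then show "nrm f \<le> ennreal c" by (rule nrm_modular(1)[OF c(1)])
qed

lemma nrm_cmult: "nrm (\<lambda>t. a * f t) \<le> ennreal (cmod a) * nrm f"
proof (cases "a = 0")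
  case True
  have "nrm (\<lambda>t. 0) \<le> 0"
  proof (rule ennreal_le_by_real_bounds)
    fix c :: real assume c: "0 < c"
    show "nrm (\<lambda>t. 0) \<le> ennreal c"
      by (rule nrm_modular(1)[OF c]) (simp add: modular_le_1_def Phi_0)
  qed
  with True show ?thesis by simp
next
  case False
  show ?thesis
  proof (rule ennreal_le_by_real_bounds)
    fix c :: real assume c: "0 < c" "ennreal (cmod a) * nrm f < ennreal c"
    have "nrm f < ennreal (c / cmod a)"
    proof (cases "nrm f")
      case (real r)
      then have "ennreal (cmod a * r) < ennreal c" using c by (simp add: ennreal_mult)
      then have "cmod a * r < c" using real c by (simp add: ennreal_less_iff)
      then have "r < c / cmod a" using False by (simp add: field_simps)
      then show ?thesis using real by (simp add: ennreal_less_iff)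
    next
      case top
      then show ?thesis using c False by (simp add: ennreal_mult_top)
    qed
    moreover have "0 < c / cmod a" using c False by simp
    ultimately have "modular_le_1 (c / cmod a) f" by (intro nrm_modular(2))
    then have "modular_le_1 c (\<lambda>t. a * f t)"
      by (simp add: modular_le_1_def norm_mult mult.commute)
    then show "nrm (\<lambda>t. a * f t) \<le> ennreal c" by (rule nrm_modular(1)[OF c(1)])
  qed
qed

text \<open>
  Convexity of \<open>\<Phi>\<close>, applied to
  \<open>|f + g| / (a + b) \<le> (a / (a + b)) (|f| / a) + (b / (a + b)) (|g| / b)\<close>.
\<close>

lemma modular_le_1_add:
  assumes f: "f \<in> borel_measurable borel" and g: "g \<in> borel_measurable borel"
    and a: "0 < a" "modular_le_1 a f" and b: "0 < b" "modular_le_1 b g"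
  shows "modular_le_1 (a + b) (\<lambda>t. f t + g t)"
  unfolding modular_le_1_def
proof
  fix x' :: "'x \<Rightarrow> complex" assume x': "x' \<in> dual_unit_ball"
  let ?F = "\<lambda>t. \<Phi> (cmod (f t) / a)" and ?G = "\<lambda>t. \<Phi> (cmod (g t) / b)"
  define u where "u = b / (a + b)"
  have u: "0 \<le> u" "u \<le> 1" "1 - u = a / (a + b)" using a b by (simp_all add: u_def field_simps)
  have nonneg: "0 \<le> ?F t" "0 \<le> ?G t" for t using a b by (simp_all add: Phi_nonneg)
  have convex: "\<Phi> (cmod (f t + g t) / (a + b)) \<le> (1 - u) * ?F t + u * ?G t" for t
  proof -
    have "cmod (f t + g t) / (a + b) \<le> (cmod (f t) + cmod (g t)) / (a + b)"
      using a b by (intro divide_right_mono norm_triangle_ineq) auto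
    also have "\<dots> = (1 - u) *\<^sub>R (cmod (f t) / a) + u *\<^sub>R (cmod (g t) / b)"
    proof -
      have "(1 - u) *\<^sub>R (x / a) = x / (a + b)" "u *\<^sub>R (x / b) = x / (a + b)" for x
        using u(3) a b by (simp_all add: u_def)
      then show ?thesis by (simp only: add_divide_distrib)
    qed
    finally have "\<Phi> (cmod (f t + g t) / (a + b)) \<le>
        \<Phi> ((1 - u) *\<^sub>R (cmod (f t) / a) + u *\<^sub>R (cmod (g t) / b))"
      using a b by (intro Phi_mono) auto
    also have "\<dots> \<le> (1 - u) * ?F t + u * ?G t"
    proof (rule convex_onD[OF _ u(1,2)])
      show "convex_on {0..} \<Phi>" using \<Phi> by (simp add: Young_function_def)
    qed (use a b in auto)
    finally show ?thesis .
  qed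
  have "(\<integral>\<^sup>+t. ennreal (\<Phi> (cmod (f t + g t) / (a + b))) \<partial>tv x') \<le>
      (\<integral>\<^sup>+t. ennreal (1 - u) * ennreal (?F t) + ennreal u * ennreal (?G t) \<partial>tv x')"
  proof (rule nn_integral_mono)
    fix t
    have "ennreal ((1 - u) * ?F t + u * ?G t) =
        ennreal (1 - u) * ennreal (?F t) + ennreal u * ennreal (?G t)"
      using u(1,2) nonneg[of t] by (simp add: ennreal_plus ennreal_mult del: ennreal_plus_if)
    then show "ennreal (\<Phi> (cmod (f t + g t) / (a + b))) \<le>
        ennreal (1 - u) * ennreal (?F t) + ennreal u * ennreal (?G t)"
      using ennreal_leI[OF convex[of t]] by simp
  qed
  also have "\<dots> = ennreal (1 - u) * (\<integral>\<^sup>+t. ennreal (?F t) \<partial>tv x') +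
      ennreal u * (\<integral>\<^sup>+t. ennreal (?G t) \<partial>tv x')"
  proof -
    note [measurable] = f g
    have [measurable]: "(\<lambda>t. ennreal (?F t)) \<in> borel_measurable (tv x')"
      by (rule Young_function_measurable[OF \<Phi> _ a(1)]) measurable
    have [measurable]: "(\<lambda>t. ennreal (?G t)) \<in> borel_measurable (tv x')"
      by (rule Young_function_measurable[OF \<Phi> _ b(1)]) measurable
    show ?thesis by (simp add: nn_integral_add nn_integral_cmult)
  qed
  also have "\<dots> \<le> ennreal (1 - u) * 1 + ennreal u * 1"
    using a(2) b(2) x' by (intro add_mono mult_left_mono) (auto simp: modular_le_1_def)
  also have "\<dots> = 1" using u by (simp flip: ennreal_plus)
  finally show "(\<integral>\<^sup>+t. ennreal (\<Phi> (cmod (f t + g t) / (a + b))) \<partial>tv x') \<le> 1" .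
qed

lemma nrm_add:
  assumes f: "f \<in> borel_measurable borel" and g: "g \<in> borel_measurable borel"
  shows "nrm (\<lambda>t. f t + g t) \<le> nrm f + nrm g"
proof (rule ennreal_le_epsilon)
  fix e :: real assume fin: "nrm f + nrm g < top" and e: "0 < e"
  obtain a b where a: "0 \<le> a" "nrm f = ennreal a" and b: "0 \<le> b" "nrm g = ennreal b"
    using fin by (cases "nrm f"; cases "nrm g") auto
  have "modular_le_1 ((a + e / 2) + (b + e / 2)) (\<lambda>t. f t + g t)"
    using a b e
    by (intro modular_le_1_add[OF f g] nrm_modular(2)) (auto simp: ennreal_less_iff)
  then have "nrm (\<lambda>t. f t + g t) \<le> ennreal ((a + e / 2) + (b + e / 2))"
    using a b e by (intro nrm_modular(1)) auto
  also have "\<dots> = nrm f + nrm g + ennreal e"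
    using a b e by (simp flip: ennreal_plus)
  finally show "nrm (\<lambda>t. f t + g t) \<le> nrm f + nrm g + ennreal e" .
qed

lemma nrm_minus_commute: "nrm (\<lambda>t. f t - g t) = nrm (\<lambda>t. g t - f t)"
  by (rule antisym; rule nrm_mono; rule eq_refl[OF norm_minus_commute])

lemma nrm_triangle:
  assumes "f \<in> borel_measurable borel" "g \<in> borel_measurable borel" "h \<in> borel_measurable borel"
  shows "nrm (\<lambda>t. f t - h t) \<le> nrm (\<lambda>t. f t - g t) + nrm (\<lambda>t. g t - h t)"
proof -
  have "(\<lambda>t. f t - h t) = (\<lambda>t. (f t - g t) + (g t - h t))" by simp
  then show ?thesis
    using assms by (simp only:) (intro nrm_add borel_measurable_diff)
qed

lemma nrm_sum:
  assumes "finite I" "\<And>i. i \<in> I \<Longrightarrow> f i \<in> borel_measurable borel"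
  shows "nrm (\<lambda>t. \<Sum>i\<in>I. f i t) \<le> (\<Sum>i\<in>I. nrm (f i))"
  using assms
proof (induction I rule: finite_induct)
  case empty
  show ?case using nrm_cmult[of 0 "\<lambda>_. 0"] by simp
next
  case (insert i I)
  then have "nrm (\<lambda>t. f i t + (\<Sum>i\<in>I. f i t)) \<le> nrm (f i) + nrm (\<lambda>t. \<Sum>i\<in>I. f i t)"
    by (intro nrm_add borel_measurable_sum) auto
  also have "\<dots> \<le> nrm (f i) + (\<Sum>i\<in>I. nrm (f i))"
    using insert by (intro add_left_mono) auto
  finally show ?case using insert.hyps by simp
qed

lemma nrm_le_sup:
  assumes "\<And>t. cmod (f t) \<le> c"
  shows "nrm f \<le> ennreal c * nrm (\<lambda>_. 1)"
proof -
  have c: "0 \<le> c" using norm_ge_zero assms by (rule order_trans)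
  have "nrm f \<le> nrm (\<lambda>_. complex_of_real c * 1)" by (rule nrm_mono) (use assms c in simp)
  also have "\<dots> \<le> ennreal (cmod (complex_of_real c)) * nrm (\<lambda>_. 1)" by (rule nrm_cmult)
  finally show ?thesis using c by simp
qed

lemma nrm_const_ge: "ennreal c * nrm (\<lambda>_. 1) \<le> nrm (\<lambda>_. complex_of_real c)"
proof (cases "c \<le> 0")
  case False
  have "nrm (\<lambda>_. complex_of_real (1 / c) * complex_of_real c) \<le>
      ennreal (cmod (complex_of_real (1 / c))) * nrm (\<lambda>_. complex_of_real c)"
    by (rule nrm_cmult)
  then have "nrm (\<lambda>_. 1) \<le> ennreal (1 / c) * nrm (\<lambda>_. complex_of_real c)"
    using False by (simp add: norm_divide)
  then have "ennreal c * nrm (\<lambda>_. 1) \<le> ennreal c * (ennreal (1 / c) * nrm (\<lambda>_. complex_of_real c))"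
    by (rule mult_left_mono) simp
  also have "\<dots> = (ennreal c * ennreal (1 / c)) * nrm (\<lambda>_. complex_of_real c)"
    by (simp only: mult.assoc)
  also have "ennreal c * ennreal (1 / c) = 1" using False by (simp flip: ennreal_mult)
  finally show ?thesis by simp
qed (simp add: ennreal_neg)

lemma modular_le_1_indicator:
  assumes c: "0 < c" and E: "E \<in> sets borel"
    and le: "\<And>x'. x' \<in> dual_unit_ball \<Longrightarrow> ennreal (\<Phi> (1 / c)) * emeasure (tv x') E \<le> 1"
  shows "modular_le_1 c (\<lambda>t. of_bool (t \<in> E))"
  unfolding modular_le_1_def
proof
  fix x' :: "'x \<Rightarrow> complex" assume x': "x' \<in> dual_unit_ball"
  have "(\<integral>\<^sup>+t. ennreal (\<Phi> (cmod (of_bool (t \<in> E)) / c)) \<partial>tv x') =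
      (\<integral>\<^sup>+t. ennreal (\<Phi> (1 / c)) * indicator E t \<partial>tv x')"
    by (intro nn_integral_cong) (simp add: Phi_0 split: split_indicator)
  also have "\<dots> = ennreal (\<Phi> (1 / c)) * emeasure (tv x') E"
    using E by (simp add: nn_integral_cmult_indicator)
  finally show "(\<integral>\<^sup>+t. ennreal (\<Phi> (cmod (of_bool (t \<in> E)) / c)) \<partial>tv x') \<le> 1"
    using le[OF x'] by simp
qed

lemma tv_le_4_sup:
  assumes x': "x' \<in> dual_unit_ball" and A: "A \<in> sets borel"
    and S: "\<And>B. B \<in> sets borel \<Longrightarrow> B \<subseteq> A \<Longrightarrow> norm (\<nu> B) \<le> S"
  shows "emeasure (tv x') A \<le> ennreal (4 * S)"
  unfolding emeasure_total_variation[OF vector_measure_dual[OF \<nu> x'] A]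
proof (rule variation_le_4_sup[OF vector_measure_dual[OF \<nu> x']])
  show "cmod (x' (\<nu> B)) \<le> S" if "B \<in> sets borel" "B \<subseteq> A" for B
    using dual_unit_ballD(3)[OF x'] S[OF that] by (rule order_trans)
qed

text \<open>
  The variations of all \<open>\<langle>\<nu>, x'\<rangle>\<close> have a common bound \<open>4 S\<close>, and \<open>\<Phi> (1 / c) \<le> 1 / (4 S + 1)\<close> for
  large \<open>c\<close>, because \<open>\<Phi>\<close> is continuous with \<open>\<Phi> 0 = 0\<close>.
\<close>

lemma nrm_1_finite: "nrm (\<lambda>_. 1) < \<infinity>"
proof -
  obtain S where S: "\<And>A. A \<in> sets borel \<Longrightarrow> norm (\<nu> A) \<le> S"
    using vector_measure_bounded[OF \<nu>] by blast
  have S0: "0 \<le> S" using S[of "{}"] by (simp add: vector_measure_empty[OF \<nu>])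
  have "continuous_on {0..} \<Phi>" using \<Phi> by (simp add: Young_function_def)
  moreover have "0 < 1 / (4 * S + 1)" using S0 by simp
  ultimately obtain d where d: "0 < d" "\<And>t. 0 \<le> t \<Longrightarrow> dist t 0 < d \<Longrightarrow> dist (\<Phi> t) (\<Phi> 0) < 1 / (4 * S + 1)"
    unfolding continuous_on_iff by (metis atLeast_iff order_refl)
  define c where "c = 2 / d"
  have c: "0 < c" "\<Phi> (1 / c) \<le> 1 / (4 * S + 1)"
    using d(1) d(2)[of "1 / c"] by (simp_all add: c_def Phi_0 dist_real_def)
  have "ennreal (\<Phi> (1 / c)) * emeasure (tv x') UNIV \<le> 1" if x': "x' \<in> dual_unit_ball" for x'
  proof -
    have "ennreal (\<Phi> (1 / c)) * emeasure (tv x') UNIV \<le> ennreal (1 / (4 * S + 1)) * ennreal (4 * S)"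
      using S c by (intro mult_mono ennreal_leI tv_le_4_sup[OF x']) auto
    also have "\<dots> \<le> 1"
      using S0 by (simp flip: ennreal_mult)
    finally show ?thesis .
  qed
  then have "modular_le_1 c (\<lambda>t. of_bool (t \<in> UNIV))"
    by (intro modular_le_1_indicator c) auto
  then have "nrm (\<lambda>_. 1) \<le> ennreal c" using nrm_modular(1)[OF c(1)] by simp
  then show ?thesis by (simp add: le_less_trans)
qed

text \<open>
  If the norm vanished, \<open>\<Phi> (1 / c)\<close> times the variation of every \<open>\<langle>\<nu>, x'\<rangle>\<close> would be at most 1 for all
  \<open>c\<close>.  For a functional norming some nonzero value of \<open>\<nu>\<close> this contradicts \<open>\<Phi> \<rightarrow> \<infinity>\<close>.
\<close>

lemma nrm_1_pos:
  assumes "nonzero_vector_measure \<nu>"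
  shows "0 < nrm (\<lambda>_. 1)"
proof (rule ccontr)
  assume "\<not> 0 < nrm (\<lambda>_. 1)"
  then have zero: "nrm (\<lambda>_. 1) = 0" by simp
  obtain A where A: "A \<in> sets borel" "\<nu> A \<noteq> 0" using assms by (auto simp: nonzero_vector_measure_def)
  obtain x' where x': "x' \<in> dual_unit_ball" "x' (\<nu> A) = complex_of_real (norm (\<nu> A))"
    using dual_unit_ball_norming[of "\<nu> A"] by blast
  define v where "v = norm (\<nu> A)"
  have v: "0 < v" using A by (simp add: v_def)
  have "ennreal v \<le> emeasure (tv x') A"
    using norm_le_variation[OF A(1), of "\<lambda>A. x' (\<nu> A)"] x'
    by (simp add: v_def emeasure_total_variation[OF vector_measure_dual[OF \<nu> x'(1)] A(1)])
  also have "\<dots> \<le> emeasure (tv x') UNIV" by (rule emeasure_mono) auto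
  finally have large: "ennreal v \<le> emeasure (tv x') UNIV" .
  have "eventually (\<lambda>t. 2 / v \<le> \<Phi> t) at_top"
    using \<Phi> by (auto simp: Young_function_def filterlim_at_top)
  then obtain T where T: "\<And>t. T \<le> t \<Longrightarrow> 2 / v \<le> \<Phi> t" by (auto simp: eventually_at_top_linorder)
  define c where "c = 1 / max 1 T"
  have c: "0 < c" "2 / v \<le> \<Phi> (1 / c)" using T[of "max 1 T"] by (simp_all add: c_def)
  have "modular_le_1 c (\<lambda>_. 1)" using zero c(1) by (intro nrm_modular(2)) simp_all
  then have "ennreal (\<Phi> (1 / c)) * emeasure (tv x') UNIV \<le> 1"
    using x' by (simp add: modular_le_1_def)
  moreover have "ennreal (2 / v) * ennreal v \<le> ennreal (\<Phi> (1 / c)) * emeasure (tv x') UNIV"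
    using c large by (intro mult_mono ennreal_leI) auto
  moreover have "ennreal (2 / v) * ennreal v = 2"
    using v by (simp flip: ennreal_mult)
  ultimately have "(2::ennreal) \<le> 1" by (metis order_trans)
  then show False by simp
qed

lemma nrm_indicator_small:
  assumes m: "sets m = sets borel" "finite_measure m"
    and ac: "abs_continuous_wrt \<nu> m" and e: "0 < e"
  obtains d where "0 < d"
    "\<And>E. E \<in> sets borel \<Longrightarrow> measure m E < d \<Longrightarrow> nrm (\<lambda>t. of_bool (t \<in> E)) \<le> ennreal e"
proof -
  define r where "r = 1 / (4 * \<Phi> (1 / e))"
  have r: "0 < r" using e by (simp add: r_def Phi_pos)
  obtain d where d: "0 < d" "\<And>A. A \<in> sets borel \<Longrightarrow> measure m A < d \<Longrightarrow> norm (\<nu> A) < r"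
    using ac r unfolding abs_continuous_wrt_def by meson
  have "nrm (\<lambda>t. of_bool (t \<in> E)) \<le> ennreal e"
    if E: "E \<in> sets borel" "measure m E < d" for E
  proof (rule nrm_modular(1)[OF e], rule modular_le_1_indicator[OF e E(1)])
    fix x' :: "'x \<Rightarrow> complex" assume x': "x' \<in> dual_unit_ball"
    have "norm (\<nu> B) \<le> r" if "B \<in> sets borel" "B \<subseteq> E" for B
    proof -
      have "measure m B \<le> measure m E"
        using that E m by (intro finite_measure.finite_measure_mono) auto
      then show ?thesis using d(2)[OF that(1)] E(2) by simp
    qed
    then have "emeasure (tv x') E \<le> ennreal (4 * r)" by (intro tv_le_4_sup[OF x' E(1)])
    then have "ennreal (\<Phi> (1 / e)) * emeasure (tv x') E \<le> ennreal (\<Phi> (1 / e)) * ennreal (4 * r)"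
      by (intro mult_left_mono) auto
    also have "\<dots> = 1"
      using e r Phi_pos[of "1 / e"] by (simp flip: ennreal_mult add: r_def)
    finally show "ennreal (\<Phi> (1 / e)) * emeasure (tv x') E \<le> 1" .
  qed
  with d(1) show thesis by (rule that)
qed

end

section \<open>Compact groups and Haar measure\<close>

text \<open>
  Replaces every point \<open>t\<close> by one of finitely many points \<open>p t\<close> with \<open>t \<in> W (p t)\<close>, measurably in
  \<open>t\<close>: a finite subcover is made disjoint.  All the discretizations below are instances.
\<close>

lemma finite_borel_selection:
  fixes W :: "'g::topological_space \<Rightarrow> 'g set"
  assumes compact: "compact (UNIV :: 'g set)" and W: "\<And>x. open (W x)" "\<And>x. x \<in> W x"
  obtains p where "simple_function borel p" "\<And>t. t \<in> W (p t)"
proof -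
  have step: "\<exists>p. simple_function borel p \<and> (\<forall>t\<in>\<Union> (W ` S). t \<in> W (p t))" if "finite S" for S
    using that
  proof (induction S rule: finite_induct)
    case empty
    show ?case by (intro exI[of _ "\<lambda>_. undefined"]) simp
  next
    case (insert x S)
    then obtain p where p: "simple_function borel p" "\<forall>t\<in>\<Union> (W ` S). t \<in> W (p t)" by blast
    have "simple_function borel (\<lambda>t. if t \<in> W x then x else p t)"
      using p(1) W(1) by (intro simple_function_If_set) auto
    moreover have "\<forall>t\<in>\<Union> (W ` insert x S). t \<in> W (if t \<in> W x then x else p t)"
      using p(2) by auto
    ultimately show ?case by blast
  qed
  obtain S where "finite S" "UNIV \<subseteq> \<Union> (W ` S)"
    using compactE_image[OF compact, of UNIV W] W by (metis UNIV_I UN_iff subsetI)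
  with step[of S] obtain p where "simple_function borel p" "\<And>t. t \<in> W (p t)" by blast
  then show thesis by (rule that)
qed

lemma continuous_uniform_approx_simple:
  fixes h :: "'g::topological_space \<Rightarrow> complex"
  assumes compact: "compact (UNIV :: 'g set)" and h: "continuous_on UNIV h" and e: "0 < e"
  obtains \<phi> where "simple_function borel \<phi>" "\<And>t. cmod (h t - \<phi> t) \<le> e"
proof -
  have "open {t. cmod (h t - h x) < e}" for x
    using h by (intro open_Collect_less continuous_intros)
  then obtain p where p: "simple_function borel p" "\<And>t. t \<in> {s. cmod (h s - h (p t)) < e}"
    using finite_borel_selection[OF compact, of "\<lambda>x. {t. cmod (h t - h x) < e}"] e by auto
  show thesis
    by (rule that[of "\<lambda>t. h (p t)"]) (use p in \<open>auto intro: simple_function_compose1 less_imp_le\<close>)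
qed

lemma continuous_uniform_left_translation:
  fixes h :: "'g::topological_group_add \<Rightarrow> complex"
  assumes compact: "compact (UNIV :: 'g set)" and h: "continuous_on UNIV h" and e: "0 < e"
  obtains V where "open V" "0 \<in> V" "\<And>v t. v \<in> V \<Longrightarrow> cmod (h (v + t) - h t) \<le> e"
proof -
  have cont: "continuous_on (UNIV \<times> UNIV) (\<lambda>z. h (fst z + snd z))"
    by (intro continuous_on_compose2[OF h] continuous_intros) auto
  obtain V where "0 \<in> V" "open V"
      "\<forall>v\<in>V \<inter> UNIV. \<forall>t\<in>UNIV. dist (h (fst (v, t) + snd (v, t))) (h (fst (0, t) + snd (0::'g, t))) \<le> e"
    using continuous_on_prod_compactE[OF cont compact UNIV_I e, of 0] by metis
  then show thesis by (intro that[of V]) (auto simp: dist_norm)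
qed

text \<open>
  The map \<open>s \<mapsto> \<tau>\<^sub>s h\<close> is approximated by one with finitely many values, uniformly in both \<open>s\<close> and
  \<open>t\<close>.  The point \<open>p s\<close> is chosen with \<open>- s + p s\<close> close to \<open>0\<close>, which
  \<open>- s + t = (- s + p s) + (- p s + t)\<close> turns into a small left translation.
\<close>

lemma continuous_translates_uniform_approx:
  fixes h :: "'g::topological_group_add \<Rightarrow> complex"
  assumes compact: "compact (UNIV :: 'g set)" and h: "continuous_on UNIV h" and e: "0 < e"
  obtains p where "simple_function borel p" "\<And>s t. cmod (h (- s + t) - h (- p s + t)) \<le> e"
proof -
  obtain V where V: "open V" "0 \<in> V" "\<And>v t. v \<in> V \<Longrightarrow> cmod (h (v + t) - h t) \<le> e"
    using continuous_uniform_left_translation[OF assms] by blast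
  have "open {s. - s + x \<in> V}" for x
    using open_vimage[OF V(1), of "\<lambda>s. - s + x"] by (simp add: vimage_def continuous_intros)
  then obtain p where p: "simple_function borel p" "\<And>s. s \<in> {s'. - s' + p s \<in> V}"
    using finite_borel_selection[OF compact, of "\<lambda>x. {s. - s + x \<in> V}"] V(2) by auto
  have "cmod (h (- s + t) - h (- p s + t)) \<le> e" for s t
  proof -
    have "- s + t = (- s + p s) + (- p s + t)" by (simp add: add.assoc)
    then show ?thesis using V(3)[of "- s + p s" "- p s + t"] p(2)[of s] by simp
  qed
  with p(1) show thesis by (rule that)
qed

lemma compact_Hausdorff_Urysohn:
  fixes K U :: "'g::t2_space set"
  assumes compact: "compact (UNIV :: 'g set)" and K: "closed K" "K \<subseteq> U" and U: "open U"
  obtains f :: "'g \<Rightarrow> real" where "continuous_on UNIV f" "\<And>t. 0 \<le> f t" "\<And>t. f t \<le> 1"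
    "\<And>t. t \<in> K \<Longrightarrow> f t = 1" "\<And>t. t \<notin> U \<Longrightarrow> f t = 0"
proof -
  have "Hausdorff_space (euclidean :: 'g topology)"
    unfolding Hausdorff_space_def by (simp add: disjnt_def) (metis hausdorff)
  moreover have "compact_space (euclidean :: 'g topology)"
    using compact by (simp add: compact_space_def)
  ultimately have "normal_space (euclidean :: 'g topology)"
    by (intro compact_Hausdorff_or_regular_imp_normal_space) auto
  then obtain f where f: "continuous_map euclidean (top_of_set {0..1::real}) f"
      "f ` (- U) \<subseteq> {0}" "f ` K \<subseteq> {1}"
    using Urysohn_lemma[of euclidean "- U" K 0 1] K U by (auto simp: disjnt_def closed_Compl)
  then have "continuous_on UNIV f" "range f \<subseteq> {0..1}"
    by (auto simp: continuous_map_in_subtopology)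
  then show thesis using f by (intro that[of f]) (auto simp: image_subset_iff)
qed

locale compact_group_Haar =
  fixes m :: "'g::{topological_group_add, t2_space} measure"
  assumes compact: "compact (UNIV :: 'g set)" and Haar: "normalized_haar_measure m"
begin

lemma sets_m [measurable_cong, simp]: "sets m = sets borel"
  using Haar by (simp add: normalized_haar_measure_def)

lemma space_m [simp]: "space m = UNIV"
  using sets_eq_imp_space_eq[OF sets_m] by simp

lemma emeasure_m_UNIV [simp]: "emeasure m UNIV = 1"
  using Haar by (simp add: normalized_haar_measure_def)

sublocale finite_measure m
  by (rule finite_measureI) simp

lemma emeasure_left_translation:
  "A \<in> sets borel \<Longrightarrow> emeasure m ((+) s ` A) = emeasure m A"
  using Haar unfolding normalized_haar_measure_def by (elim conjE) (drule spec, erule bspec)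

lemma distr_left_translation: "distr m borel ((+) s) = m"
proof (rule measure_eqI)
  fix A assume "A \<in> sets (distr m borel ((+) s))"
  then have A: "A \<in> sets borel" by simp
  have "emeasure (distr m borel ((+) s)) A = emeasure m ((+) s -` A)"
    using A by (subst emeasure_distr) (simp_all add: measurable_left_add)
  also have "(+) s -` A = (+) (- s) ` A" by (simp add: translate_image_eq_vimage)
  also have "emeasure m \<dots> = emeasure m A"
    by (rule emeasure_left_translation[OF A])
  finally show "emeasure (distr m borel ((+) s)) A = emeasure m A" .
qed simp

text \<open>
  The image of Haar measure under inversion.  It is the measure that occurs in estimates for
  convolutions, since \<open>\<integral> f(-s + t) dm(s) = \<integral> f dm_inv\<close> by left invariance of \<open>m\<close>.
\<close>

definition m_inv :: "'g measure" where
  "m_inv = distr m borel uminus"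

lemma measurable_uminus_group: "uminus \<in> m \<rightarrow>\<^sub>M (borel :: 'g measure)"
proof -
  have "(\<lambda>x::'g. - x) \<in> borel_measurable borel"
    by (intro borel_measurable_continuous_onI continuous_intros)
  then show ?thesis by (simp only: measurable_cong_sets[OF sets_m refl])
qed

lemma sets_m_inv [measurable_cong, simp]: "sets m_inv = sets borel"
  by (simp add: m_inv_def)

lemma emeasure_m_inv: "A \<in> sets borel \<Longrightarrow> emeasure m_inv A = emeasure m (uminus -` A)"
  unfolding m_inv_def by (simp add: emeasure_distr[OF measurable_uminus_group])

lemma finite_measure_m_inv: "finite_measure m_inv"
  unfolding m_inv_def by (rule finite_measure_distr[OF measurable_uminus_group])

text \<open>
  Substituting \<open>t + s\<close> for \<open>s\<close> turns \<open>- s + t\<close> into \<open>- (t + s) + t = - s\<close>.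
\<close>

lemma nn_integral_reflected_translate:
  assumes f: "f \<in> borel_measurable borel"
  shows "(\<integral>\<^sup>+s. f (- s + t) \<partial>m) = (\<integral>\<^sup>+s. f s \<partial>m_inv)"
proof -
  have F: "(\<lambda>s. f (- s + t)) \<in> borel_measurable borel"
    by (rule measurable_compose[OF _ f]) (intro borel_measurable_continuous_onI continuous_intros)
  have "(\<integral>\<^sup>+s. f (- s + t) \<partial>m) = (\<integral>\<^sup>+s. f (- s + t) \<partial>distr m borel ((+) t))"
    by (simp only: distr_left_translation)
  also have "\<dots> = (\<integral>\<^sup>+s. f (- (t + s) + t) \<partial>m)"
    by (rule nn_integral_distr) (use F in \<open>simp_all add: measurable_left_add\<close>)
  also have "\<dots> = (\<integral>\<^sup>+s. f (- s) \<partial>m)" by (simp add: minus_add add.assoc)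
  also have "\<dots> = (\<integral>\<^sup>+s. f s \<partial>m_inv)"
    unfolding m_inv_def by (rule nn_integral_distr[symmetric]) (use f in \<open>simp_all add: measurable_uminus_group\<close>)
  finally show ?thesis .
qed

text \<open>
  The bound does not depend on \<open>t\<close>.  It is the reason why convolution with a bounded function turns
  \<open>L\<^sup>1\<close>-convergence into uniform convergence.
\<close>

lemma integrable_bounded_mult_translate:
  fixes \<gamma> f :: "'g \<Rightarrow> complex"
  assumes \<gamma>: "\<gamma> \<in> borel_measurable borel" "\<And>s. cmod (\<gamma> s) \<le> M"
    and f: "f \<in> borel_measurable borel" "(\<integral>\<^sup>+s. ennreal (cmod (f s)) \<partial>m_inv) < \<infinity>"
  shows "integrable m (\<lambda>s. \<gamma> s * f (- s + t))"
    and "ennreal (cmod (LINT s|m. \<gamma> s * f (- s + t))) \<le> ennreal M * (\<integral>\<^sup>+s. ennreal (cmod (f s)) \<partial>m_inv)"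
proof -
  have [measurable]: "(\<lambda>s. f (- s + t)) \<in> borel_measurable borel"
    by (rule measurable_compose[OF _ f(1)]) (intro borel_measurable_continuous_onI continuous_intros)
  note [measurable] = \<gamma>(1) f(1)
  have M: "0 \<le> M" using norm_ge_zero \<gamma>(2) by (rule order_trans)
  have "(\<integral>\<^sup>+s. ennreal (cmod (\<gamma> s * f (- s + t))) \<partial>m) \<le> (\<integral>\<^sup>+s. ennreal M * ennreal (cmod (f (- s + t))) \<partial>m)"
    using \<gamma>(2) M
    by (intro nn_integral_mono) (simp add: norm_mult mult_right_mono ennreal_leI flip: ennreal_mult)
  also have "\<dots> = ennreal M * (\<integral>\<^sup>+s. ennreal (cmod (f (- s + t))) \<partial>m)"
    by (rule nn_integral_cmult) measurable
  also have "(\<integral>\<^sup>+s. ennreal (cmod (f (- s + t))) \<partial>m) = (\<integral>\<^sup>+s. ennreal (cmod (f s)) \<partial>m_inv)"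
    by (rule nn_integral_reflected_translate) measurable
  finally have bound: "(\<integral>\<^sup>+s. ennreal (cmod (\<gamma> s * f (- s + t))) \<partial>m) \<le>
      ennreal M * (\<integral>\<^sup>+s. ennreal (cmod (f s)) \<partial>m_inv)" .
  also have "\<dots> < \<infinity>" using f(2) by (simp add: ennreal_mult_less_top)
  finally show int: "integrable m (\<lambda>s. \<gamma> s * f (- s + t))"
    by (intro integrableI_bounded) measurable
  show "ennreal (cmod (LINT s|m. \<gamma> s * f (- s + t))) \<le> ennreal M * (\<integral>\<^sup>+s. ennreal (cmod (f s)) \<partial>m_inv)"
    using integral_norm_bound_ennreal[OF int] bound by (rule order_trans)
qed

text \<open>
  Finitely many translates of \<open>U\<close> cover the group, and they all have the same measure.
\<close>

lemma measure_open_pos: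
  assumes U: "open U" "0 \<in> U"
  shows "0 < measure m U"
proof (rule ccontr)
  assume "\<not> 0 < measure m U"
  then have "measure m U = 0" by (intro antisym) auto
  then have zero: "emeasure m U = 0" by (simp only: emeasure_eq_measure ennreal_0)
  have W: "open ((+) x ` U)" "x \<in> (+) x ` U" for x
  proof -
    show "open ((+) x ` U)"
      unfolding translate_image_eq_vimage by (intro open_vimage U continuous_intros)
    show "x \<in> (+) x ` U" using U(2) by (auto simp: image_iff intro!: bexI[of _ 0])
  qed
  have "UNIV \<subseteq> (\<Union>x\<in>UNIV. (+) x ` U)" using W(2) by blast
  then obtain S where S: "finite S" "UNIV \<subseteq> (\<Union>x\<in>S. (+) x ` U)"
    by (rule compactE_image[OF compact W(1)])
  have "emeasure m (\<Union>x\<in>S. (+) x ` U) \<le> (\<Sum>x\<in>S. emeasure m ((+) x ` U))"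
    using S(1) W by (intro emeasure_subadditive_finite) auto
  also have "\<dots> = (\<Sum>x\<in>S. emeasure m U)"
    using U by (intro sum.cong emeasure_left_translation) auto
  also have "\<dots> = 0" by (simp add: zero)
  finally have "emeasure m (\<Union>x\<in>S. (+) x ` U) = 0" by simp
  moreover have "(\<Union>x\<in>S. (+) x ` U) = UNIV" using S(2) by blast
  ultimately show False by simp
qed

lemma outer_regular:
  assumes A: "A \<in> sets borel" and d: "0 < d"
  obtains U where "open U" "A \<subseteq> U" "measure m (U - A) < d"
proof -
  have plus: "emeasure m A + ennreal d = ennreal (measure m A + d)"
    using d by (simp only: emeasure_eq_measure ennreal_plus[OF measure_nonneg less_imp_le])
  have "emeasure m A < emeasure m A + ennreal d"
    unfolding plus using d by (simp only: emeasure_eq_measure ennreal_less_iff[OF measure_nonneg])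
  moreover have "emeasure m A = (INF U \<in> {U. open U \<and> A \<subseteq> U}. emeasure m U)"
    using Haar unfolding normalized_haar_measure_def by (elim conjE) (rule bspec[OF _ A])
  ultimately have "(INF U \<in> {U. open U \<and> A \<subseteq> U}. emeasure m U) < emeasure m A + ennreal d"
    by simp
  then obtain U where U: "open U" "A \<subseteq> U" "emeasure m U < emeasure m A + ennreal d"
    by (auto simp: INF_less_iff)
  then have "measure m U < measure m A + d"
    unfolding plus by (simp only: emeasure_eq_measure ennreal_less_iff[OF measure_nonneg])
  moreover have "measure m (U - A) = measure m U - measure m A"
    using U A by (intro finite_measure_Diff) auto
  ultimately show thesis using U by (intro that[of U]) auto
qed

lemma regular:
  assumes A: "A \<in> sets borel" and d: "0 < d"
  obtains K U where "closed K" "open U" "K \<subseteq> A" "A \<subseteq> U" "measure m (U - K) < d"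
proof -
  have d2: "0 < d / 2" using d by simp
  obtain U where U: "open U" "A \<subseteq> U" "measure m (U - A) < d / 2"
    by (rule outer_regular[OF A d2])
  have "- A \<in> sets borel" using A by (rule borel_comp)
  then obtain V where V: "open V" "- A \<subseteq> V" "measure m (V - - A) < d / 2"
    by (rule outer_regular[OF _ d2])
  have "measure m (U - - V) \<le> measure m ((U - A) \<union> (V - - A))"
    using A U V by (intro finite_measure_mono) auto
  also have "\<dots> \<le> measure m (U - A) + measure m (V - - A)"
    using A U V by (intro measure_Un_le) auto
  also have "\<dots> < d" using U V by simp
  finally show thesis using U V by (intro that[of "- V" U]) auto
qed

text \<open>
  Inversion is a homeomorphism, so the image measure inherits regularity.  Intersecting the open
  sets and uniting the closed sets found for the two measures gives one pair that serves both.
\<close>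

lemma regular_m_and_m_inv:
  assumes A: "A \<in> sets borel" and d: "0 < d"
  obtains K U where "closed K" "open U" "K \<subseteq> A" "A \<subseteq> U" "measure m (U - K) < d" "measure m_inv (U - K) < d"
proof -
  have meas_u: "uminus -` B \<in> sets borel" if "B \<in> sets borel" for B :: "'g set"
    using measurable_sets[OF measurable_uminus_group that] by simp
  obtain K1 U1 where 1: "closed K1" "open U1" "K1 \<subseteq> A" "A \<subseteq> U1" "measure m (U1 - K1) < d"
    by (rule regular[OF A d])
  obtain K2 U2 where 2: "closed K2" "open U2" "K2 \<subseteq> uminus -` A" "uminus -` A \<subseteq> U2"
      "measure m (U2 - K2) < d"
    by (rule regular[OF meas_u[OF A] d])
  define K where "K = K1 \<union> uminus -` K2"
  define U where "U = U1 \<inter> uminus -` U2"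
  have cl: "closed K" unfolding K_def
    using 1 2 by (intro closed_Un closed_vimage continuous_intros)
  have op: "open U" unfolding U_def
    using 1 2 by (intro open_Int open_vimage continuous_intros)
  have "- x \<in> U2" if "x \<in> A" for x using subsetD[OF 2(4), of "- x"] that by simp
  then have "K \<subseteq> A" "A \<subseteq> U" using 1 2 by (auto simp: K_def U_def)
  moreover have "measure m (U - K) < d"
  proof -
    have "measure m (U - K) \<le> measure m (U1 - K1)"
      using 1 cl op by (intro finite_measure_mono) (auto simp: U_def K_def)
    with 1 show ?thesis by simp
  qed
  moreover have "measure m_inv (U - K) < d"
  proof -
    have "measure m_inv (U - K) = measure m (uminus -` (U - K))"
      using cl op by (simp add: measure_def emeasure_m_inv)
    also have "\<dots> \<le> measure m (U2 - K2)"
      using 2 by (intro finite_measure_mono) (auto simp: U_def K_def)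
    finally show ?thesis using 2 by simp
  qed
  ultimately show thesis using cl op by (intro that[of K U])
qed

end

section \<open>Convolution with continuous functions\<close>

locale invariant_Orlicz_setting =
  Orlicz_setting \<Phi> \<nu> + compact_group_Haar m
  for \<Phi> and \<nu> :: "'g::{topological_group_add, t2_space} set \<Rightarrow> 'x::complex_banach"
    and m :: "'g measure" +
  assumes nonzero: "nonzero_vector_measure \<nu>"
    and abs_cont: "abs_continuous_wrt \<nu> m"
    and inv: "norm_integral_translation_invariant \<nu>"
begin

definition nrm_one :: real where "nrm_one = enn2real (nrm (\<lambda>_. 1))"

lemma nrm_const_1: "nrm (\<lambda>_. 1) = ennreal nrm_one" and nrm_one_pos: "0 < nrm_one"
  using nrm_1_finite nrm_1_pos[OF nonzero] by (simp_all add: nrm_one_def enn2real_positive_iff)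

lemma continuous_bounded:
  fixes h :: "'g \<Rightarrow> 'b::real_normed_vector"
  assumes "continuous_on UNIV h"
  obtains M where "0 < M" "\<And>t. norm (h t) \<le> M"
proof -
  have "bounded (range h)"
    by (intro compact_imp_bounded compact_continuous_image assms compact)
  then obtain M where "0 < M" "\<forall>x\<in>range h. norm x \<le> M" unfolding bounded_pos by (elim exE conjE)
  then show thesis by (intro that[of M]) simp_all
qed

lemma integrable_bounded_borel:
  fixes f :: "'g \<Rightarrow> complex"
  assumes "f \<in> borel_measurable borel" "\<And>t. cmod (f t) \<le> B"
  shows "integrable m f"
  using assms by (intro integrable_const_bound[where B = B]) auto

text \<open>
  Uniform approximation is approximation in the Orlicz norm, since \<open>\<parallel>1\<parallel>\<close> is finite.  Both the
  continuity of a convolution and its norm bound are obtained through this criterion.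
\<close>

lemma uniform_limit_continuous_nrm_le:
  assumes approx: "\<And>e. 0 < e \<Longrightarrow>
    \<exists>\<phi>. continuous_on UNIV \<phi> \<and> nrm \<phi> \<le> B + ennreal e \<and> (\<forall>t. cmod (F t - \<phi> t) \<le> e)"
  shows "continuous_on UNIV F" "nrm F \<le> B"
proof -
  have "\<forall>n. \<exists>\<phi>. continuous_on UNIV \<phi> \<and> (\<forall>t. cmod (F t - \<phi> t) \<le> inverse (real (Suc n)))"
  proof
    fix n
    have "0 < inverse (real (Suc n))" by simp
    from approx[OF this]
    show "\<exists>\<phi>. continuous_on UNIV \<phi> \<and> (\<forall>t. cmod (F t - \<phi> t) \<le> inverse (real (Suc n)))"
      by (elim exE conjE) (intro exI conjI)
  qed
  from choice[OF this] obtain \<phi> where *: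
      "\<forall>n. continuous_on UNIV (\<phi> n) \<and> (\<forall>t. cmod (F t - \<phi> n t) \<le> inverse (real (Suc n)))"
    by (elim exE)
  then have \<phi>: "\<And>n. continuous_on UNIV (\<phi> n)"
      "\<And>n t. cmod (F t - \<phi> n t) \<le> inverse (real (Suc n))" by simp_all
  have "uniform_limit UNIV \<phi> F sequentially"
  proof (rule uniform_limitI)
    fix e :: real assume "0 < e"
    then have "\<forall>\<^sub>F n in sequentially. inverse (real (Suc n)) < e"
      by (intro order_tendstoD(2)[OF LIMSEQ_inverse_real_of_nat])
    then show "\<forall>\<^sub>F n in sequentially. \<forall>t\<in>UNIV. dist (\<phi> n t) (F t) < e"
    proof eventually_elim
      case (elim n)
      then show ?case using \<phi>(2)[of _ n] by (auto simp: dist_norm norm_minus_commute intro: le_less_trans)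
    qed
  qed
  then show F: "continuous_on UNIV F"
    using \<phi>(1) by (intro uniform_limit_theorem[where F = sequentially and f = \<phi>]) auto
  show "nrm F \<le> B"
  proof (rule ennreal_le_epsilon)
    fix e :: real assume e: "0 < e"
    define d where "d = e / (1 + nrm_one)"
    have d: "0 < d" "d * (1 + nrm_one) = e"
      using e nrm_one_pos by (simp_all add: d_def)
    obtain \<phi> where *: "continuous_on UNIV \<phi>" "nrm \<phi> \<le> B + ennreal d" "\<forall>t. cmod (F t - \<phi> t) \<le> d"
      using approx[OF d(1)] by (elim exE conjE)
    then have \<phi>: "continuous_on UNIV \<phi>" "nrm \<phi> \<le> B + ennreal d" "\<And>t. cmod (F t - \<phi> t) \<le> d"
      by simp_all
    have "nrm F = nrm (\<lambda>t. \<phi> t + (F t - \<phi> t))" by simp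
    also have "\<dots> \<le> nrm \<phi> + nrm (\<lambda>t. F t - \<phi> t)"
      by (intro nrm_add borel_measurable_continuous_onI continuous_intros F \<phi>)
    also have "\<dots> \<le> (B + ennreal d) + ennreal d * ennreal nrm_one"
      using nrm_le_sup[OF \<phi>(3)] \<phi>(2) by (intro add_mono) (simp_all add: nrm_const_1)
    also have "\<dots> = B + ennreal (d + d * nrm_one)"
      using d(1) nrm_one_pos by (simp add: ennreal_mult add.assoc)
    also have "d + d * nrm_one = e" using d(2) by (simp add: distrib_left)
    finally show "nrm F \<le> B + ennreal e" .
  qed
qed

definition kernel :: "('g \<Rightarrow> real) \<Rightarrow> bool" where
  "kernel \<gamma> \<longleftrightarrow> continuous_on UNIV \<gamma> \<and> (\<forall>t. 0 \<le> \<gamma> t) \<and> integral\<^sup>L m \<gamma> = 1"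

abbreviation conv :: "('g \<Rightarrow> real) \<Rightarrow> ('g \<Rightarrow> complex) \<Rightarrow> 'g \<Rightarrow> complex" where
  "conv \<gamma> \<equiv> convolution m (\<lambda>s. complex_of_real (\<gamma> s))"

lemma kernelD:
  assumes "kernel \<gamma>"
  shows "continuous_on UNIV \<gamma>" "0 \<le> \<gamma> t" "integral\<^sup>L m \<gamma> = 1" "\<gamma> \<in> borel_measurable borel"
    "integrable m \<gamma>"
proof -
  show 1: "continuous_on UNIV \<gamma>" "0 \<le> \<gamma> t" "integral\<^sup>L m \<gamma> = 1"
    using assms by (simp_all add: kernel_def)
  then show 2: "\<gamma> \<in> borel_measurable borel" by (intro borel_measurable_continuous_onI)
  obtain M where "\<And>t. norm (\<gamma> t) \<le> M" using continuous_bounded[OF 1(1)] by metis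
  then show "integrable m \<gamma>" using 2 by (intro integrable_const_bound[where B = M]) auto
qed

lemma integrable_kernel_mult:
  assumes \<gamma>: "kernel \<gamma>" and u: "u \<in> borel_measurable borel" "\<And>s. cmod (u s) \<le> B"
  shows "integrable m (\<lambda>s. complex_of_real (\<gamma> s) * u s)"
proof -
  obtain M where M: "0 < M" "\<And>t. norm (\<gamma> t) \<le> M" using continuous_bounded[OF kernelD(1)[OF \<gamma>]] by metis
  note [measurable] = kernelD(4)[OF \<gamma>] u(1)
  show ?thesis
  proof (rule integrable_bounded_borel)
    show "cmod (complex_of_real (\<gamma> s) * u s) \<le> M * B" for s
      unfolding norm_mult using M u(2) by (intro mult_mono) auto
  qed measurable
qed

text \<open>
  An average with weights \<open>\<gamma> s dm(s)\<close> of quantities bounded by \<open>e\<close> is bounded by \<open>e\<close>; the values of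
  \<open>u\<close> where \<open>\<gamma>\<close> vanishes do not count.
\<close>

lemma kernel_average_bound:
  assumes \<gamma>: "kernel \<gamma>" and u: "u \<in> borel_measurable borel" "\<And>s. cmod (u s) \<le> B"
    and e: "\<And>s. \<gamma> s \<noteq> 0 \<Longrightarrow> cmod (u s) \<le> e"
  shows "cmod (LINT s|m. complex_of_real (\<gamma> s) * u s) \<le> e"
proof -
  have "cmod (LINT s|m. complex_of_real (\<gamma> s) * u s) \<le>
      (LINT s|m. cmod (complex_of_real (\<gamma> s) * u s))"
    by (rule integral_norm_bound)
  also have "\<dots> \<le> (LINT s|m. \<gamma> s * e)"
  proof (rule integral_mono)
    show "integrable m (\<lambda>s. cmod (complex_of_real (\<gamma> s) * u s))"
      by (rule integrable_norm[OF integrable_kernel_mult[OF \<gamma> u]])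
    show "integrable m (\<lambda>s. \<gamma> s * e)" using kernelD(5)[OF \<gamma>] by simp
    show "cmod (complex_of_real (\<gamma> s) * u s) \<le> \<gamma> s * e" for s
      using e[of s] kernelD(2)[OF \<gamma>, of s] by (cases "\<gamma> s = 0") (auto simp: norm_mult intro: mult_left_mono)
  qed
  also have "\<dots> = e" using kernelD(3)[OF \<gamma>] by simp
  finally show ?thesis .
qed

text \<open>
  Replacing \<open>h (- s + t)\<close> by \<open>h (- p s + t)\<close> with \<open>p\<close> of finite range turns the convolution into
  \<open>\<Sum>\<^sub>x a\<^sub>x \<tau>\<^sub>x h\<close>, where \<open>a\<^sub>x\<close> is the integral of \<open>\<gamma>\<close> over \<open>{p = x}\<close>.  The \<open>a\<^sub>x\<close> are nonnegative and
  sum to 1, and all \<open>\<tau>\<^sub>x h\<close> have norm at most \<open>\<parallel>h\<parallel>\<close>.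
\<close>

lemma conv_continuous:
  assumes \<gamma>: "kernel \<gamma>" and h: "continuous_on UNIV h"
  shows "continuous_on UNIV (conv \<gamma> h)" "nrm (conv \<gamma> h) \<le> nrm h"
proof -
  have "\<exists>\<phi>. continuous_on UNIV \<phi> \<and> nrm \<phi> \<le> nrm h + ennreal e \<and> (\<forall>t. cmod (conv \<gamma> h t - \<phi> t) \<le> e)"
    if e: "0 < e" for e
  proof -
    obtain p where p: "simple_function borel p"
        "\<And>s t. cmod (h (- s + t) - h (- p s + t)) \<le> e"
      using continuous_translates_uniform_approx[OF compact h e] by metis
    have fin: "finite (range p)" using simple_functionD(1)[OF p(1)] by simp
    have meas_p: "(\<lambda>s. f (p s)) \<in> borel_measurable borel" for f :: "'g \<Rightarrow> 'b::topological_space"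
      by (intro borel_measurable_simple_function simple_function_compose1[OF p(1)])
    obtain M where M: "\<And>t. cmod (h t) \<le> M" using continuous_bounded[OF h] by metis
    define a where "a = (\<lambda>x. LINT s|m. \<gamma> s * of_bool (p s = x))"
    define \<phi> where "\<phi> = (\<lambda>t. \<Sum>x\<in>range p. complex_of_real (a x) * translate x h t)"
    have meas_ind: "(\<lambda>s. of_bool (p s = x) :: real) \<in> borel_measurable borel" for x
      by (rule meas_p)
    have int_a: "integrable m (\<lambda>s. \<gamma> s * of_bool (p s = x))" for x
    proof (rule Bochner_Integration.integrable_bound[OF kernelD(5)[OF \<gamma>]])
      note [measurable] = meas_ind kernelD(4)[OF \<gamma>]
      show "(\<lambda>s. \<gamma> s * of_bool (p s = x)) \<in> borel_measurable m" by measurable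
    qed auto
    have a_nonneg: "0 \<le> a x" for x
      unfolding a_def by (intro integral_nonneg_AE AE_I2) (simp add: kernelD(2)[OF \<gamma>])
    have sum_p: "(\<Sum>x\<in>range p. of_bool (p s = x) * f x) = f (p s)" for s and f :: "'g \<Rightarrow> 'b::comm_semiring_1"
      using sum.remove[OF fin, of "p s" "\<lambda>x. of_bool (p s = x) * f x"]
      by (simp add: sum.neutral)
    have "(\<Sum>x\<in>range p. a x) = (LINT s|m. (\<Sum>x\<in>range p. \<gamma> s * of_bool (p s = x)))"
      unfolding a_def by (rule Bochner_Integration.integral_sum[symmetric]) (rule int_a)
    also have "\<dots> = 1"
      using sum_p[of _ "\<lambda>_. 1 :: real"] kernelD(3)[OF \<gamma>] by (simp flip: sum_distrib_left)
    finally have sum_a: "(\<Sum>x\<in>range p. a x) = 1" .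
    have cont_tr: "continuous_on UNIV (translate x h)" for x
      unfolding translate_def by (intro continuous_on_compose2[OF h] continuous_intros) auto
    have "continuous_on UNIV \<phi>"
      unfolding \<phi>_def by (intro continuous_intros cont_tr)
    moreover have "nrm \<phi> \<le> nrm h + ennreal e"
    proof -
      have "nrm \<phi> \<le> (\<Sum>x\<in>range p. nrm (\<lambda>t. complex_of_real (a x) * translate x h t))"
        unfolding \<phi>_def
        by (intro nrm_sum fin borel_measurable_continuous_onI continuous_intros cont_tr)
      also have "\<dots> \<le> (\<Sum>x\<in>range p. ennreal (a x) * nrm h)"
      proof (rule sum_mono)
        fix x
        have "nrm (\<lambda>t. complex_of_real (a x) * translate x h t) \<le> ennreal (a x) * nrm (translate x h)"
          using nrm_cmult[of "complex_of_real (a x)" "translate x h"] a_nonneg[of x] by simp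
        also have "\<dots> \<le> ennreal (a x) * nrm h"
          by (intro mult_left_mono Orlicz_norm_translate_le \<Phi> \<nu> inv borel_measurable_continuous_onI h) simp
        finally show "nrm (\<lambda>t. complex_of_real (a x) * translate x h t) \<le> ennreal (a x) * nrm h" .
      qed
      also have "\<dots> = ennreal (\<Sum>x\<in>range p. a x) * nrm h"
        using a_nonneg by (simp flip: sum_distrib_right)
      also have "\<dots> = nrm h" by (simp add: sum_a)
      finally show ?thesis by (simp add: add_increasing2)
    qed
    moreover have "cmod (conv \<gamma> h t - \<phi> t) \<le> e" for t
    proof -
      have meas1: "(\<lambda>s. h (- s + t)) \<in> borel_measurable borel"
        by (intro borel_measurable_continuous_onI continuous_on_compose2[OF h] continuous_intros) auto
      have meas2: "(\<lambda>s. h (- p s + t)) \<in> borel_measurable borel"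
        by (rule meas_p)
      have "\<phi> t = (\<Sum>x\<in>range p. (LINT s|m. complex_of_real (\<gamma> s * of_bool (p s = x)) * h (- x + t)))"
        by (simp add: \<phi>_def a_def translate_def del: of_real_mult)
      also have "\<dots> = (LINT s|m. (\<Sum>x\<in>range p. complex_of_real (\<gamma> s * of_bool (p s = x)) * h (- x + t)))"
        by (rule Bochner_Integration.integral_sum[symmetric])
           (intro integrable_mult_left integrable_of_real int_a)
      also have "\<dots> = (LINT s|m. complex_of_real (\<gamma> s) * h (- p s + t))"
      proof (rule Bochner_Integration.integral_cong[OF refl])
        fix s
        have "(\<Sum>x\<in>range p. complex_of_real (\<gamma> s * of_bool (p s = x)) * h (- x + t)) =
            complex_of_real (\<gamma> s) * (\<Sum>x\<in>range p. of_bool (p s = x) * h (- x + t))"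
          unfolding sum_distrib_left by (intro sum.cong) (auto simp: of_bool_def)
        then show "(\<Sum>x\<in>range p. complex_of_real (\<gamma> s * of_bool (p s = x)) * h (- x + t)) =
            complex_of_real (\<gamma> s) * h (- p s + t)"
          by (simp only: sum_p)
      qed
      finally have "conv \<gamma> h t - \<phi> t =
          (LINT s|m. complex_of_real (\<gamma> s) * h (- s + t)) - (LINT s|m. complex_of_real (\<gamma> s) * h (- p s + t))"
        by (simp add: convolution_def)
      also have "\<dots> = (LINT s|m. complex_of_real (\<gamma> s) * h (- s + t) - complex_of_real (\<gamma> s) * h (- p s + t))"
        by (intro Bochner_Integration.integral_diff[symmetric] integrable_kernel_mult[OF \<gamma>, where B = M]
            meas1 meas2 M)
      also have "\<dots> = (LINT s|m. complex_of_real (\<gamma> s) * (h (- s + t) - h (- p s + t)))"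
        by (simp add: right_diff_distrib)
      finally have eq: "conv \<gamma> h t - \<phi> t =
          (LINT s|m. complex_of_real (\<gamma> s) * (h (- s + t) - h (- p s + t)))" .
      show ?thesis
        unfolding eq by (rule kernel_average_bound[OF \<gamma>, where B = e])
          (intro borel_measurable_diff meas1 meas2 p(2))+
    qed
    ultimately show ?thesis by (intro exI[of _ \<phi>] conjI allI)
  qed
  from uniform_limit_continuous_nrm_le[of "nrm h" "conv \<gamma> h", OF this]
  show "continuous_on UNIV (conv \<gamma> h)" "nrm (conv \<gamma> h) \<le> nrm h" by simp_all
qed

text \<open>
  The \<open>L\<^sup>1\<close>-norm is taken with respect to \<open>m_inv\<close> because that is the norm which controls
  convolutions pointwise.
\<close>

definition L1 :: "('g \<Rightarrow> complex) \<Rightarrow> ennreal" where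
  "L1 f = (\<integral>\<^sup>+s. ennreal (cmod (f s)) \<partial>m_inv)"

lemma L1_le_sup:
  assumes "\<And>t. cmod (f t) \<le> c"
  shows "L1 f \<le> ennreal c"
proof -
  have "L1 f \<le> (\<integral>\<^sup>+s. ennreal c \<partial>m_inv)"
    unfolding L1_def using assms by (intro nn_integral_mono ennreal_leI)
  also have "\<dots> = ennreal c * emeasure m_inv UNIV" by (simp add: sets_eq_imp_space_eq[OF sets_m_inv])
  also have "emeasure m_inv UNIV = 1" by (simp add: emeasure_m_inv)
  finally show ?thesis by simp
qed

lemma L1_add:
  assumes [measurable]: "f \<in> borel_measurable borel" "g \<in> borel_measurable borel"
  shows "L1 (\<lambda>t. f t + g t) \<le> L1 f + L1 g"
proof -
  have "L1 (\<lambda>t. f t + g t) \<le> (\<integral>\<^sup>+s. ennreal (cmod (f s)) + ennreal (cmod (g s)) \<partial>m_inv)"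
    unfolding L1_def
    by (intro nn_integral_mono) (simp add: norm_triangle_ineq ennreal_leI flip: ennreal_plus)
  also have "\<dots> = L1 f + L1 g"
    unfolding L1_def by (rule nn_integral_add) measurable
  finally show ?thesis .
qed

lemma L1_cmult:
  assumes [measurable]: "f \<in> borel_measurable borel"
  shows "L1 (\<lambda>t. a * f t) = ennreal (cmod a) * L1 f"
  unfolding L1_def norm_mult by (simp add: ennreal_mult nn_integral_cmult)

text \<open>
  The convolution of the constant kernel 1 with \<open>|h|\<close> is the constant \<open>L1 h\<close>, and convolution does
  not increase the Orlicz norm.
\<close>

lemma L1_bound_continuous:
  assumes h: "continuous_on UNIV h"
  shows "L1 h * ennreal nrm_one \<le> nrm h"
proof -
  define u where "u = (\<lambda>t. complex_of_real (cmod (h t)))"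
  have u: "continuous_on UNIV u" unfolding u_def by (intro continuous_intros h)
  have one: "kernel (\<lambda>_. 1)" by (simp add: kernel_def measure_def)
  obtain M where M: "0 < M" "\<And>t. cmod (h t) \<le> M" using continuous_bounded[OF h] by metis
  have "L1 h \<le> ennreal M" by (rule L1_le_sup[OF M(2)])
  then have fin: "L1 h < \<infinity>" by (rule le_less_trans) simp
  have "conv (\<lambda>_. 1) u t = complex_of_real (enn2real (L1 h))" for t
  proof -
    have meas: "(\<lambda>s. cmod (h (- s + t))) \<in> borel_measurable borel"
      by (intro borel_measurable_continuous_onI continuous_on_compose2[OF h] continuous_intros) auto
    have "(LINT s|m. cmod (h (- s + t))) = enn2real (\<integral>\<^sup>+s. ennreal (cmod (h (- s + t))) \<partial>m)"
      using meas by (intro integral_eq_nn_integral) auto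
    also have "(\<integral>\<^sup>+s. ennreal (cmod (h (- s + t))) \<partial>m) = L1 h"
      unfolding L1_def
      by (rule nn_integral_reflected_translate[where f = "\<lambda>s. ennreal (cmod (h s))"])
         (intro measurable_compose[OF _ measurable_ennreal] borel_measurable_continuous_onI continuous_intros h)
    finally show ?thesis by (simp add: convolution_def u_def)
  qed
  then have "nrm (\<lambda>_. complex_of_real (enn2real (L1 h))) = nrm (conv (\<lambda>_. 1) u)" by presburger
  also have "\<dots> \<le> nrm u" by (rule conv_continuous(2)[OF one u])
  also have "\<dots> \<le> nrm h" by (rule nrm_mono) (simp add: u_def)
  finally have "ennreal (enn2real (L1 h)) * ennreal nrm_one \<le> nrm h"
    using nrm_const_ge[of "enn2real (L1 h)"] by (simp add: nrm_const_1)
  then show ?thesis using fin by simp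
qed

section \<open>Density of the continuous functions and the approximate identity\<close>

text \<open>
  Approximation by one and the same continuous function in both norms.  The comparison of the two
  norms, known for continuous functions, can be transferred to a limit only if the approximants
  converge to it in both.
\<close>

definition C_approximable :: "('g \<Rightarrow> complex) \<Rightarrow> bool" where
  "C_approximable f \<longleftrightarrow> (\<forall>e>0. \<exists>h. continuous_on UNIV h \<and>
     nrm (\<lambda>t. f t - h t) \<le> ennreal e \<and> L1 (\<lambda>t. f t - h t) \<le> ennreal e)"

lemma C_approximableD:
  assumes "C_approximable f" "0 < e"
  obtains h where "continuous_on UNIV h" "nrm (\<lambda>t. f t - h t) \<le> ennreal e"
    "L1 (\<lambda>t. f t - h t) \<le> ennreal e"
proof -
  from assms have "\<exists>h. continuous_on UNIV h \<and>
     nrm (\<lambda>t. f t - h t) \<le> ennreal e \<and> L1 (\<lambda>t. f t - h t) \<le> ennreal e"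
    by (simp add: C_approximable_def)
  then show thesis by (elim exE conjE) (rule that)
qed

lemma C_approximableI:
  assumes "\<And>e. 0 < e \<Longrightarrow> \<exists>h. continuous_on UNIV h \<and>
     nrm (\<lambda>t. f t - h t) \<le> ennreal e \<and> L1 (\<lambda>t. f t - h t) \<le> ennreal e"
  shows "C_approximable f"
  using assms by (simp add: C_approximable_def)

text \<open>
  A Urysohn function between \<open>K\<close> and \<open>U\<close> differs from the indicator of \<open>A\<close> only on \<open>U - K\<close>, which is
  small for \<open>m_inv\<close>, hence in \<open>L\<^sup>1\<close>, and small for \<open>m\<close>, hence in the Orlicz norm by absolute
  continuity of \<open>\<nu>\<close>.
\<close>

lemma C_approximable_indicator:
  assumes A: "A \<in> sets borel"
  shows "C_approximable (\<lambda>t. of_bool (t \<in> A))"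
proof (rule C_approximableI)
  fix e :: real assume e: "0 < e"
  obtain d where d: "0 < d"
    "\<And>E. E \<in> sets borel \<Longrightarrow> measure m E < d \<Longrightarrow> nrm (\<lambda>t. of_bool (t \<in> E)) \<le> ennreal e"
    using nrm_indicator_small[OF sets_m finite_measure_axioms abs_cont e] by blast
  have "0 < min d e" using d e by simp
  then obtain K U where KU: "closed K" "open U" "K \<subseteq> A" "A \<subseteq> U"
      "measure m (U - K) < min d e" "measure m_inv (U - K) < min d e"
    by (rule regular_m_and_m_inv[OF A])
  have "K \<subseteq> U" using KU by simp
  then obtain f where f: "continuous_on UNIV f" "\<And>t. 0 \<le> f t" "\<And>t. f t \<le> (1::real)"
      "\<And>t. t \<in> K \<Longrightarrow> f t = 1" "\<And>t. t \<notin> U \<Longrightarrow> f t = 0"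
    using compact_Hausdorff_Urysohn[OF compact KU(1) _ KU(2)] by metis
  let ?d = "\<lambda>t. of_bool (t \<in> A) - complex_of_real (f t)"
  have UK: "U - K \<in> sets borel" using KU(1,2) by auto
  have le: "cmod (?d t) \<le> cmod (of_bool (t \<in> U - K))" for t
  proof (cases "t \<in> U - K")
    case True
    have "?d t = complex_of_real (of_bool (t \<in> A) - f t)" by (simp add: of_bool_def)
    then have "cmod (?d t) = \<bar>of_bool (t \<in> A) - f t\<bar>" by (simp only: norm_of_real)
    also have "\<dots> \<le> 1" using f(2,3)[of t] by (simp add: of_bool_def)
    finally show ?thesis using True by simp
  next
    case False
    then have "?d t = 0" using KU(3,4) f(4,5)[of t] by auto
    then show ?thesis by simp
  qed
  have "nrm ?d \<le> nrm (\<lambda>t. of_bool (t \<in> U - K))" by (rule nrm_mono) (rule le)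
  also have "\<dots> \<le> ennreal e"
    using KU(5) by (intro d(2) UK) simp
  finally have "nrm ?d \<le> ennreal e" .
  moreover have "L1 ?d \<le> ennreal e"
  proof -
    have "L1 ?d \<le> (\<integral>\<^sup>+s. indicator (U - K) s \<partial>m_inv)"
      unfolding L1_def
    proof (rule nn_integral_mono)
      fix s
      have "ennreal (cmod (of_bool (s \<in> U - K))) = indicator (U - K) s"
        by (simp split: split_indicator)
      then show "ennreal (cmod (?d s)) \<le> indicator (U - K) s"
        using ennreal_leI[OF le[of s]] by (simp only:)
    qed
    also have "\<dots> = ennreal (measure m_inv (U - K))"
      using UK finite_measure.emeasure_eq_measure[OF finite_measure_m_inv] by simp
    also have "\<dots> \<le> ennreal e" using KU(6) by (intro ennreal_leI) simp
    finally show ?thesis .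
  qed
  ultimately show "\<exists>h. continuous_on UNIV h \<and>
     nrm (\<lambda>t. of_bool (t \<in> A) - h t) \<le> ennreal e \<and> L1 (\<lambda>t. of_bool (t \<in> A) - h t) \<le> ennreal e"
    using f(1) by (intro exI[of _ "\<lambda>t. complex_of_real (f t)"] conjI continuous_intros)
qed

lemma C_approximable_add:
  assumes f: "f \<in> borel_measurable borel" "C_approximable f" and g: "g \<in> borel_measurable borel" "C_approximable g"
  shows "C_approximable (\<lambda>t. f t + g t)"
proof (rule C_approximableI)
  fix e :: real assume "0 < e"
  then have e: "0 < e / 2" by simp
  obtain h where h: "continuous_on UNIV h" "nrm (\<lambda>t. f t - h t) \<le> ennreal (e / 2)"
      "L1 (\<lambda>t. f t - h t) \<le> ennreal (e / 2)" by (rule C_approximableD[OF f(2) e])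
  obtain k where k: "continuous_on UNIV k" "nrm (\<lambda>t. g t - k t) \<le> ennreal (e / 2)"
      "L1 (\<lambda>t. g t - k t) \<le> ennreal (e / 2)" by (rule C_approximableD[OF g(2) e])
  have eq: "(\<lambda>t. f t + g t - (h t + k t)) = (\<lambda>t. (f t - h t) + (g t - k t))"
    by (simp add: algebra_simps)
  have half: "ennreal (e / 2) + ennreal (e / 2) = ennreal e"
    using e by (simp flip: ennreal_plus)
  have meas: "(\<lambda>t. f t - h t) \<in> borel_measurable borel" "(\<lambda>t. g t - k t) \<in> borel_measurable borel"
    by (intro borel_measurable_diff f g borel_measurable_continuous_onI h k)+
  have "nrm (\<lambda>t. f t + g t - (h t + k t)) \<le> ennreal (e / 2) + ennreal (e / 2)"
    unfolding eq using h(2) k(2) by (intro order_trans[OF nrm_add[OF meas]] add_mono)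
  moreover have "L1 (\<lambda>t. f t + g t - (h t + k t)) \<le> ennreal (e / 2) + ennreal (e / 2)"
    unfolding eq using h(3) k(3) by (intro order_trans[OF L1_add[OF meas]] add_mono)
  ultimately show "\<exists>h. continuous_on UNIV h \<and>
     nrm (\<lambda>t. f t + g t - h t) \<le> ennreal e \<and> L1 (\<lambda>t. f t + g t - h t) \<le> ennreal e"
    unfolding half using h(1) k(1) by (intro exI[of _ "\<lambda>t. h t + k t"] conjI continuous_intros)
qed

lemma C_approximable_cmult:
  assumes f: "f \<in> borel_measurable borel" "C_approximable f"
  shows "C_approximable (\<lambda>t. a * f t)"
proof (rule C_approximableI)
  fix e :: real assume e: "0 < e"
  define d where "d = e / (cmod a + 1)"
  have d: "0 < d" using e by (simp add: d_def add_nonneg_pos)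
  have "cmod a * d \<le> (cmod a + 1) * d" using d by (intro mult_right_mono) auto
  also have "(cmod a + 1) * d = e" by (simp add: d_def add_nonneg_eq_0_iff)
  finally have "ennreal (cmod a * d) \<le> ennreal e" by (rule ennreal_leI)
  then have ad: "ennreal (cmod a) * ennreal d \<le> ennreal e" using d by (simp add: ennreal_mult)
  obtain h where h: "continuous_on UNIV h" "nrm (\<lambda>t. f t - h t) \<le> ennreal d"
      "L1 (\<lambda>t. f t - h t) \<le> ennreal d" by (rule C_approximableD[OF f(2) d])
  have eq: "(\<lambda>t. a * f t - a * h t) = (\<lambda>t. a * (f t - h t))" by (simp add: right_diff_distrib)
  have "nrm (\<lambda>t. a * f t - a * h t) \<le> ennreal (cmod a) * ennreal d"
    unfolding eq using h(2) by (intro order_trans[OF nrm_cmult] mult_left_mono) simp_all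
  moreover have "L1 (\<lambda>t. a * f t - a * h t) \<le> ennreal (cmod a) * ennreal d"
    unfolding eq L1_cmult[OF borel_measurable_diff[OF f(1) borel_measurable_continuous_onI[OF h(1)]]]
    using h(3) by (rule mult_left_mono) simp
  ultimately show "\<exists>h. continuous_on UNIV h \<and>
     nrm (\<lambda>t. a * f t - h t) \<le> ennreal e \<and> L1 (\<lambda>t. a * f t - h t) \<le> ennreal e"
    using h(1) ad by (intro exI[of _ "\<lambda>t. a * h t"] conjI continuous_intros) (auto intro: order_trans)
qed

lemma C_approximable_sum:
  assumes "finite I" "\<And>i. i \<in> I \<Longrightarrow> f i \<in> borel_measurable borel" "\<And>i. i \<in> I \<Longrightarrow> C_approximable (f i)"
  shows "C_approximable (\<lambda>t. \<Sum>i\<in>I. f i t)"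
  using assms
proof (induction I rule: finite_induct)
  case empty
  show ?case using C_approximable_indicator[of "{}"] by simp
next
  case (insert i I)
  have "C_approximable (\<lambda>t. f i t + (\<Sum>i\<in>I. f i t))"
    using insert by (intro C_approximable_add borel_measurable_sum) auto
  then show ?case using insert.hyps by simp
qed

lemma C_approximable_simple:
  fixes \<phi> :: "'g \<Rightarrow> complex"
  assumes \<phi>: "simple_function borel \<phi>"
  shows "C_approximable \<phi>"
proof -
  have fin: "finite (range \<phi>)" by (rule simple_function_borelD(1)[OF \<phi>])
  have meas: "(\<lambda>t. of_bool (t \<in> \<phi> -` {a}) :: complex) \<in> borel_measurable borel" for a
  proof -
    have "(indicator (\<phi> -` {a}) :: 'g \<Rightarrow> complex) \<in> borel_measurable borel"
      by (rule borel_measurable_indicator[OF simple_function_borelD(2)[OF \<phi>]])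
    then show ?thesis by (simp add: indicator_def[abs_def] of_bool_def)
  qed
  have "C_approximable (\<lambda>t. \<Sum>a\<in>range \<phi>. a * of_bool (t \<in> \<phi> -` {a}))"
    by (intro C_approximable_sum fin C_approximable_cmult borel_measurable_times borel_measurable_const meas
        C_approximable_indicator simple_function_borelD(2)[OF \<phi>])
  moreover have "(\<Sum>a\<in>range \<phi>. a * of_bool (t \<in> \<phi> -` {a})) = \<phi> t" for t
    using fin by (simp add: of_bool_def if_distrib cong: if_cong)
  ultimately show ?thesis by simp
qed

lemma L1_bound_simple:
  fixes \<phi> :: "'g \<Rightarrow> complex"
  assumes \<phi>: "simple_function borel \<phi>"
  shows "L1 \<phi> * ennreal nrm_one \<le> nrm \<phi>"
proof (rule ennreal_le_epsilon)
  fix e :: real assume e: "0 < e"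
  define d where "d = e / (1 + nrm_one)"
  have d: "0 < d" "d * (1 + nrm_one) = e" using e nrm_one_pos by (simp_all add: d_def)
  obtain h where h: "continuous_on UNIV h" "nrm (\<lambda>t. \<phi> t - h t) \<le> ennreal d"
      "L1 (\<lambda>t. \<phi> t - h t) \<le> ennreal d" by (rule C_approximableD[OF C_approximable_simple[OF \<phi>] d(1)])
  have meas: "\<phi> \<in> borel_measurable borel" "h \<in> borel_measurable borel"
      "(\<lambda>t. \<phi> t - h t) \<in> borel_measurable borel" "(\<lambda>t. h t - \<phi> t) \<in> borel_measurable borel"
    by (intro borel_measurable_diff borel_measurable_simple_function \<phi> borel_measurable_continuous_onI h)+
  have "L1 \<phi> = L1 (\<lambda>t. h t + (\<phi> t - h t))" by simp
  also have "\<dots> \<le> L1 h + ennreal d"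
    using h(3) by (intro order_trans[OF L1_add[OF meas(2,3)]] add_left_mono)
  finally have "L1 \<phi> * ennreal nrm_one \<le> (L1 h + ennreal d) * ennreal nrm_one" by (rule mult_right_mono) simp
  also have "\<dots> = L1 h * ennreal nrm_one + ennreal d * ennreal nrm_one" by (rule distrib_right)
  also have "\<dots> \<le> nrm h + ennreal d * ennreal nrm_one"
    by (intro add_right_mono L1_bound_continuous h)
  also have "nrm h = nrm (\<lambda>t. \<phi> t + (h t - \<phi> t))" by simp
  also have "\<dots> \<le> nrm \<phi> + ennreal d"
    using h(2) by (intro order_trans[OF nrm_add[OF meas(1,4)]] add_left_mono)
      (simp add: nrm_minus_commute[of h \<phi>])
  finally have "L1 \<phi> * ennreal nrm_one \<le> nrm \<phi> + ennreal d + ennreal d * ennreal nrm_one" by simp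
  also have "\<dots> = nrm \<phi> + ennreal (d * (1 + nrm_one))"
    using d(1) nrm_one_pos by (simp add: ennreal_mult add.assoc distrib_left)
  finally show "L1 \<phi> * ennreal nrm_one \<le> nrm \<phi> + ennreal e" by (simp only: d(2))
qed

text \<open>
  The integral of \<open>|f|\<close> is the supremum of the integrals of simple functions below \<open>|f|\<close>, and the
  Orlicz norm is monotone.
\<close>

lemma L1_bound:
  shows "L1 f * ennreal nrm_one \<le> nrm f"
proof -
  define S where "S = {g. simple_function m_inv g \<and> g \<le> (\<lambda>s. ennreal (cmod (f s))) \<and> (\<forall>s. g s < top)}"
  have "(\<lambda>_. 0) \<in> S" by (simp add: S_def le_fun_def)
  then have ne: "S \<noteq> {}" by blast
  have "L1 f * ennreal nrm_one = (SUP g\<in>S. integral\<^sup>S m_inv g) * ennreal nrm_one"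
    by (simp add: L1_def nn_integral_def_finite S_def)
  also have "\<dots> = (SUP g\<in>S. integral\<^sup>S m_inv g * ennreal nrm_one)"
    by (rule SUP_mult_right_ennreal)
  also have "\<dots> \<le> nrm f"
  proof (rule SUP_least)
    fix g assume "g \<in> S"
    then have g: "simple_function m_inv g" "\<And>s. g s \<le> ennreal (cmod (f s))" "\<And>s. g s < top"
      by (simp_all add: S_def le_fun_def)
    define \<phi> where "\<phi> = (\<lambda>s. complex_of_real (enn2real (g s)))"
    have cmod_\<phi>: "ennreal (cmod (\<phi> s)) = g s" for s using g(3)[of s] by (simp add: \<phi>_def)
    have \<phi>: "simple_function borel \<phi>"
      unfolding \<phi>_def
      by (rule simple_function_compose1[of _ _ "\<lambda>x. complex_of_real (enn2real x)"])
         (use g(1) in \<open>simp add: simple_function_def sets_eq_imp_space_eq[OF sets_m_inv]\<close>)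
    have "integral\<^sup>S m_inv g = L1 \<phi>"
      unfolding L1_def cmod_\<phi> by (rule nn_integral_eq_simple_integral[symmetric, OF g(1)])
    then have "integral\<^sup>S m_inv g * ennreal nrm_one \<le> nrm \<phi>" using L1_bound_simple[OF \<phi>] by simp
    also have "\<dots> \<le> nrm f"
    proof (rule nrm_mono)
      fix s
      have "ennreal (cmod (\<phi> s)) \<le> ennreal (cmod (f s))" unfolding cmod_\<phi> by (rule g(2))
      then show "cmod (\<phi> s) \<le> cmod (f s)" by simp
    qed
    finally show "integral\<^sup>S m_inv g * ennreal nrm_one \<le> nrm f" .
  qed
  finally show ?thesis .
qed

lemma L1_le_nrm: "L1 f \<le> ennreal (1 / nrm_one) * nrm f"
proof -
  have "L1 f = ennreal (1 / nrm_one) * (L1 f * ennreal nrm_one)"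
  proof -
    have "ennreal (1 / nrm_one) * ennreal nrm_one = 1" using nrm_one_pos by (simp flip: ennreal_mult)
    then show ?thesis by (simp add: mult.left_commute[of _ "L1 f"])
  qed
  also have "\<dots> \<le> ennreal (1 / nrm_one) * nrm f" by (intro mult_left_mono L1_bound) simp
  finally show ?thesis .
qed

text \<open>
  Membership in the closure of the continuous functions under the Orlicz norm, the form in which
  membership in \<open>L\<^sup>\<Phi>(\<nu>)\<close> is used.
\<close>

definition in_C_closure :: "('g \<Rightarrow> complex) \<Rightarrow> bool" where
  "in_C_closure f \<longleftrightarrow> f \<in> borel_measurable borel \<and> nrm f < \<infinity> \<and>
     (\<forall>e>0. \<exists>h. continuous_on UNIV h \<and> nrm (\<lambda>t. f t - h t) \<le> ennreal e)"

lemma in_C_closureD: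
  assumes "in_C_closure f"
  shows "f \<in> borel_measurable borel" "nrm f < \<infinity>" "L1 f < \<infinity>"
    "0 < e \<Longrightarrow> \<exists>h. continuous_on UNIV h \<and> nrm (\<lambda>t. f t - h t) \<le> ennreal e"
proof -
  show "f \<in> borel_measurable borel" and fin: "nrm f < \<infinity>"
    and "0 < e \<Longrightarrow> \<exists>h. continuous_on UNIV h \<and> nrm (\<lambda>t. f t - h t) \<le> ennreal e"
    using assms by (simp_all add: in_C_closure_def)
  have "ennreal (1 / nrm_one) * nrm f < \<infinity>" using fin by (simp add: ennreal_mult_less_top)
  with L1_le_nrm show "L1 f < \<infinity>" by (rule le_less_trans)
qed

lemma nrm_continuous_finite:
  assumes "continuous_on UNIV h"
  shows "nrm h < \<infinity>"
proof -
  obtain M where M: "\<And>t. cmod (h t) \<le> M" using continuous_bounded[OF assms] by metis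
  have "nrm h \<le> ennreal M * ennreal nrm_one" using nrm_le_sup[OF M] by (simp add: nrm_const_1)
  also have "\<dots> < \<infinity>" by (simp add: ennreal_mult_less_top)
  finally show ?thesis .
qed

lemma in_C_closure_continuous: "continuous_on UNIV h \<Longrightarrow> in_C_closure h"
  unfolding in_C_closure_def
proof (intro conjI allI impI)
  assume h: "continuous_on UNIV h"
  show "h \<in> borel_measurable borel" "nrm h < \<infinity>"
    using h by (simp_all only: borel_measurable_continuous_onI nrm_continuous_finite)
  have "nrm (\<lambda>t. h t - h t) = 0" using nrm_cmult[of 0 "\<lambda>_. 0"] by simp
  then show "\<exists>k. continuous_on UNIV k \<and> nrm (\<lambda>t. h t - k t) \<le> ennreal e" for e
    using h by (intro exI[of _ h] conjI) simp_all
qed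

lemma in_C_closure_diff:
  assumes f: "in_C_closure f" and k: "continuous_on UNIV k"
  shows "in_C_closure (\<lambda>t. f t - k t)"
proof -
  have "nrm (\<lambda>t. f t - k t) \<le> nrm f + nrm k"
  proof -
    have "nrm (\<lambda>t. f t + - 1 * k t) \<le> nrm f + nrm (\<lambda>t. - 1 * k t)"
      by (intro nrm_add in_C_closureD(1)[OF f] borel_measurable_times borel_measurable_const
          borel_measurable_continuous_onI k)
    also have "nrm (\<lambda>t. - 1 * k t) \<le> nrm k" by (rule nrm_mono) simp
    finally show ?thesis by simp
  qed
  also have "\<dots> < \<infinity>" using in_C_closureD(2)[OF f] nrm_continuous_finite[OF k] by simp
  finally have "nrm (\<lambda>t. f t - k t) < \<infinity>" .
  moreover have "\<exists>h. continuous_on UNIV h \<and> nrm (\<lambda>t. f t - k t - h t) \<le> ennreal e" if e: "0 < e" for e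
  proof -
    obtain h where "continuous_on UNIV h" "nrm (\<lambda>t. f t - h t) \<le> ennreal e"
      using in_C_closureD(4)[OF f e] by (elim exE conjE)
    then show ?thesis
      by (intro exI[of _ "\<lambda>t. h t - k t"] conjI continuous_intros k) (simp_all add: algebra_simps)
  qed
  ultimately show ?thesis
    unfolding in_C_closure_def
    by (intro conjI allI impI borel_measurable_diff in_C_closureD(1)[OF f] borel_measurable_continuous_onI[OF k])
qed

lemma conv_diff:
  assumes \<gamma>: "kernel \<gamma>" and f: "in_C_closure f" and h: "in_C_closure h"
  shows "conv \<gamma> (\<lambda>t. f t - h t) t = conv \<gamma> f t - conv \<gamma> h t"
proof -
  obtain M where M: "\<And>t. norm (\<gamma> t) \<le> M" using continuous_bounded[OF kernelD(1)[OF \<gamma>]] by metis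
  have meas: "(\<lambda>s. complex_of_real (\<gamma> s)) \<in> borel_measurable borel"
    by (intro borel_measurable_continuous_onI continuous_intros kernelD(1)[OF \<gamma>])
  have int: "integrable m (\<lambda>s. complex_of_real (\<gamma> s) * u (- s + t))" if u: "in_C_closure u" for u
    using in_C_closureD(3)[OF u] M
    by (intro integrable_bounded_mult_translate(1)[OF meas, where M = M] in_C_closureD(1)[OF u])
       (simp_all add: L1_def)
  show ?thesis
    unfolding convolution_def right_diff_distrib
    by (rule Bochner_Integration.integral_diff[OF int[OF f] int[OF h]])
qed

text \<open>
  If \<open>h\<close> is continuous with \<open>\<parallel>f - h\<parallel> \<le> d\<close>, then \<open>L1 (f - h) \<le> d / \<parallel>1\<parallel>\<close>, so the convolutions of \<open>f\<close>
  and \<open>h\<close> differ by at most \<open>M d / \<parallel>1\<parallel>\<close> everywhere, where \<open>M\<close> bounds \<open>\<gamma>\<close>.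
\<close>

lemma conv_of_C_closure:
  assumes \<gamma>: "kernel \<gamma>" and f: "in_C_closure f"
  shows "continuous_on UNIV (conv \<gamma> f)" "nrm (conv \<gamma> f) \<le> nrm f"
proof -
  obtain M where M: "0 < M" "\<And>t. norm (\<gamma> t) \<le> M" using continuous_bounded[OF kernelD(1)[OF \<gamma>]] by metis
  have meas: "(\<lambda>s. complex_of_real (\<gamma> s)) \<in> borel_measurable borel"
    by (intro borel_measurable_continuous_onI continuous_intros kernelD(1)[OF \<gamma>])
  have "\<exists>\<phi>. continuous_on UNIV \<phi> \<and> nrm \<phi> \<le> nrm f + ennreal e \<and> (\<forall>t. cmod (conv \<gamma> f t - \<phi> t) \<le> e)"
    if e: "0 < e" for e
  proof -
    define d where "d = min e (e * nrm_one / M)"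
    have d: "0 < d" "d \<le> e" "M * (1 / nrm_one * d) \<le> e"
    proof -
      show "0 < d" "d \<le> e" using e M nrm_one_pos by (simp_all add: d_def)
      have "M * (1 / nrm_one * d) \<le> M * (1 / nrm_one * (e * nrm_one / M))"
        using M nrm_one_pos by (intro mult_left_mono) (simp_all add: d_def)
      then show "M * (1 / nrm_one * d) \<le> e" using M nrm_one_pos by simp
    qed
    obtain h where h: "continuous_on UNIV h" "nrm (\<lambda>t. f t - h t) \<le> ennreal d"
      using in_C_closureD(4)[OF f d(1)] by (elim exE conjE)
    have fh: "in_C_closure (\<lambda>t. f t - h t)" by (rule in_C_closure_diff[OF f h(1)])
    have "nrm (conv \<gamma> h) \<le> nrm h" by (rule conv_continuous(2)[OF \<gamma> h(1)])
    also have "nrm h = nrm (\<lambda>t. f t + (h t - f t))" by simp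
    also have "\<dots> \<le> nrm f + nrm (\<lambda>t. h t - f t)"
      by (intro nrm_add borel_measurable_diff in_C_closureD(1)[OF f] borel_measurable_continuous_onI h)
    also have "\<dots> \<le> nrm f + ennreal e"
      unfolding nrm_minus_commute[of h f]
      using h(2) d(2) by (intro add_left_mono) (auto intro: order_trans ennreal_leI)
    finally have "nrm (conv \<gamma> h) \<le> nrm f + ennreal e" .
    moreover have "cmod (conv \<gamma> f t - conv \<gamma> h t) \<le> e" for t
    proof -
      have "ennreal (cmod (conv \<gamma> f t - conv \<gamma> h t)) = ennreal (cmod (conv \<gamma> (\<lambda>t. f t - h t) t))"
        by (simp only: conv_diff[OF \<gamma> f in_C_closure_continuous[OF h(1)]])
      also have "\<dots> \<le> ennreal M * L1 (\<lambda>t. f t - h t)"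
        unfolding convolution_def L1_def
        using in_C_closureD(3)[OF fh] M(2)
        by (intro integrable_bounded_mult_translate(2)[OF meas] in_C_closureD(1)[OF fh])
           (simp_all add: L1_def)
      also have "\<dots> \<le> ennreal M * (ennreal (1 / nrm_one) * ennreal d)"
        using h(2) by (intro mult_left_mono order_trans[OF L1_le_nrm]) auto
      also have "\<dots> = ennreal (M * (1 / nrm_one * d))"
        using M(1) nrm_one_pos d(1) by (simp flip: ennreal_mult)
      also have "\<dots> \<le> ennreal e" by (rule ennreal_leI[OF d(3)])
      finally show ?thesis using e by simp
    qed
    ultimately show ?thesis
      using conv_continuous(1)[OF \<gamma> h(1)] by (intro exI[of _ "conv \<gamma> h"] conjI allI)
  qed
  from uniform_limit_continuous_nrm_le[of "nrm f" "conv \<gamma> f", OF this]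
  show "continuous_on UNIV (conv \<gamma> f)" "nrm (conv \<gamma> f) \<le> nrm f" by simp_all
qed

text \<open>
  With \<open>h\<close> continuous and close to \<open>f\<close>, the difference \<open>\<gamma> * f - f\<close> is
  \<open>\<gamma> * (f - h) + (\<gamma> * h - h) + (h - f)\<close>.  The outer terms are small for every kernel \<open>\<gamma>\<close>; the middle
  one is uniformly small as soon as \<open>\<gamma>\<close> lives where \<open>h (- s + t)\<close> is close to \<open>h t\<close> for all \<open>t\<close>.
  The neighbourhood \<open>U\<close> depends on \<open>f\<close> and \<open>e\<close> only.
\<close>

lemma approximate_identity:
  assumes f: "in_C_closure f" and e: "0 < e"
  obtains U where "open U" "0 \<in> U"
    "\<forall>\<gamma>. kernel \<gamma> \<longrightarrow> (\<forall>s. \<gamma> s \<noteq> 0 \<longrightarrow> s \<in> U) \<longrightarrow> nrm (\<lambda>t. conv \<gamma> f t - f t) \<le> ennreal e"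
proof -
  have e3: "0 < e / 3" "0 < e / 3 / nrm_one" using e nrm_one_pos by simp_all
  obtain h where h: "continuous_on UNIV h" "nrm (\<lambda>t. f t - h t) \<le> ennreal (e / 3)"
    using in_C_closureD(4)[OF f e3(1)] by (elim exE conjE)
  obtain V where V: "open V" "0 \<in> V" "\<And>v t. v \<in> V \<Longrightarrow> cmod (h (v + t) - h t) \<le> e / 3 / nrm_one"
    using continuous_uniform_left_translation[OF compact h(1) e3(2)] by metis
  have bound: "nrm (\<lambda>t. conv \<gamma> f t - f t) \<le> ennreal e"
    if \<gamma>: "kernel \<gamma>" and supp: "\<And>s. \<gamma> s \<noteq> 0 \<Longrightarrow> s \<in> uminus -` V" for \<gamma>
  proof -
    have fh: "in_C_closure (\<lambda>t. f t - h t)" by (rule in_C_closure_diff[OF f h(1)])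
    note cont = conv_of_C_closure(1)[OF \<gamma> f] conv_continuous(1)[OF \<gamma> h(1)]
    note meas = in_C_closureD(1)[OF f] borel_measurable_continuous_onI[OF h(1)] cont[THEN borel_measurable_continuous_onI]
    have "(\<lambda>t. conv \<gamma> f t - conv \<gamma> h t) = conv \<gamma> (\<lambda>t. f t - h t)"
      by (rule ext) (rule conv_diff[OF \<gamma> f in_C_closure_continuous[OF h(1)], symmetric])
    then have "nrm (\<lambda>t. conv \<gamma> f t - conv \<gamma> h t) = nrm (conv \<gamma> (\<lambda>t. f t - h t))"
      by (rule arg_cong)
    also have "\<dots> \<le> ennreal (e / 3)" using conv_of_C_closure(2)[OF \<gamma> fh] h(2) by (rule order_trans)
    finally have 1: "nrm (\<lambda>t. conv \<gamma> f t - conv \<gamma> h t) \<le> ennreal (e / 3)" .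
    have "cmod (conv \<gamma> h t - h t) \<le> e / 3 / nrm_one" for t
    proof -
      obtain M where M: "\<And>t. cmod (h t) \<le> M" using continuous_bounded[OF h(1)] by metis
      have meas1: "(\<lambda>s. h (- s + t)) \<in> borel_measurable borel"
        by (intro borel_measurable_continuous_onI continuous_on_compose2[OF h(1)] continuous_intros) auto
      have "h t = (LINT s|m. complex_of_real (\<gamma> s) * h t)" using kernelD(3)[OF \<gamma>] by simp
      then have "conv \<gamma> h t - h t =
          (LINT s|m. complex_of_real (\<gamma> s) * h (- s + t)) - (LINT s|m. complex_of_real (\<gamma> s) * h t)"
        by (simp only: convolution_def)
      also have "\<dots> = (LINT s|m. complex_of_real (\<gamma> s) * h (- s + t) - complex_of_real (\<gamma> s) * h t)"
        by (intro Bochner_Integration.integral_diff[symmetric] integrable_kernel_mult[OF \<gamma>, where B = M]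
            meas1 borel_measurable_const M)
      also have "\<dots> = (LINT s|m. complex_of_real (\<gamma> s) * (h (- s + t) - h t))"
        by (simp only: right_diff_distrib)
      also have "cmod \<dots> \<le> e / 3 / nrm_one"
      proof (rule kernel_average_bound[OF \<gamma>])
        show "(\<lambda>s. h (- s + t) - h t) \<in> borel_measurable borel"
          by (intro borel_measurable_diff meas1 borel_measurable_const)
        show "cmod (h (- s + t) - h t) \<le> M + M" for s
          by (rule order_trans[OF norm_triangle_ineq4 add_mono[OF M M]])
        show "cmod (h (- s + t) - h t) \<le> e / 3 / nrm_one" if "\<gamma> s \<noteq> 0" for s
          using V(3)[of "- s" t] supp[OF that] by simp
      qed
      finally show ?thesis .
    qed
    then have "nrm (\<lambda>t. conv \<gamma> h t - h t) \<le> ennreal (e / 3 / nrm_one) * nrm (\<lambda>_. 1)" by (rule nrm_le_sup)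
    also have "\<dots> = ennreal (e / 3)" using e nrm_one_pos by (simp add: nrm_const_1 flip: ennreal_mult)
    finally have 2: "nrm (\<lambda>t. conv \<gamma> h t - h t) \<le> ennreal (e / 3)" .
    have "nrm (\<lambda>t. conv \<gamma> f t - f t) \<le>
        nrm (\<lambda>t. conv \<gamma> f t - conv \<gamma> h t) + (nrm (\<lambda>t. conv \<gamma> h t - h t) + nrm (\<lambda>t. h t - f t))"
      by (rule order_trans[OF nrm_triangle[OF meas(3,4,1)] add_left_mono[OF nrm_triangle[OF meas(4,2,1)]]])
    also have "\<dots> \<le> ennreal (e / 3) + (ennreal (e / 3) + ennreal (e / 3))"
      using h(2) unfolding nrm_minus_commute[of h f] by (intro add_mono 1 2)
    also have "\<dots> = ennreal e" using e by (simp flip: ennreal_plus)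
    finally show ?thesis .
  qed
  show thesis
  proof (rule that[of "uminus -` V"])
    show "open (uminus -` V)" by (intro open_vimage V continuous_intros)
  qed (use V(2) bound in simp_all)
qed

lemma Orlicz_space_subset_C_closure:
  assumes "f \<in> Orlicz_space \<Phi> \<nu>"
  shows "in_C_closure f"
proof -
  have f: "f \<in> borel_measurable borel" "nrm f < \<infinity>"
    using assms by (simp_all add: Orlicz_space_def weak_Orlicz_space_def)
  have "\<exists>h. continuous_on UNIV h \<and> nrm (\<lambda>t. f t - h t) \<le> ennreal e" if e: "0 < e" for e
  proof -
    have e2: "0 < e / 2" "0 < ennreal (e / 2)" using e by simp_all
    have "\<forall>\<epsilon>>0. \<exists>\<phi>. simple_function borel \<phi> \<and> nrm (\<lambda>t. f t - \<phi> t) < \<epsilon>"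
      using assms by (simp add: Orlicz_space_def)
    from this[rule_format, OF e2(2)]
    obtain \<phi> where \<phi>: "simple_function borel \<phi>" "nrm (\<lambda>t. f t - \<phi> t) < ennreal (e / 2)"
      by (elim exE conjE)
    obtain h where h: "continuous_on UNIV h" "nrm (\<lambda>t. \<phi> t - h t) \<le> ennreal (e / 2)"
      by (rule C_approximableD[OF C_approximable_simple[OF \<phi>(1)] e2(1)])
    have "nrm (\<lambda>t. f t - h t) \<le> nrm (\<lambda>t. f t - \<phi> t) + nrm (\<lambda>t. \<phi> t - h t)"
      by (intro nrm_triangle f borel_measurable_simple_function \<phi> borel_measurable_continuous_onI h)
    also have "\<dots> \<le> ennreal (e / 2) + ennreal (e / 2)" using \<phi>(2) h(2) by (intro add_mono) auto
    also have "\<dots> = ennreal e" using e by (simp flip: ennreal_plus)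
    finally show ?thesis using h(1) by (intro exI[of _ h] conjI)
  qed
  with f show ?thesis by (simp add: in_C_closure_def)
qed

lemma ennreal_pos_real_below:
  fixes \<epsilon> :: ennreal
  assumes "0 < \<epsilon>"
  obtains e where "0 < e" "ennreal e < \<epsilon>"
proof -
  obtain z where z: "0 < z" "z < \<epsilon>" using dense[OF assms] by blast
  then show thesis by (cases z) (auto intro: that)
qed

lemma continuous_in_Orlicz_space:
  assumes h: "continuous_on UNIV h"
  shows "h \<in> Orlicz_space \<Phi> \<nu>"
proof -
  have "\<exists>\<phi>. simple_function borel \<phi> \<and> nrm (\<lambda>t. h t - \<phi> t) < \<epsilon>" if \<epsilon>: "0 < \<epsilon>" for \<epsilon>
  proof -
    obtain e where e: "0 < e" "ennreal e < \<epsilon>" using ennreal_pos_real_below[OF \<epsilon>] by metis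
    have "0 < e / nrm_one" using e nrm_one_pos by simp
    then obtain \<phi> where \<phi>: "simple_function borel \<phi>" "\<And>t. cmod (h t - \<phi> t) \<le> e / nrm_one"
      using continuous_uniform_approx_simple[OF compact h] by metis
    have "nrm (\<lambda>t. h t - \<phi> t) \<le> ennreal (e / nrm_one) * nrm (\<lambda>_. 1)" by (rule nrm_le_sup[OF \<phi>(2)])
    also have "\<dots> = ennreal e" using e(1) nrm_one_pos by (simp add: nrm_const_1 flip: ennreal_mult)
    finally have "nrm (\<lambda>t. h t - \<phi> t) < \<epsilon>" using e(2) by (rule le_less_trans)
    with \<phi>(1) show ?thesis by (intro exI[of _ \<phi>] conjI)
  qed
  then show ?thesis
    using nrm_continuous_finite[OF h] borel_measurable_continuous_onI[OF h]
    by (simp add: Orlicz_space_def weak_Orlicz_space_def)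
qed

text \<open>
  For a Urysohn function \<open>f\<close> that vanishes off \<open>U\<close>, the closed support may leave \<open>U\<close>.  The support of
  \<open>max 0 (f - 1/2)\<close> lies in the closed set \<open>{f \<ge> 1/2}\<close>, which is contained in \<open>U\<close>.
\<close>

lemma kernel_with_support_in:
  assumes U: "open U" "0 \<in> U"
  obtains \<gamma> where "kernel \<gamma>" "\<gamma> 0 \<noteq> 0" "supp (\<lambda>t. complex_of_real (\<gamma> t)) \<subseteq> U"
proof -
  obtain f where f: "continuous_on UNIV f" "\<And>t. 0 \<le> f t" "\<And>t. f t \<le> (1::real)"
      "\<And>t. t \<in> {0} \<Longrightarrow> f t = 1" "\<And>t. t \<notin> U \<Longrightarrow> f t = 0"
    using compact_Hausdorff_Urysohn[OF compact, of "{0}" U] U by auto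
  define g where "g = (\<lambda>t. max 0 (f t - 1 / 2))"
  have g: "continuous_on UNIV g" unfolding g_def by (intro continuous_intros f)
  have g_nonneg: "0 \<le> g t" for t by (simp add: g_def)
  have g_le: "g t \<le> 1" for t using f(3)[of t] by (simp add: g_def)
  have "g 0 = 1 / 2" using f(4)[of 0] by (simp add: g_def)
  have meas: "g \<in> borel_measurable m"
    using borel_measurable_continuous_onI[OF g] by simp
  have int: "integrable m g"
    by (rule integrable_const_bound[where B = 1]) (use meas g_nonneg g_le in auto)
  define W where "W = {t. 1 / 4 < g t}"
  have W: "open W" "0 \<in> W"
    using \<open>g 0 = 1 / 2\<close> unfolding W_def by (auto intro!: open_Collect_less continuous_intros g)
  have "0 < measure m W / 4" using measure_open_pos[OF W] by simp
  also have "measure m W / 4 = (LINT t|m. (1 / 4) * indicator W t)"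
    using W by simp
  also have "\<dots> \<le> integral\<^sup>L m g"
  proof (rule integral_mono[OF _ int])
    show "integrable m (\<lambda>t. 1 / 4 * indicator W t :: real)"
      using W by (intro integrable_mult_right integrable_real_indicator) (auto simp: emeasure_eq_measure)
    show "1 / 4 * indicator W t \<le> g t" for t
      using g_nonneg[of t] by (auto simp: W_def split: split_indicator)
  qed
  finally have pos: "0 < integral\<^sup>L m g" .
  define \<gamma> where "\<gamma> = (\<lambda>t. g t / integral\<^sup>L m g)"
  have "kernel \<gamma>"
    using pos g_nonneg unfolding kernel_def \<gamma>_def
    by (auto intro!: continuous_intros g)
  moreover have "\<gamma> 0 \<noteq> 0" using pos \<open>g 0 = 1 / 2\<close> by (simp add: \<gamma>_def)
  moreover have "supp (\<lambda>t. complex_of_real (\<gamma> t)) \<subseteq> U"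
  proof -
    have "{t. complex_of_real (\<gamma> t) \<noteq> 0} \<subseteq> {t. 1 / 2 \<le> f t}" by (auto simp: \<gamma>_def g_def max_def)
    moreover have "closed {t. 1 / 2 \<le> f t}" by (intro closed_Collect_le continuous_intros f)
    ultimately have "supp (\<lambda>t. complex_of_real (\<gamma> t)) \<subseteq> {t. 1 / 2 \<le> f t}"
      unfolding supp_def by (rule closure_minimal)
    also have "\<dots> \<subseteq> U" using f(5) by force
    finally show ?thesis .
  qed
  ultimately show thesis by (rule that)
qed

end

theorem theorem4p5:
  fixes m :: "'g::{topological_group_add, t2_space} measure"
    and \<Phi> :: "real \<Rightarrow> real"
    and \<nu> :: "'g set \<Rightarrow> 'x::complex_banach"
  assumes "compact (UNIV :: 'g set)"
    and "normalized_haar_measure m"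
    and "Young_function \<Phi>"
    and "vector_measure \<nu>"
    and "nonzero_vector_measure \<nu>"
    and "abs_continuous_wrt \<nu> m"
    and "norm_integral_translation_invariant \<nu>"
  shows "\<exists>(\<Lambda> :: 'g set set) (le :: 'g set \<Rightarrow> 'g set \<Rightarrow> bool) (g :: 'g set \<Rightarrow> 'g \<Rightarrow> complex).
           directed_set \<Lambda> le \<and>
           (\<forall>l\<in>\<Lambda>. g l \<in> Orlicz_space \<Phi> \<nu>) \<and>
           (\<forall>l\<in>\<Lambda>. continuous_on UNIV (g l)) \<and>
           (\<forall>l\<in>\<Lambda>. \<forall>t. g l t \<in> \<real>\<^sub>\<ge>\<^sub>0) \<and>
           (\<forall>a\<in>\<Lambda>. \<forall>b\<in>\<Lambda>. le a b \<longrightarrow> supp (g b) \<subseteq> supp (g a)) \<and>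
           (\<forall>U. 0 \<in> interior U \<longrightarrow> (\<exists>l0\<in>\<Lambda>. \<forall>l\<in>\<Lambda>. le l0 l \<longrightarrow> supp (g l) \<subseteq> U)) \<and>
           (\<forall>l\<in>\<Lambda>. (LINT t|m. g l t) = 1) \<and>
           (\<forall>f \<in> Orlicz_space \<Phi> \<nu>. \<forall>\<epsilon>>0. \<exists>l0\<in>\<Lambda>. \<forall>l\<in>\<Lambda>. le l0 l \<longrightarrow>
              Orlicz_norm \<Phi> \<nu> (\<lambda>t. convolution m (g l) f t - f t) < \<epsilon>)"
proof -
  interpret invariant_Orlicz_setting \<Phi> \<nu> m
    by unfold_locales (rule assms)+
  define \<Lambda> where "\<Lambda> = {U :: 'g set. open U \<and> 0 \<in> U}"
  have "\<exists>\<gamma>. kernel \<gamma> \<and> \<gamma> 0 \<noteq> 0 \<and> supp (\<lambda>t. complex_of_real (\<gamma> t)) \<subseteq> U" if "U \<in> \<Lambda>" for U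
    using kernel_with_support_in[of U] that unfolding \<Lambda>_def by (metis mem_Collect_eq)
  then have "\<forall>U. \<exists>\<gamma>. U \<in> \<Lambda> \<longrightarrow> kernel \<gamma> \<and> \<gamma> 0 \<noteq> 0 \<and> supp (\<lambda>t. complex_of_real (\<gamma> t)) \<subseteq> U"
    by simp
  from choice[OF this] obtain \<gamma> where *:
      "\<forall>U. U \<in> \<Lambda> \<longrightarrow> kernel (\<gamma> U) \<and> \<gamma> U 0 \<noteq> 0 \<and> supp (\<lambda>t. complex_of_real (\<gamma> U t)) \<subseteq> U"
    by (elim exE)
  define g where "g = (\<lambda>U t. complex_of_real (\<gamma> U t))"
  have \<gamma>: "kernel (\<gamma> U)" "\<gamma> U 0 \<noteq> 0" "supp (g U) \<subseteq> U" if "U \<in> \<Lambda>" for U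
    using * that by (simp_all add: g_def)
  \<comment> \<open>Ordering by the supports themselves, rather than by inclusion of the
     neighbourhoods, makes the supports decrease along the net.\<close>
  define le where "le = (\<lambda>U V. supp (g V) \<subseteq> supp (g U))"
  have nonzero_supp: "t \<in> supp (g U)" if "\<gamma> U t \<noteq> 0" for U t
    using that closure_subset[of "{t. g U t \<noteq> 0}"] by (auto simp: supp_def g_def)
  have cont: "continuous_on UNIV (g U)" if "U \<in> \<Lambda>" for U
    unfolding g_def by (intro continuous_intros kernelD(1)[OF \<gamma>(1)[OF that]])
  have "directed_set \<Lambda> le"
    unfolding directed_set_def
  proof (intro conjI ballI impI)
    have "UNIV \<in> \<Lambda>" by (simp add: \<Lambda>_def)
    then show "\<Lambda> \<noteq> {}" by blast
    show "le U U" for U by (simp add: le_def)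
    show "le U W" if "le U V" "le V W" for U V W using that by (simp add: le_def)
    fix U V assume UV: "U \<in> \<Lambda>" "V \<in> \<Lambda>"
    \<comment> \<open>This set contains 0 because neither kernel vanishes there.\<close>
    define W where "W = {t. \<gamma> U t \<noteq> 0} \<inter> {t. \<gamma> V t \<noteq> 0}"
    have "open W"
      unfolding W_def
      by (intro open_Int open_Collect_neq continuous_intros kernelD(1) \<gamma>(1) UV)
    then have W: "W \<in> \<Lambda>" using \<gamma>(2)[OF UV(1)] \<gamma>(2)[OF UV(2)] by (simp add: \<Lambda>_def W_def)
    have "W \<subseteq> supp (g U)" "W \<subseteq> supp (g V)" using nonzero_supp by (auto simp: W_def)
    then have "le U W" "le V W" using \<gamma>(3)[OF W] by (auto simp: le_def)
    with W show "\<exists>W\<in>\<Lambda>. le U W \<and> le V W" by blast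
  qed
  moreover have "\<forall>l\<in>\<Lambda>. g l \<in> Orlicz_space \<Phi> \<nu>" using cont continuous_in_Orlicz_space by simp
  moreover have "\<forall>l\<in>\<Lambda>. continuous_on UNIV (g l)" using cont by simp
  moreover have "\<forall>l\<in>\<Lambda>. \<forall>t. g l t \<in> \<real>\<^sub>\<ge>\<^sub>0"
    using kernelD(2)[OF \<gamma>(1)] by (simp add: g_def)
  moreover have "\<forall>a\<in>\<Lambda>. \<forall>b\<in>\<Lambda>. le a b \<longrightarrow> supp (g b) \<subseteq> supp (g a)" by (simp add: le_def)
  moreover have "\<forall>U. 0 \<in> interior U \<longrightarrow> (\<exists>l0\<in>\<Lambda>. \<forall>l\<in>\<Lambda>. le l0 l \<longrightarrow> supp (g l) \<subseteq> U)"
  proof (intro allI impI)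
    fix U :: "'g set" assume "0 \<in> interior U"
    then have U: "interior U \<in> \<Lambda>" by (simp add: \<Lambda>_def)
    have "supp (g l) \<subseteq> U" if "le (interior U) l" for l
      using that \<gamma>(3)[OF U] interior_subset[of U] by (simp add: le_def)
    with U show "\<exists>l0\<in>\<Lambda>. \<forall>l\<in>\<Lambda>. le l0 l \<longrightarrow> supp (g l) \<subseteq> U" by blast
  qed
  moreover have "\<forall>l\<in>\<Lambda>. (LINT t|m. g l t) = 1"
    using kernelD(3)[OF \<gamma>(1)] by (simp add: g_def)
  moreover have "\<forall>f \<in> Orlicz_space \<Phi> \<nu>. \<forall>\<epsilon>>0. \<exists>l0\<in>\<Lambda>. \<forall>l\<in>\<Lambda>. le l0 l \<longrightarrow>
      Orlicz_norm \<Phi> \<nu> (\<lambda>t. convolution m (g l) f t - f t) < \<epsilon>"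
  proof (intro ballI allI impI)
    fix f and \<epsilon> :: ennreal assume f: "f \<in> Orlicz_space \<Phi> \<nu>" and \<epsilon>: "0 < \<epsilon>"
    obtain e where e: "0 < e" "ennreal e < \<epsilon>" using ennreal_pos_real_below[OF \<epsilon>] by metis
    obtain U where U: "open U" "0 \<in> U"
      "\<forall>\<gamma>. kernel \<gamma> \<longrightarrow> (\<forall>s. \<gamma> s \<noteq> 0 \<longrightarrow> s \<in> U) \<longrightarrow> nrm (\<lambda>t. conv \<gamma> f t - f t) \<le> ennreal e"
      by (rule approximate_identity[OF Orlicz_space_subset_C_closure[OF f] e(1)])
    have U\<Lambda>: "U \<in> \<Lambda>" using U by (simp add: \<Lambda>_def)
    have "nrm (\<lambda>t. convolution m (g l) f t - f t) < \<epsilon>" if l: "l \<in> \<Lambda>" "le U l" for l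
    proof -
      have "s \<in> U" if "\<gamma> l s \<noteq> 0" for s
        using nonzero_supp[OF that] l(2) \<gamma>(3)[OF U\<Lambda>] by (auto simp: le_def)
      then have "nrm (\<lambda>t. conv (\<gamma> l) f t - f t) \<le> ennreal e"
        using U(3) \<gamma>(1)[OF l(1)] by simp
      then show ?thesis using e(2) unfolding g_def by (rule le_less_trans)
    qed
    with U\<Lambda> show "\<exists>l0\<in>\<Lambda>. \<forall>l\<in>\<Lambda>. le l0 l \<longrightarrow>
        Orlicz_norm \<Phi> \<nu> (\<lambda>t. convolution m (g l) f t - f t) < \<epsilon>" by blast
  qed
  ultimately show ?thesis by (intro exI conjI)
qed

end
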